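(* There exist a field $K$ and an integer $n$ for which there is no family of maps $$p_G\colon H^1(K,G)\to H^1(K,G),$$ defined for all reductive $K$-groups $G$, such that: (functoriality in $G$) for every homomorphism $\varphi\colon G\to G'$ of reductive $K$-groups and every $\xi\in H^1(K,G)$ one has $\varphi_*(p_G(\xi))=p_{G'}(\varphi_*(\xi))$; and, for every $K$-torus $T$ and every $\xi\in H^1(K,T)$, $p_T(\xi)=\xi^n$, the $n$-th power of $\xi$ in the abelian group $H^1(K,T)$.
   Context: Reductive groups are assumed to be connected. $H^1(K,G)=H^1(\mathrm{Gal}(K^s/K),G(K^s))$ is the first Galois cohomology pointed set, where $K^s$ is a separable closure of $K$; for a torus it is an abelian group, written multiplicatively. *)

theory Defs
  imports "HOL-Algebra.Algebraic_Closure" "HOL-Analysis.Function_Topology"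
begin

text \<open>
  The base field is a subfield \<open>K\<close> of an algebraic closure \<open>L\<close> of \<open>K\<close> (the library locale
  \<^locale>\<open>algebraic_closure\<close>). Smooth affine algebraic groups over \<open>K\<close> are treated
  in the classical way, as Zariski closed subgroups of some \<open>GL\<^sub>m(L)\<close> defined over \<open>K\<close>; every
  affine algebraic group, in particular every reductive group, is of this kind up to
  \<open>K\<close>-isomorphism.

  HOL has no existential quantification over types, so ``there is a field'' has to be stated for
  field structures carried by subsets of one concrete type. The type \<^typ>\<open>complex\<close> used for this
  purpose only serves as a set of the cardinality of the continuum: the ring operations of \<open>L\<close>
  are arbitrary, and \<open>K\<close> may have any characteristic.
\<close>

type_synonym 'a sqmat = "nat \<times> nat \<Rightarrow> 'a"

record 'a lin_group =
  deg :: nat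
  points :: "'a sqmat set"

abbreviation idx :: "nat \<Rightarrow> (nat \<times> nat) set"
  where "idx m \<equiv> {..<m} \<times> {..<m}"


context algebraic_closure
begin

subsection \<open>Linear algebraic groups\<close>

definition mat_ring :: "nat \<Rightarrow> 'a sqmat ring"
  where "mat_ring m =
    \<lparr>carrier = idx m \<rightarrow>\<^sub>E carrier L,
     monoid.mult = (\<lambda>A B. \<lambda>(i, j)\<in>idx m. \<Oplus>k\<in>{..<m}. A (i, k) \<otimes> B (k, j)),
     one = (\<lambda>(i, j)\<in>idx m. if i = j then \<one> else \<zero>),
     zero = (\<lambda>(i, j)\<in>idx m. \<zero>),
     add = (\<lambda>A B. \<lambda>ij\<in>idx m. A ij \<oplus> B ij)\<rparr>"

definition GL :: "nat \<Rightarrow> 'a sqmat monoid"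
  where "GL m = units_of (mat_ring m)"

text \<open>
  Regular functions on \<open>GL\<^sub>m\<close> with coefficients in the subring \<open>F\<close>: the \<open>F\<close>-algebra generated by
  the entries of \<open>g\<close> and of its inverse, i.e. by the entries of \<open>g\<close> and \<open>1 / det g\<close>. As \<open>L\<close> is
  infinite, elements of the coordinate ring may be identified with functions on \<open>GL\<^sub>m(L)\<close>.
\<close>

inductive_set reg_fun :: "'a set \<Rightarrow> nat \<Rightarrow> ('a sqmat \<Rightarrow> 'a) set"
  for F :: "'a set" and m :: nat
  where
    const: "a \<in> F \<Longrightarrow> (\<lambda>g\<in>carrier (GL m). a) \<in> reg_fun F m"
  | entry: "ij \<in> idx m \<Longrightarrow> (\<lambda>g\<in>carrier (GL m). g ij) \<in> reg_fun F m"
  | inv_entry: "ij \<in> idx m \<Longrightarrow> (\<lambda>g\<in>carrier (GL m). (inv\<^bsub>GL m\<^esub> g) ij) \<in> reg_fun F m"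
  | add: "f \<in> reg_fun F m \<Longrightarrow> h \<in> reg_fun F m \<Longrightarrow>
      (\<lambda>g\<in>carrier (GL m). f g \<oplus> h g) \<in> reg_fun F m"
  | mult: "f \<in> reg_fun F m \<Longrightarrow> h \<in> reg_fun F m \<Longrightarrow>
      (\<lambda>g\<in>carrier (GL m). f g \<otimes> h g) \<in> reg_fun F m"

definition zariski_closed :: "nat \<Rightarrow> 'a sqmat set \<Rightarrow> bool"
  where "zariski_closed m Z \<longleftrightarrow>
    (\<exists>S \<subseteq> reg_fun (carrier L) m. Z = {g \<in> carrier (GL m). \<forall>f\<in>S. f g = \<zero>})"

definition zariski_connected :: "nat \<Rightarrow> 'a sqmat set \<Rightarrow> bool"
  where "zariski_connected m Z \<longleftrightarrow>
    \<not> (\<exists>A B. zariski_closed m A \<and> zariski_closed m B \<and> A \<noteq> {} \<and> B \<noteq> {} \<and>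
         A \<inter> B = {} \<and> A \<union> B = Z)"

definition vanishing :: "'a set \<Rightarrow> nat \<Rightarrow> 'a sqmat set \<Rightarrow> ('a sqmat \<Rightarrow> 'a) set"
  where "vanishing F m Z = {f \<in> reg_fun F m. \<forall>g\<in>Z. f g = \<zero>}"

text \<open>
  Being the zero set of functions over \<open>K\<close> is not enough over an imperfect field: the
  vanishing ideal over \<open>L\<close> has to be spanned by the one over \<open>K\<close>.
\<close>

definition defined_over_base :: "nat \<Rightarrow> 'a sqmat set \<Rightarrow> bool"
  where "defined_over_base m Z \<longleftrightarrow>
    (\<forall>f \<in> vanishing (carrier L) m Z.
       \<exists>(r::nat) a h. a \<in> {..<r} \<rightarrow> carrier L \<and> h \<in> {..<r} \<rightarrow> vanishing K m Z \<and>
         f = (\<lambda>g\<in>carrier (GL m). \<Oplus>i\<in>{..<r}. a i \<otimes> h i g))"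

definition algebraic_group :: "'a lin_group \<Rightarrow> bool"
  where "algebraic_group G \<longleftrightarrow>
    subgroup (points G) (GL (deg G)) \<and> zariski_closed (deg G) (points G)"

definition K_group :: "'a lin_group \<Rightarrow> bool"
  where "K_group G \<longleftrightarrow> algebraic_group G \<and> defined_over_base (deg G) (points G)"

abbreviation grp :: "'a lin_group \<Rightarrow> 'a sqmat monoid"
  where "grp G \<equiv> (GL (deg G))\<lparr>carrier := points G\<rparr>"

text \<open>Homomorphisms of algebraic groups that are defined over \<open>F\<close>.\<close>

definition alg_hom :: "'a set \<Rightarrow> 'a lin_group \<Rightarrow> 'a lin_group \<Rightarrow> ('a sqmat \<Rightarrow> 'a sqmat) set"
  where "alg_hom F G G' = {\<phi> \<in> hom (grp G) (grp G').
    \<forall>ij\<in>idx (deg G'). \<exists>f\<in>reg_fun F (deg G). \<forall>g\<in>points G. \<phi> g ij = f g}"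

definition alg_isomorphic :: "'a set \<Rightarrow> 'a lin_group \<Rightarrow> 'a lin_group \<Rightarrow> bool"
  where "alg_isomorphic F G G' \<longleftrightarrow>
    (\<exists>\<phi>\<in>alg_hom F G G'. \<exists>\<psi>\<in>alg_hom F G' G.
       (\<forall>g\<in>points G. \<psi> (\<phi> g) = g) \<and> (\<forall>g\<in>points G'. \<phi> (\<psi> g) = g))"

definition unipotent :: "nat \<Rightarrow> 'a sqmat \<Rightarrow> bool"
  where "unipotent m g \<longleftrightarrow>
    (\<exists>k::nat. (g \<ominus>\<^bsub>mat_ring m\<^esub> \<one>\<^bsub>mat_ring m\<^esub>) [^]\<^bsub>mat_ring m\<^esub> k = \<zero>\<^bsub>mat_ring m\<^esub>)"

text \<open>
  Reductive groups are connected by convention. The condition on \<open>U\<close> says that the unipotent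
  radical is trivial; \<open>U\<close> is not required to be defined over \<open>K\<close>.
\<close>

definition reductive :: "'a lin_group \<Rightarrow> bool"
  where "reductive G \<longleftrightarrow>
    K_group G \<and> zariski_connected (deg G) (points G) \<and>
    (\<forall>U. U \<lhd> grp G \<and> zariski_closed (deg G) U \<and> zariski_connected (deg G) U \<and>
         (\<forall>g\<in>U. unipotent (deg G) g) \<longrightarrow> U = {\<one>\<^bsub>GL (deg G)\<^esub>})"

definition diag_group :: "nat \<Rightarrow> 'a lin_group"
  where "diag_group r = \<lparr>deg = r,
    points = {g \<in> carrier (GL r). \<forall>(i, j)\<in>idx r. i \<noteq> j \<longrightarrow> g (i, j) = \<zero>}\<rparr>"

definition K_torus :: "'a lin_group \<Rightarrow> bool"
  where "K_torus T \<longleftrightarrow> K_group T \<and> (\<exists>r. alg_isomorphic (carrier L) T (diag_group r))"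


subsection \<open>Galois cohomology\<close>

definition sep_closure :: "'a set"
  where "sep_closure = {x \<in> carrier L. \<forall>y\<in>carrier L. alg_mult (Irr K x) y \<le> 1}"

definition Gal :: "('a \<Rightarrow> 'a) set"
  where "Gal = {s \<in> ring_iso (L\<lparr>carrier := sep_closure\<rparr>) (L\<lparr>carrier := sep_closure\<rparr>).
    s \<in> extensional sep_closure \<and> (\<forall>a\<in>K. s a = a)}"

text \<open>The Krull topology is the topology of pointwise convergence, with discrete values.\<close>

definition krull_topology :: "('a \<Rightarrow> 'a) topology"
  where "krull_topology =
    subtopology (product_topology (\<lambda>_. discrete_topology sep_closure) sep_closure) Gal"

definition sep_points :: "'a lin_group \<Rightarrow> 'a sqmat set"
  where "sep_points G = {g \<in> points G. \<forall>ij\<in>idx (deg G). g ij \<in> sep_closure}"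

definition gal_act :: "nat \<Rightarrow> ('a \<Rightarrow> 'a) \<Rightarrow> 'a sqmat \<Rightarrow> 'a sqmat"
  where "gal_act m s g = (\<lambda>ij\<in>idx m. s (g ij))"

definition cocycles :: "'a lin_group \<Rightarrow> (('a \<Rightarrow> 'a) \<Rightarrow> 'a sqmat) set"
  where "cocycles G = {c \<in> Gal \<rightarrow>\<^sub>E sep_points G.
    continuous_map krull_topology (discrete_topology (sep_points G)) c \<and>
    (\<forall>s\<in>Gal. \<forall>t\<in>Gal.
       c (compose sep_closure s t) = c s \<otimes>\<^bsub>GL (deg G)\<^esub> gal_act (deg G) s (c t))}"

definition cohomologous :: "'a lin_group \<Rightarrow>
    ((('a \<Rightarrow> 'a) \<Rightarrow> 'a sqmat) \<times> (('a \<Rightarrow> 'a) \<Rightarrow> 'a sqmat)) set"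
  where "cohomologous G = {(c, d). c \<in> cocycles G \<and> d \<in> cocycles G \<and>
    (\<exists>g\<in>sep_points G. \<forall>s\<in>Gal.
       d s = inv\<^bsub>GL (deg G)\<^esub> g \<otimes>\<^bsub>GL (deg G)\<^esub> c s \<otimes>\<^bsub>GL (deg G)\<^esub> gal_act (deg G) s g)}"

definition H1 :: "'a lin_group \<Rightarrow> (('a \<Rightarrow> 'a) \<Rightarrow> 'a sqmat) set set"
  where "H1 G = cocycles G // cohomologous G"

text \<open>The map \<open>H\<^sup>1(K, G) \<rightarrow> H\<^sup>1(K, G')\<close> induced by a \<open>K\<close>-homomorphism \<open>\<phi> : G \<rightarrow> G'\<close>.\<close>

definition H1_map :: "'a lin_group \<Rightarrow> ('a sqmat \<Rightarrow> 'a sqmat) \<Rightarrow>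
    (('a \<Rightarrow> 'a) \<Rightarrow> 'a sqmat) set \<Rightarrow> (('a \<Rightarrow> 'a) \<Rightarrow> 'a sqmat) set"
  where "H1_map G' \<phi> \<xi> = cohomologous G' `` ((\<lambda>c. \<lambda>s\<in>Gal. \<phi> (c s)) ` \<xi>)"

text \<open>Multiplication of classes through pointwise products of cocycles; meant for commutative \<open>T\<close>.\<close>

definition H1_group :: "'a lin_group \<Rightarrow> (('a \<Rightarrow> 'a) \<Rightarrow> 'a sqmat) set monoid"
  where "H1_group T =
    \<lparr>carrier = H1 T,
     monoid.mult = (\<lambda>\<xi> \<eta>. cohomologous T ``
       {\<lambda>s\<in>Gal. c s \<otimes>\<^bsub>GL (deg T)\<^esub> d s | c d. c \<in> \<xi> \<and> d \<in> \<eta>}),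
     one = cohomologous T `` {\<lambda>s\<in>Gal. \<one>\<^bsub>GL (deg T)\<^esub>}\<rparr>"


subsection \<open>Functorial power operations\<close>

definition power_operation :: "int \<Rightarrow>
    ('a lin_group \<Rightarrow> (('a \<Rightarrow> 'a) \<Rightarrow> 'a sqmat) set \<Rightarrow> (('a \<Rightarrow> 'a) \<Rightarrow> 'a sqmat) set) \<Rightarrow> bool"
  where "power_operation n p \<longleftrightarrow>
    (\<forall>G. reductive G \<longrightarrow> p G \<in> H1 G \<rightarrow> H1 G) \<and>
    (\<forall>G G' \<phi> \<xi>. reductive G \<and> reductive G' \<and> \<phi> \<in> alg_hom K G G' \<and> \<xi> \<in> H1 G \<longrightarrow>
       H1_map G' \<phi> (p G \<xi>) = p G' (H1_map G' \<phi> \<xi>)) \<and>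
    (\<forall>T \<xi>. K_torus T \<and> \<xi> \<in> H1 T \<longrightarrow> p T \<xi> = \<xi> [^]\<^bsub>H1_group T\<^esub> n)"

end

end

theory Submission
  imports Defs "HOL-Computational_Algebra.Fundamental_Theorem_Algebra" "HOL-Algebra.Algebraic_Closure_Type"
begin

text \<open>
  The number $n = 2$ already fails. Suppose that a maximal torus $T$ of a reductive group $G$ carries
  classes \<open>\<xi>\<close> and \<open>\<eta>\<close> such that \<open>\<xi>\<close> and \<open>\<xi>\<eta>\<close> become equal in $H^1(K, G)$ but \<open>\<xi>\<^sup>2\<close> and
  \<open>\<xi>\<^sup>2\<eta>\<^sup>2\<close> do not. Functoriality along the inclusion of $T$ in $G$ would force the operation on
  $H^1(K, G)$ to send the common image of \<open>\<xi>\<close> and \<open>\<xi>\<eta>\<close> to the images of \<open>\<xi>\<^sup>2\<close> and of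
  \<open>\<xi>\<^sup>2\<eta>\<^sup>2\<close>, so no such operation exists.

  Such classes come from symbol algebras of degree 3. Let $K$ contain a primitive cube root of unity
  \<open>\<zeta>\<close> and elements $a = u^3$, $b = v^3$, $c = w^3$, let $A$ be the symbol algebra $(a, b)$, and
  let $E = K(u)$. The group is $G = (SL_1(A) \times R^1_{E/K} G_m) / \mu_3$, up to replacing $A$ by its
  opposite. It is a form of the group \<open>std\<close> of all \<open>x \<otimes> y\<close> with $x$ in $GL_3$, with $y$ diagonal
  and $\det x \det y = 1$. The class \<open>\<eta>\<close> is the image of $c$ under
  $K^*/K^{*3} = H^1(K, \mu_3)$, placed in the centre; it dies in a twist of $G$ if $c$ is a reduced norm
  of the algebra that replaces $A$ there. The class \<open>\<xi>\<close> is chosen so that twisting by \<open>\<xi>\<^sup>l\<close> replaces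
  $(a, b)$ by $(a, b^{1-l})$. For $l = 1$ this is
  the split algebra $(a, 1)$, for which everything is a reduced norm, so \<open>\<xi> = \<xi>\<eta>\<close> in
  $H^1(K, G)$; this is lemma \<open>cohomologous_01_11\<close>. For $l = 2$ it is again a
  division algebra, and \<open>\<xi>\<^sup>2 = \<xi>\<^sup>2\<eta>\<^sup>2\<close> would make $c^{-2}$ a reduced norm; this is lemma
  \<open>not_cohomologous_02_22\<close>. There the equation $g \cdot c'(s) = c(s) \cdot s(g)$ is solved
  by hand: a finite Fourier transform turns the entries of $g$ into nine elements of $K$, and the
  determinant condition on $g$ becomes the norm equation.

  The base field must satisfy two conditions: $c^{-2}$ is not a reduced norm from $(a, b)$, and all
  complex numbers are algebraic over $K$, so that they form its algebraic closure. For
  algebraically independent $a$, $b$, $c$ the first condition follows by comparing degrees modulo 3.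
  It survives the adjunction of a further transcendental element, by specialisation; hence a subfield of
  the complex numbers that is maximal with the first condition has the second
  (lemma \<open>exists_base_field\<close>).

  The rest makes the language of algebraic groups available. In characteristic 0 the separable
  closure is everything, and by Zorn's lemma the fixed field of the Galois group is $K$. A closed set
  that is stable under the Galois group is defined over $K$, by Artin's independence argument
  (\<open>defined_over_base_if_stable\<close>). A set whose points are pairwise joined by rational curves is
  connected (\<open>zariski_connected_if_joined\<close>). A normal unipotent subgroup of \<open>std\<close> is trivial, because
  the trace is constant on unipotent elements (\<open>unipotent_normal_std\<close>).
\<close>

section \<open>Subfields and simple extensions\<close>

definition is_subfield :: "'a::field set \<Rightarrow> bool"
  where "is_subfield F \<longleftrightarrow> 0 \<in> F \<and> 1 \<in> F \<and> (\<forall>x\<in>F. \<forall>y\<in>F. x + y \<in> F) \<and> (\<forall>x\<in>F. - x \<in> F) \<and>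
     (\<forall>x\<in>F. \<forall>y\<in>F. x * y \<in> F) \<and> (\<forall>x\<in>F. inverse x \<in> F)"

lemma is_subfieldD:
  assumes "is_subfield F"
  shows "0 \<in> F" "1 \<in> F" "x \<in> F \<Longrightarrow> y \<in> F \<Longrightarrow> x + y \<in> F" "x \<in> F \<Longrightarrow> - x \<in> F"
    "x \<in> F \<Longrightarrow> y \<in> F \<Longrightarrow> x * y \<in> F" "x \<in> F \<Longrightarrow> inverse x \<in> F"
    "x \<in> F \<Longrightarrow> y \<in> F \<Longrightarrow> x - y \<in> F" "x \<in> F \<Longrightarrow> y \<in> F \<Longrightarrow> x / y \<in> F"
    "x \<in> F \<Longrightarrow> x ^ n \<in> F" "of_nat n \<in> F" "numeral k \<in> F"
proof -
  note * = assms[unfolded is_subfield_def]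
  show 1: "0 \<in> F" "1 \<in> F" "x \<in> F \<Longrightarrow> y \<in> F \<Longrightarrow> x + y \<in> F" "x \<in> F \<Longrightarrow> - x \<in> F"
    "x \<in> F \<Longrightarrow> y \<in> F \<Longrightarrow> x * y \<in> F" "x \<in> F \<Longrightarrow> inverse x \<in> F" for x y
    using * by auto
  show "x \<in> F \<Longrightarrow> y \<in> F \<Longrightarrow> x - y \<in> F" using 1(3)[of x "-y"] 1(4) by auto
  show "x \<in> F \<Longrightarrow> y \<in> F \<Longrightarrow> x / y \<in> F" using 1(5)[of x "inverse y"] 1(6) by (auto simp: divide_inverse)
  show "x \<in> F \<Longrightarrow> x ^ n \<in> F" by (induction n) (auto intro: 1)
  show of_nat: "of_nat n \<in> F" for n by (induction n) (auto intro: 1)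
  show "numeral k \<in> F" using of_nat[of "numeral k"] by simp
qed

lemma is_subfield_sum:
  assumes "is_subfield F" "\<And>i. i \<in> I \<Longrightarrow> f i \<in> F"
  shows "sum f I \<in> F"
  using assms(2) by (induction I rule: infinite_finite_induct) (auto intro: is_subfieldD[OF assms(1)])

lemma is_subfield_UN_chain:
  assumes "\<And>F. F \<in> C \<Longrightarrow> is_subfield F" "C \<noteq> {}" "\<And>F G. F \<in> C \<Longrightarrow> G \<in> C \<Longrightarrow> F \<subseteq> G \<or> G \<subseteq> F"
  shows "is_subfield (\<Union>C)"
proof -
  have c: "\<exists>F\<in>C. x \<in> F \<and> y \<in> F" if "x \<in> \<Union>C" "y \<in> \<Union>C" for x y
    using that assms(3) by blast
  obtain F0 where F0: "F0 \<in> C" using assms(2) by blast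
  have "x + y \<in> \<Union>C" "x * y \<in> \<Union>C" if "x \<in> \<Union>C" "y \<in> \<Union>C" for x y
    using c[OF that] is_subfieldD(3,5)[OF assms(1)] by blast+
  moreover have "- x \<in> \<Union>C" "inverse x \<in> \<Union>C" if "x \<in> \<Union>C" for x
    using that is_subfieldD(4,6)[OF assms(1)] by blast+
  moreover have "0 \<in> \<Union>C" "1 \<in> \<Union>C" using F0 is_subfieldD(1,2)[OF assms(1)[OF F0]] by blast+
  ultimately show ?thesis unfolding is_subfield_def by blast
qed

definition polys :: "'a::field set \<Rightarrow> 'a poly set"
  where "polys F = {p. \<forall>i. Polynomial.coeff p i \<in> F}"

lemma polys_closed:
  assumes "is_subfield F"
  shows "0 \<in> polys F" "1 \<in> polys F" "p \<in> polys F \<Longrightarrow> q \<in> polys F \<Longrightarrow> p + q \<in> polys F"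
    "p \<in> polys F \<Longrightarrow> q \<in> polys F \<Longrightarrow> p * q \<in> polys F" "p \<in> polys F \<Longrightarrow> - p \<in> polys F"
    "p \<in> polys F \<Longrightarrow> q \<in> polys F \<Longrightarrow> p - q \<in> polys F"
    "x \<in> F \<Longrightarrow> p \<in> polys F \<Longrightarrow> pCons x p \<in> polys F"
    "p \<in> polys F \<Longrightarrow> p ^ n \<in> polys F" "p \<in> polys F \<Longrightarrow> pderiv p \<in> polys F"
    "x \<in> F \<Longrightarrow> p \<in> polys F \<Longrightarrow> smult x p \<in> polys F"
    "x \<in> F \<Longrightarrow> Polynomial.monom x n \<in> polys F"
    "numeral k \<in> polys F"
proof -
  note i = is_subfieldD[OF assms]
  have m: "p \<in> polys F \<longleftrightarrow> (\<forall>i. Polynomial.coeff p i \<in> F)" for p by (simp add: polys_def)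
  show 1: "1 \<in> polys F" unfolding m coeff_1 using i(1,2) by auto
  show pCons: "x \<in> F \<Longrightarrow> p \<in> polys F \<Longrightarrow> pCons x p \<in> polys F" for x p
    by (auto simp: m coeff_pCons split: nat.split)
  show mult: "p \<in> polys F \<Longrightarrow> q \<in> polys F \<Longrightarrow> p * q \<in> polys F" for p q
    unfolding m coeff_mult using i(5) by (blast intro: is_subfield_sum[OF assms])
  show "p \<in> polys F \<Longrightarrow> p ^ n \<in> polys F" by (induction n) (auto intro: 1 mult)
  show zero: "0 \<in> polys F" using i(1) by (simp add: m)
  have "[:numeral k:] \<in> polys F" by (rule pCons[OF i(11) zero])
  thus "numeral k \<in> polys F" by (simp add: numeral_poly)
  show "p \<in> polys F \<Longrightarrow> pderiv p \<in> polys F"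
    unfolding m coeff_pderiv using i(5,10) by blast
  show "p \<in> polys F \<Longrightarrow> q \<in> polys F \<Longrightarrow> p + q \<in> polys F"
    "p \<in> polys F \<Longrightarrow> - p \<in> polys F" "p \<in> polys F \<Longrightarrow> q \<in> polys F \<Longrightarrow> p - q \<in> polys F"
    using i(3,4,7) by (auto simp: m)
  show "x \<in> F \<Longrightarrow> p \<in> polys F \<Longrightarrow> smult x p \<in> polys F" "x \<in> F \<Longrightarrow> Polynomial.monom x n \<in> polys F"
    using i(1,5) by (auto simp: m Polynomial.coeff_monom)
qed

lemma poly_in_subfield:
  assumes "is_subfield F" "p \<in> polys F" "t \<in> F"
  shows "poly p t \<in> F"
  unfolding poly_altdef
  by (rule is_subfield_sum[OF assms(1)])
     (use assms in \<open>auto simp: polys_def intro: is_subfieldD[OF assms(1)]\<close>)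

definition adjoin :: "'a::field set \<Rightarrow> 'a \<Rightarrow> 'a set"
  where "adjoin F t = {poly p t / poly q t | p q. p \<in> polys F \<and> q \<in> polys F \<and> poly q t \<noteq> 0}"

lemma adjoinI: "p \<in> polys F \<Longrightarrow> q \<in> polys F \<Longrightarrow> poly q t \<noteq> 0 \<Longrightarrow> poly p t / poly q t \<in> adjoin F t"
  by (auto simp: adjoin_def)

lemma adjoinE:
  assumes "x \<in> adjoin F t"
  obtains p q where "p \<in> polys F" "q \<in> polys F" "poly q t \<noteq> 0" "x = poly p t / poly q t"
  using assms by (auto simp: adjoin_def)

lemma subset_adjoin: assumes "is_subfield F" shows "F \<subseteq> adjoin F t"
proof
  fix x assume "x \<in> F"
  then have "poly [:x:] t / poly 1 t \<in> adjoin F t"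
    by (intro adjoinI) (auto intro: polys_closed[OF assms])
  then show "x \<in> adjoin F t" by simp
qed

lemma mem_adjoin: assumes "is_subfield F" shows "t \<in> adjoin F t"
proof -
  have "poly [:0, 1:] t / poly 1 t \<in> adjoin F t"
    by (intro adjoinI) (auto intro: polys_closed[OF assms] is_subfieldD[OF assms])
  then show ?thesis by simp
qed

lemma is_subfield_adjoin:
  assumes "is_subfield F" shows "is_subfield (adjoin F t)"
proof -
  note c = polys_closed[OF assms]
  have 1: "0 \<in> adjoin F t" "1 \<in> adjoin F t"
    using subset_adjoin[OF assms] is_subfieldD(1,2)[OF assms] by blast+
  have "x + y \<in> adjoin F t \<and> x * y \<in> adjoin F t" if xy: "x \<in> adjoin F t" "y \<in> adjoin F t" for x y
  proof -
    from xy(1) obtain p q where pq: "p \<in> polys F" "q \<in> polys F" "poly q t \<noteq> 0" "x = poly p t / poly q t"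
      by (rule adjoinE)
    from xy(2) obtain p' q' where pq': "p' \<in> polys F" "q' \<in> polys F" "poly q' t \<noteq> 0" "y = poly p' t / poly q' t"
      by (rule adjoinE)
    have "x + y = poly (p * q' + p' * q) t / poly (q * q') t" "x * y = poly (p * p') t / poly (q * q') t"
      unfolding pq(4) pq'(4) using pq(3) pq'(3) by (simp_all add: field_simps)
    moreover have "poly (p * q' + p' * q) t / poly (q * q') t \<in> adjoin F t"
      by (rule adjoinI) (use pq pq' c in auto)
    moreover have "poly (p * p') t / poly (q * q') t \<in> adjoin F t"
      by (rule adjoinI) (use pq pq' c in auto)
    ultimately show ?thesis by simp
  qed
  moreover have "- x \<in> adjoin F t \<and> inverse x \<in> adjoin F t" if x: "x \<in> adjoin F t" for x
  proof -
    from x obtain p q where pq: "p \<in> polys F" "q \<in> polys F" "poly q t \<noteq> 0" "x = poly p t / poly q t"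
      by (rule adjoinE)
    have "poly (- p) t / poly q t \<in> adjoin F t"
      by (rule adjoinI) (use pq c in auto)
    moreover have "poly p t = 0 \<or> poly q t / poly p t \<in> adjoin F t"
      using adjoinI[OF pq(2,1)] by blast
    ultimately show ?thesis using pq 1 by auto
  qed
  ultimately show ?thesis unfolding is_subfield_def using 1 by blast
qed

text \<open>
  All arguments about \<open>adjoin F t\<close> clear denominators first and then compare polynomials in \<open>t\<close>.
\<close>
lemma adjoin_common_denominator:
  assumes F: "is_subfield F" and "finite I" "\<And>i. i \<in> I \<Longrightarrow> y i \<in> adjoin F t"
  obtains q Y where "q \<in> polys F" "poly q t \<noteq> 0" "\<And>i. i \<in> I \<Longrightarrow> Y i \<in> polys F"
    "\<And>i. i \<in> I \<Longrightarrow> y i = poly (Y i) t / poly q t"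
proof -
  note c = polys_closed[OF F]
  have "\<exists>q Y. q \<in> polys F \<and> poly q t \<noteq> 0 \<and> (\<forall>i\<in>I. Y i \<in> polys F \<and> y i = poly (Y i) t / poly q t)"
    using assms(2,3)
  proof (induction I)
    case empty
    show ?case by (rule exI[of _ 1]) (auto intro: c)
  next
    case (insert j I)
    then obtain q Y where q: "q \<in> polys F" "poly q t \<noteq> 0"
      and Y: "\<forall>i\<in>I. Y i \<in> polys F \<and> y i = poly (Y i) t / poly q t" by auto
    from insert.prems[of j] obtain p q' where
      pq: "p \<in> polys F" "q' \<in> polys F" "poly q' t \<noteq> 0" "y j = poly p t / poly q' t"
      by (auto elim: adjoinE)
    show ?case
    proof (intro exI conjI ballI)
      show "q * q' \<in> polys F" "poly (q * q') t \<noteq> 0" using q pq c by auto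
      fix i assume i: "i \<in> insert j I"
      show "(if i = j then p * q else Y i * q') \<in> polys F"
        "y i = poly (if i = j then p * q else Y i * q') t / poly (q * q') t"
        using i q pq Y c insert.hyps by auto
    qed
  qed
  then show thesis using that by blast
qed

definition transc :: "'a::field set \<Rightarrow> 'a \<Rightarrow> bool"
  where "transc F t \<longleftrightarrow> (\<forall>p\<in>polys F. poly p t = 0 \<longrightarrow> p = 0)"

lemma countable_polys:
  assumes "countable F"
  shows "countable (polys F)"
proof -
  have "polys F \<subseteq> Poly ` lists F"
  proof
    fix p assume "p \<in> polys F"
    then have "Polynomial.coeff p i \<in> F" for i by (simp add: polys_def)
    then have "set (coeffs p) \<subseteq> F" unfolding coeffs_def by auto
    then have "Poly (coeffs p) \<in> Poly ` lists F" by (intro imageI) auto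
    then show "p \<in> Poly ` lists F" by (simp only: Poly_coeffs)
  qed
  then show ?thesis
    by (rule countable_subset) (intro countable_image countable_lists assms)
qed

lemma countable_adjoin:
  assumes "countable F"
  shows "countable (adjoin F t)"
proof -
  have "adjoin F t \<subseteq> (\<lambda>(p, q). poly p t / poly q t) ` (polys F \<times> polys F)"
    by (force simp: adjoin_def)
  moreover have "countable ((\<lambda>(p, q). poly p t / poly q t) ` (polys F \<times> polys F))"
    using countable_polys[OF assms] by (intro countable_image countable_SIGMA)
  ultimately show ?thesis by (rule countable_subset)
qed

text \<open>
  There are only countably many polynomials with coefficients in a countable set, and each has finitely many roots.
\<close>
lemma exists_transc:
  assumes "countable (F :: complex set)"
  obtains t where "transc F t"
proof -
  define A where "A = (\<Union>p\<in>polys F - {0}. {t. poly p t = 0})"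
  have "countable A" unfolding A_def
    by (intro countable_UN countable_Diff countable_polys assms countable_finite poly_roots_finite) auto
  then have "A \<noteq> UNIV" using uncountable_UNIV_complex by auto
  then obtain t where "t \<notin> A" by auto
  then have "transc F t" by (auto simp: transc_def A_def)
  then show thesis by (rule that)
qed

section \<open>The reduced norm of a symbol algebra of degree three\<close>

text \<open>
  The norm form of $F[u]/(u^3 - a)$, evaluated at $x + y u + z u^2$.
\<close>
definition norm3 :: "'a::comm_ring_1 \<Rightarrow> 'a \<Rightarrow> 'a \<Rightarrow> 'a \<Rightarrow> 'a"
  where "norm3 a x y z = x * x * x + a * (y * y * y) + a * a * (z * z * z) - 3 * a * (x * y * z)"

definition mixed :: "'a::comm_ring_1 \<Rightarrow> 'a \<Rightarrow> (nat \<Rightarrow> nat \<Rightarrow> 'a) \<Rightarrow> 'a"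
  where "mixed a \<zeta> y = 3 * (y 0 0 * y 1 0 * y 2 0 + a * (y 0 1 * y 1 1 * y 2 1) + a * a * (y 0 2 * y 1 2 * y 2 2)
     + a * \<zeta> * \<zeta> * (y 0 0 * y 1 1 * y 2 2 + y 0 2 * y 1 0 * y 2 1 + y 0 1 * y 1 2 * y 2 0)
     + a * \<zeta> * (y 0 0 * y 1 2 * y 2 1 + y 0 1 * y 1 0 * y 2 2 + y 0 2 * y 1 1 * y 2 0))"

text \<open>
  The reduced norm of $\sum_{i,j} y_{ij} V^i U^j$ in the symbol algebra given by $U^3 = a$, $V^3 = b$ and
  \<open>U V = \<zeta> V U\<close>; see \<open>det3_symbol\<close> for its description as a determinant. The form \<open>mixed\<close>
  collects the monomials that involve all three powers of $V$.
\<close>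
definition reduced_norm :: "'a::comm_ring_1 \<Rightarrow> 'a \<Rightarrow> 'a \<Rightarrow> (nat \<Rightarrow> nat \<Rightarrow> 'a) \<Rightarrow> 'a"
  where "reduced_norm a b \<zeta> y = norm3 a (y 0 0) (y 0 1) (y 0 2) + b * norm3 a (y 1 0) (y 1 1) (y 1 2)
     + b * b * norm3 a (y 2 0) (y 2 1) (y 2 2) - b * mixed a \<zeta> y"

lemma poly_norm3: "poly (norm3 a x y z) t = norm3 (poly a t) (poly x t) (poly y t) (poly z t)"
  by (simp add: norm3_def)

lemma poly_mixed: "poly (mixed a \<zeta> y) t = mixed (poly a t) (poly \<zeta> t) (\<lambda>i j. poly (y i j) t)"
  by (simp add: mixed_def)

lemma poly_reduced_norm:
  "poly (reduced_norm a b \<zeta> y) t = reduced_norm (poly a t) (poly b t) (poly \<zeta> t) (\<lambda>i j. poly (y i j) t)"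
  by (simp add: reduced_norm_def poly_norm3 poly_mixed)

lemma norm3_scale: "norm3 a (r * x) (r * y) (r * z) = r ^ 3 * norm3 a x y z"
  by (simp add: norm3_def algebra_simps power3_eq_cube)

lemma reduced_norm_scale: "reduced_norm a b \<zeta> (\<lambda>i j. r * y i j) = r ^ 3 * reduced_norm a b \<zeta> y"
  by (simp add: reduced_norm_def norm3_def mixed_def algebra_simps power3_eq_cube)

lemma norm3_polys:
  assumes "is_subfield F" "a \<in> polys F" "x \<in> polys F" "y \<in> polys F" "z \<in> polys F"
  shows "norm3 a x y z \<in> polys F"
  unfolding norm3_def using assms(2-) by (intro polys_closed[OF assms(1)])

lemma mixed_polys:
  assumes "is_subfield F" "a \<in> polys F" "\<zeta> \<in> polys F" "\<And>i j. i < 3 \<Longrightarrow> j < 3 \<Longrightarrow> y i j \<in> polys F"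
  shows "mixed a \<zeta> y \<in> polys F"
  unfolding mixed_def using assms(2-) by (intro polys_closed[OF assms(1)]) auto

lemma reduced_norm_polys:
  assumes "is_subfield F" "a \<in> polys F" "b \<in> polys F" "\<zeta> \<in> polys F" "\<And>i j. i < 3 \<Longrightarrow> j < 3 \<Longrightarrow> y i j \<in> polys F"
  shows "reduced_norm a b \<zeta> y \<in> polys F"
  unfolding reduced_norm_def using assms(2-)
  by (intro polys_closed[OF assms(1)] norm3_polys mixed_polys assms(1)) auto

text \<open>
  The bounds $i$, $j$, $k$ need not be the exact degrees, so that the top coefficients of a cubic form in
  polynomials can be read off uniformly, some of them being zero.
\<close>
lemma coeff_mult3:
  fixes p q r :: "'a::comm_ring_1 poly"
  assumes "Polynomial.degree p \<le> i" "Polynomial.degree q \<le> j" "Polynomial.degree r \<le> k"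
  shows "Polynomial.degree (p * q * r) \<le> i + j + k"
    "Polynomial.coeff (p * q * r) (i + j + k) = Polynomial.coeff p i * Polynomial.coeff q j * Polynomial.coeff r k"
proof -
  have 1: "Polynomial.degree (p * q) \<le> i + j"
    using degree_mult_le[of p q] assms by linarith
  show "Polynomial.degree (p * q * r) \<le> i + j + k"
    using degree_mult_le[of "p * q" r] 1 assms by linarith
  have c: "Polynomial.coeff (f * g) (m + n) = Polynomial.coeff f m * Polynomial.coeff g n"
    if "Polynomial.degree f \<le> m" "Polynomial.degree g \<le> n" for f g :: "'a poly" and m n
  proof -
    have "Polynomial.coeff (f * g) (m + n) = (\<Sum>k\<le>m + n. Polynomial.coeff f k * Polynomial.coeff g (m + n - k))"
      by (simp add: coeff_mult)
    also have "\<dots> = (\<Sum>k\<in>{m}. Polynomial.coeff f k * Polynomial.coeff g (m + n - k))"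
    proof (rule sum.mono_neutral_right)
      show "\<forall>k\<in>{..m + n} - {m}. Polynomial.coeff f k * Polynomial.coeff g (m + n - k) = 0"
      proof
        fix k assume "k \<in> {..m + n} - {m}"
        then have "k > m \<or> m + n - k > n" by auto
        then show "Polynomial.coeff f k * Polynomial.coeff g (m + n - k) = 0"
          using that by (auto simp: coeff_eq_0)
      qed
    qed auto
    finally show ?thesis by simp
  qed
  show "Polynomial.coeff (p * q * r) (i + j + k) = Polynomial.coeff p i * Polynomial.coeff q j * Polynomial.coeff r k"
    using c[OF 1 assms(3)] c[OF assms(1,2)] by simp
qed

text \<open>
  A cubic form with constant coefficients commutes with taking coefficients in the top degree.
\<close>
lemma degree_norm3:
  fixes a :: "'a::field"
  assumes "Polynomial.degree x \<le> e" "Polynomial.degree y \<le> e" "Polynomial.degree z \<le> e"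
  shows "Polynomial.degree (norm3 [:a:] x y z) \<le> 3 * e"
    "Polynomial.coeff (norm3 [:a:] x y z) (3 * e)
       = norm3 a (Polynomial.coeff x e) (Polynomial.coeff y e) (Polynomial.coeff z e)"
proof -
  have e: "3 * e = e + e + e" by simp
  note c = coeff_mult3[of _ e _ e _ e, folded e]
  have eq: "norm3 [:a:] x y z = x * x * x + smult a (y * y * y) + smult (a * a) (z * z * z) - smult (3 * a) (x * y * z)"
    by (simp add: norm3_def numeral_poly mult.commute)
  show "Polynomial.degree (norm3 [:a:] x y z) \<le> 3 * e"
    unfolding eq using assms by (intro degree_add_le degree_diff_le order.trans[OF degree_smult_le] c(1))
  show "Polynomial.coeff (norm3 [:a:] x y z) (3 * e)
       = norm3 a (Polynomial.coeff x e) (Polynomial.coeff y e) (Polynomial.coeff z e)"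
    unfolding eq by (simp add: c(2) assms norm3_def)
qed

lemma three: "0 < (3::nat)" "1 < (3::nat)" "2 < (3::nat)" by simp_all

lemma degree_mixed:
  fixes a :: "'a::field"
  assumes "\<And>i j. i < 3 \<Longrightarrow> j < 3 \<Longrightarrow> Polynomial.degree (y i j) \<le> e i"
  shows "Polynomial.degree (mixed [:a:] [:\<zeta>:] y) \<le> e 0 + e 1 + e 2"
    "Polynomial.coeff (mixed [:a:] [:\<zeta>:] y) (e 0 + e 1 + e 2) = mixed a \<zeta> (\<lambda>i j. Polynomial.coeff (y i j) (e i))"
proof -
  have c: "Polynomial.degree (y 0 i * y 1 j * y 2 k) \<le> e 0 + e 1 + e 2"
    "Polynomial.coeff (y 0 i * y 1 j * y 2 k) (e 0 + e 1 + e 2)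
      = Polynomial.coeff (y 0 i) (e 0) * Polynomial.coeff (y 1 j) (e 1) * Polynomial.coeff (y 2 k) (e 2)"
    if "i < 3" "j < 3" "k < 3" for i j k
    by (rule coeff_mult3; rule assms; use that in simp)+
  have eq: "mixed [:a:] [:\<zeta>:] y = smult 3 (y 0 0 * y 1 0 * y 2 0) + smult (3 * a) (y 0 1 * y 1 1 * y 2 1)
     + smult (3 * a * a) (y 0 2 * y 1 2 * y 2 2)
     + smult (3 * a * \<zeta> * \<zeta>) (y 0 0 * y 1 1 * y 2 2 + y 0 2 * y 1 0 * y 2 1 + y 0 1 * y 1 2 * y 2 0)
     + smult (3 * a * \<zeta>) (y 0 0 * y 1 2 * y 2 1 + y 0 1 * y 1 0 * y 2 2 + y 0 2 * y 1 1 * y 2 0)"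
    by (simp add: mixed_def numeral_poly smult_add_right mult_ac)
  show "Polynomial.degree (mixed [:a:] [:\<zeta>:] y) \<le> e 0 + e 1 + e 2"
    unfolding eq by (intro degree_add_le order.trans[OF degree_smult_le] c(1)) simp_all
  show "Polynomial.coeff (mixed [:a:] [:\<zeta>:] y) (e 0 + e 1 + e 2) = mixed a \<zeta> (\<lambda>i j. Polynomial.coeff (y i j) (e i))"
    unfolding eq Polynomial.coeff_add Polynomial.coeff_smult c(2)[OF three(1) three(1) three(1)]
      c(2)[OF three(2) three(2) three(2)] c(2)[OF three(3) three(3) three(3)]
      c(2)[OF three(1) three(2) three(3)] c(2)[OF three(3) three(1) three(2)] c(2)[OF three(2) three(3) three(1)]
      c(2)[OF three(1) three(3) three(2)] c(2)[OF three(2) three(1) three(3)] c(2)[OF three(3) three(2) three(1)]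
    by (simp add: mixed_def algebra_simps)
qed

lemma degree_reduced_norm:
  fixes a :: "'a::field"
  assumes "\<And>i j. i < 3 \<Longrightarrow> j < 3 \<Longrightarrow> Polynomial.degree (y i j) \<le> e"
  shows "Polynomial.degree (reduced_norm [:a:] [:b:] [:\<zeta>:] y) \<le> 3 * e"
    "Polynomial.coeff (reduced_norm [:a:] [:b:] [:\<zeta>:] y) (3 * e)
       = reduced_norm a b \<zeta> (\<lambda>i j. Polynomial.coeff (y i j) e)"
proof -
  have m: "Polynomial.degree (mixed [:a:] [:\<zeta>:] y) \<le> 3 * e"
    "Polynomial.coeff (mixed [:a:] [:\<zeta>:] y) (3 * e) = mixed a \<zeta> (\<lambda>i j. Polynomial.coeff (y i j) e)"
    using degree_mixed[of y "\<lambda>_. e" a \<zeta>] assms by (simp_all add: mult.commute[of 3] numeral_3_eq_3 add.assoc)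
  have eq: "reduced_norm [:a:] [:b:] [:\<zeta>:] y = norm3 [:a:] (y 0 0) (y 0 1) (y 0 2)
      + smult b (norm3 [:a:] (y 1 0) (y 1 1) (y 1 2)) + smult (b * b) (norm3 [:a:] (y 2 0) (y 2 1) (y 2 2))
      - smult b (mixed [:a:] [:\<zeta>:] y)"
    by (simp add: reduced_norm_def)
  show "Polynomial.degree (reduced_norm [:a:] [:b:] [:\<zeta>:] y) \<le> 3 * e"
    unfolding eq using assms
    by (intro degree_add_le degree_diff_le order.trans[OF degree_smult_le] degree_norm3(1) m) auto
  show "Polynomial.coeff (reduced_norm [:a:] [:b:] [:\<zeta>:] y) (3 * e)
       = reduced_norm a b \<zeta> (\<lambda>i j. Polynomial.coeff (y i j) e)"
    unfolding eq by (simp add: degree_norm3(2) assms m reduced_norm_def)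
qed

text \<open>
  The nonzero ones among the first three summands have degrees 0, 1 and 2 modulo 3, so the largest of these degrees
  is attained once. The last summand has degree at most $e_0 + e_1 + e_2 + 1$, which is the mean of the
  three degrees and hence below their maximum, and it vanishes if one of the three summands does; so it cannot
  cancel that leading term.
\<close>
lemma degree_mod_3_independent:
  fixes A0 A1 A2 B :: "'a::field poly"
  assumes A: "A0 = 0 \<or> Polynomial.degree A0 = 3 * e0" "A1 = 0 \<or> Polynomial.degree A1 = 3 * e1"
      "A2 = 0 \<or> Polynomial.degree A2 = 3 * e2"
    and B: "A0 = 0 \<or> A1 = 0 \<or> A2 = 0 \<Longrightarrow> B = 0" "Polynomial.degree B \<le> e0 + e1 + e2"
    and eq: "A0 + pCons 0 A1 + pCons 0 (pCons 0 A2) + pCons 0 B = 0"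
  shows "A0 = 0 \<and> A1 = 0 \<and> A2 = 0"
proof (rule ccontr)
  assume nz: "\<not> (A0 = 0 \<and> A1 = 0 \<and> A2 = 0)"
  define d where "d = (\<lambda>i::nat. if i = 0 then 3 * e0 else if i = 1 then 3 * e1 + 1 else 3 * e2 + 2)"
  define T where "T = (\<lambda>i::nat. if i = 0 then A0 else if i = 1 then pCons 0 A1 else pCons 0 (pCons 0 A2))"
  have T: "T i = 0 \<or> Polynomial.degree (T i) = d i" for i
    using A by (auto simp: T_def d_def)
  have dm: "d i mod 3 = i" if "i < 3" for i
  proof -
    have "i = 0 \<or> i = 1 \<or> i = 2" using that by auto
    then show ?thesis by (auto simp: d_def) presburger+
  qed
  define S where "S = {i. i < 3 \<and> T i \<noteq> 0}"
  have "S \<noteq> {}"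
  proof -
    have "T 0 \<noteq> 0 \<or> T 1 \<noteq> 0 \<or> T 2 \<noteq> 0" using nz by (auto simp: T_def)
    then show ?thesis unfolding S_def by force
  qed
  moreover have fS: "finite S" by (simp add: S_def)
  ultimately obtain m where m: "m \<in> S" "\<And>i. i \<in> S \<Longrightarrow> d i \<le> d m"
    using Max_in[of "d ` S"] Max_ge[of "d ` S"] by (metis (no_types, lifting) finite_imageI imageE image_eqI image_is_empty)
  have z: "Polynomial.coeff (T i) (d m) = 0" if "i < 3" "i \<noteq> m" for i
  proof (cases "T i = 0")
    case False
    then have "i \<in> S" using that by (simp add: S_def)
    moreover have "d i \<noteq> d m" using dm[of i] dm[of m] that m by (auto simp: S_def)
    ultimately have "d i < d m" using m(2)[of i] by simp
    then show ?thesis using T[of i] False by (simp add: coeff_eq_0)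
  qed simp
  have zB: "Polynomial.coeff (pCons 0 B) (d m) = 0"
  proof (cases "A0 = 0 \<or> A1 = 0 \<or> A2 = 0")
    case True
    then show ?thesis using B by simp
  next
    case False
    then have "{0,1,2} \<subseteq> S" by (auto simp: S_def T_def)
    then have "3 * e0 \<le> d m" "3 * e1 + 1 \<le> d m" "3 * e2 + 2 \<le> d m"
      using m(2)[of 0] m(2)[of 1] m(2)[of 2] by (auto simp: d_def)
    moreover have "3 * e0 \<noteq> d m \<or> 3 * e1 + 1 \<noteq> d m" by presburger
    ultimately have "e0 + e1 + e2 + 1 < d m" by linarith
    then have "Polynomial.degree (pCons 0 B) < d m"
      using B(2) degree_pCons_le[of 0 B] by linarith
    then show ?thesis by (rule coeff_eq_0)
  qed
  have "Polynomial.coeff (T 0 + T 1 + T 2 + pCons 0 B) (d m) = 0"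
    using eq by (simp add: T_def)
  then have "Polynomial.coeff (T 0) (d m) + Polynomial.coeff (T 1) (d m) + Polynomial.coeff (T 2) (d m) = 0"
    using zB by simp
  moreover have "m = 0 \<or> m = 1 \<or> m = 2" using m by (auto simp: S_def)
  ultimately have "Polynomial.coeff (T m) (d m) = 0"
    using z[of 0] z[of 1] z[of 2] by auto
  moreover have "T m \<noteq> 0" "Polynomial.degree (T m) = d m" using m T[of m] by (auto simp: S_def)
  ultimately show False using leading_coeff_0_iff by metis
qed

text \<open>
  The three cubes in the norm form have degrees in $t$ that differ modulo 3, so they cannot cancel.
\<close>
lemma norm3_anisotropic:
  assumes F: "is_subfield F" and t: "transc F t"
    and y: "\<And>i::nat. i < 3 \<Longrightarrow> y i \<in> adjoin F t" and eq: "norm3 t (y 0) (y 1) (y 2) = 0"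
  shows "y 0 = 0 \<and> y 1 = 0 \<and> y 2 = 0"
proof -
  obtain q Y where q: "q \<in> polys F" "poly q t \<noteq> 0" and Y: "\<And>i. i \<in> {..<3} \<Longrightarrow> Y i \<in> polys F"
    "\<And>i. i \<in> {..<3::nat} \<Longrightarrow> y i = poly (Y i) t / poly q t"
    using adjoin_common_denominator[OF F, of "{..<3}" y t] y by auto
  let ?B = "smult (- 3) (Y 0 * Y 1 * Y 2)"
  let ?p = "Y 0 * Y 0 * Y 0 + pCons 0 (Y 1 * Y 1 * Y 1) + pCons 0 (pCons 0 (Y 2 * Y 2 * Y 2)) + pCons 0 ?B"
  have "poly ?p t = norm3 t (poly (Y 0) t) (poly (Y 1) t) (poly (Y 2) t)"
    by (simp add: norm3_def algebra_simps)
  also have "\<dots> = poly q t ^ 3 * norm3 t (y 0) (y 1) (y 2)"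
    using q(2) by (simp add: norm3_scale[symmetric] Y(2))
  finally have "poly ?p t = 0" using eq by simp
  moreover have "?p \<in> polys F"
    using Y(1) is_subfieldD[OF F] by (intro polys_closed[OF F]) auto
  ultimately have "?p = 0" using t by (simp add: transc_def)
  have cube: "Polynomial.degree (p * p * p) = 3 * Polynomial.degree p" for p :: "'a poly"
    by (cases "p = 0") (auto simp: degree_mult_eq)
  have "Y 0 * Y 0 * Y 0 = 0 \<and> Y 1 * Y 1 * Y 1 = 0 \<and> Y 2 * Y 2 * Y 2 = 0"
  proof (rule degree_mod_3_independent[OF _ _ _ _ _ \<open>?p = 0\<close>])
    show "Polynomial.degree ?B \<le> Polynomial.degree (Y 0) + Polynomial.degree (Y 1) + Polynomial.degree (Y 2)"
      by (rule order.trans[OF degree_smult_le coeff_mult3(1)]) auto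
  qed (auto simp: cube)
  then show ?thesis using Y(2) by auto
qed

lemma exists_common_degree:
  fixes Y :: "'i \<Rightarrow> 'a::field poly"
  assumes "finite I" "\<exists>i\<in>I. Y i \<noteq> 0"
  obtains e where "\<And>i. i \<in> I \<Longrightarrow> Polynomial.degree (Y i) \<le> e" "\<exists>i\<in>I. Polynomial.coeff (Y i) e \<noteq> 0"
proof -
  let ?S = "(\<lambda>i. Polynomial.degree (Y i)) ` {i\<in>I. Y i \<noteq> 0}"
  have S: "finite ?S" "?S \<noteq> {}" using assms by auto
  obtain i where i: "i \<in> I" "Y i \<noteq> 0" "Polynomial.degree (Y i) = Max ?S" using Max_in[OF S] by auto
  show thesis
  proof (rule that[of "Max ?S"])
    show "\<exists>i\<in>I. Polynomial.coeff (Y i) (Max ?S) \<noteq> 0"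
      using i by (intro bexI[of _ i]) (auto simp flip: i(3))
    fix j assume "j \<in> I"
    then show "Polynomial.degree (Y j) \<le> Max ?S"
      using Max_ge[OF S(1), of "Polynomial.degree (Y j)"] by (cases "Y j = 0") auto
  qed
qed

text \<open>
  The same comparison of degrees one level up: if $F[u]/(u^3-a)$ has an anisotropic norm form, then the
  norms of the three rows have degrees divisible by 3 in $t = b$, and the powers of $b$ in front of them
  separate these degrees modulo 3. So the symbol algebra of $a$ and $t$ is a division algebra.
\<close>
lemma reduced_norm_anisotropic:
  assumes F: "is_subfield F" and aF: "a \<in> F" "\<zeta> \<in> F" and t: "transc F t"
    and an: "\<And>y :: nat \<Rightarrow> 'a::field. (\<And>i. i < 3 \<Longrightarrow> y i \<in> F) \<Longrightarrow> norm3 a (y 0) (y 1) (y 2) = 0 \<Longrightarrow>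
               y 0 = 0 \<and> y 1 = 0 \<and> y 2 = 0"
    and y: "\<And>i j. i < 3 \<Longrightarrow> j < 3 \<Longrightarrow> y i j \<in> adjoin F t" and eq: "reduced_norm a t \<zeta> y = 0"
    and ij: "i < 3" "j < 3"
  shows "y i j = 0"
proof -
  let ?I = "{..<3} \<times> {..<3::nat}"
  obtain q Y' where q: "q \<in> polys F" "poly q t \<noteq> 0" and Y': "\<And>i. i \<in> ?I \<Longrightarrow> Y' i \<in> polys F"
    "\<And>i. i \<in> ?I \<Longrightarrow> (case i of (i, j) \<Rightarrow> y i j) = poly (Y' i) t / poly q t"
    by (rule adjoin_common_denominator[OF F, of ?I "\<lambda>(i, j). y i j" t]) (use y in auto)
  define Y where "Y = (\<lambda>i j. Y' (i, j))"
  have Y: "Y i j \<in> polys F" "y i j = poly (Y i j) t / poly q t" if "i < 3" "j < 3" for i j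
    using Y'[of "(i,j)"] that by (auto simp: Y_def)
  let ?n = "\<lambda>i. norm3 [:a:] (Y i 0) (Y i 1) (Y i 2)"
  let ?B = "- mixed [:a:] [:\<zeta>:] Y"
  let ?p = "?n 0 + pCons 0 (?n 1) + pCons 0 (pCons 0 (?n 2)) + pCons 0 ?B"
  have "poly ?p t = reduced_norm a t \<zeta> (\<lambda>i j. poly (Y i j) t)"
    by (simp add: reduced_norm_def poly_norm3 poly_mixed)
  also have "\<dots> = reduced_norm a t \<zeta> (\<lambda>i j. poly q t * y i j)"
    using q(2) by (simp add: reduced_norm_def norm3_def mixed_def Y(2))
  also have "\<dots> = 0" by (simp add: reduced_norm_scale eq)
  finally have "poly ?p t = 0" .
  moreover have "?p \<in> polys F"
    using Y(1) is_subfieldD[OF F] aF by (intro polys_closed[OF F] norm3_polys mixed_polys F) auto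
  ultimately have p0: "?p = 0" using t by (simp add: transc_def)
  \<comment> \<open>The exponent \<open>e\<close> is the largest degree in row \<open>i\<close>; anisotropy over \<open>F\<close> keeps the top coefficient of
    the norm of the row from vanishing.\<close>
  have row: "\<exists>e. (\<forall>j<3. Polynomial.degree (Y i j) \<le> e) \<and> ((\<forall>j<3. Y i j = 0) \<or> ?n i \<noteq> 0 \<and> Polynomial.degree (?n i) = 3 * e)"
    if i: "i < 3" for i
  proof (cases "\<exists>j\<in>{..<3}. Y i j \<noteq> 0")
    case True
    obtain e where e: "\<And>j. j \<in> {..<3} \<Longrightarrow> Polynomial.degree (Y i j) \<le> e" "\<exists>j\<in>{..<3}. Polynomial.coeff (Y i j) e \<noteq> 0"
      using exists_common_degree[OF _ True] by auto
    have d: "Polynomial.degree (?n i) \<le> 3 * e" "Polynomial.coeff (?n i) (3 * e)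
       = norm3 a (Polynomial.coeff (Y i 0) e) (Polynomial.coeff (Y i 1) e) (Polynomial.coeff (Y i 2) e)"
      using degree_norm3[of "Y i 0" e "Y i 1" "Y i 2" a] e(1) by auto
    have "\<not> (Polynomial.coeff (Y i 0) e = 0 \<and> Polynomial.coeff (Y i 1) e = 0 \<and> Polynomial.coeff (Y i 2) e = 0)"
    proof
      assume z: "Polynomial.coeff (Y i 0) e = 0 \<and> Polynomial.coeff (Y i 1) e = 0 \<and> Polynomial.coeff (Y i 2) e = 0"
      obtain j where j: "j < 3" "Polynomial.coeff (Y i j) e \<noteq> 0" using e(2) by auto
      then have "j = 0 \<or> j = 1 \<or> j = 2" by linarith
      then show False using z j by auto
    qed
    moreover have "Polynomial.coeff (Y i j) e \<in> F" if "j < 3" for j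
      using Y(1)[OF i that] by (simp add: polys_def)
    ultimately have nz: "Polynomial.coeff (?n i) (3 * e) \<noteq> 0"
      unfolding d(2) using an[of "\<lambda>j. Polynomial.coeff (Y i j) e"] by auto
    then have "Polynomial.degree (?n i) = 3 * e" by (intro le_antisym d(1) le_degree)
    moreover have "?n i \<noteq> 0" using nz by auto
    ultimately show ?thesis using e(1) by auto
  next
    case False
    then show ?thesis by (intro exI[of _ 0]) auto
  qed
  then have "\<forall>i. \<exists>e. i < 3 \<longrightarrow> (\<forall>j<3. Polynomial.degree (Y i j) \<le> e) \<and>
      ((\<forall>j<3. Y i j = 0) \<or> ?n i \<noteq> 0 \<and> Polynomial.degree (?n i) = 3 * e)" by blast
  then obtain e where e: "\<forall>i<3. (\<forall>j<3. Polynomial.degree (Y i j) \<le> e i) \<and>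
      ((\<forall>j<3. Y i j = 0) \<or> ?n i \<noteq> 0 \<and> Polynomial.degree (?n i) = 3 * e i)" by (rule choice[THEN exE]) blast
  have zero: "?n i = 0 \<Longrightarrow> j < 3 \<Longrightarrow> Y i j = 0" if "i < 3" for i j
    using e that by blast
  have deg: "?n i = 0 \<or> Polynomial.degree (?n i) = 3 * e i" if i: "i < 3" for i
  proof (cases "\<forall>j<3. Y i j = 0")
    case True
    then have "?n i = 0" by (simp add: norm3_def)
    then show ?thesis ..
  next
    case False
    then show ?thesis using e i by blast
  qed
  have n0: "?n 0 = 0 \<and> ?n 1 = 0 \<and> ?n 2 = 0"
  proof (rule degree_mod_3_independent[OF deg deg deg _ _ p0])
    show "Polynomial.degree ?B \<le> e 0 + e 1 + e 2"
      using degree_mixed(1)[of Y e a \<zeta>] e unfolding degree_minus by blast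
    assume "?n 0 = 0 \<or> ?n 1 = 0 \<or> ?n 2 = 0"
    then have "(\<forall>j<3. Y 0 j = 0) \<or> (\<forall>j<3. Y 1 j = 0) \<or> (\<forall>j<3. Y 2 j = 0)"
      using zero[OF three(1)] zero[OF three(2)] zero[OF three(3)] by blast
    then show "?B = 0" by (auto simp: mixed_def)
  qed simp_all
  have "i = 0 \<or> i = 1 \<or> i = 2" using ij(1) by linarith
  then have "?n i = 0" using n0 by blast
  then have "Y i j = 0" using zero ij by blast
  then show ?thesis using Y(2)[OF ij] by simp
qed

section \<open>A base field on which a norm equation has no solution\<close>

text \<open>
  The element $c^{-2}$ is not the reduced norm of an element with coordinates in \<open>K\<close>.
\<close>
definition no_norm :: "'a::field \<Rightarrow> 'a \<Rightarrow> 'a \<Rightarrow> 'a \<Rightarrow> 'a set \<Rightarrow> bool"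
  where "no_norm a b c \<zeta> K \<longleftrightarrow> (\<forall>y. (\<forall>i<3. \<forall>j<3. y i j \<in> K) \<longrightarrow> c * c * reduced_norm a b \<zeta> y \<noteq> 1)"

lemma reduced_norm_cong: "(\<And>i j. i < 3 \<Longrightarrow> j < 3 \<Longrightarrow> y i j = z i j) \<Longrightarrow> reduced_norm a b \<zeta> y = reduced_norm a b \<zeta> z"
  by (simp add: reduced_norm_def norm3_def mixed_def)

lemma norm_solution_in_adjoin:
  assumes F: "is_subfield F" and y: "\<And>i j. i < 3 \<Longrightarrow> j < 3 \<Longrightarrow> y i j \<in> adjoin F t"
    and eq: "c * c * reduced_norm a b \<zeta> y = 1"
  obtains q Y where "q \<in> polys F" "poly q t \<noteq> 0" "\<And>i j. i < 3 \<Longrightarrow> j < 3 \<Longrightarrow> Y i j \<in> polys F"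
     "c * c * poly (reduced_norm [:a:] [:b:] [:\<zeta>:] Y) t = poly (q * q * q) t"
proof -
  let ?I = "{..<3} \<times> {..<3::nat}"
  obtain q Y where q: "q \<in> polys F" "poly q t \<noteq> 0" and Y: "\<And>i. i \<in> ?I \<Longrightarrow> Y i \<in> polys F"
    "\<And>i. i \<in> ?I \<Longrightarrow> (case i of (i, j) \<Rightarrow> y i j) = poly (Y i) t / poly q t"
    by (rule adjoin_common_denominator[OF F, of ?I "\<lambda>(i, j). y i j" t]) (use y in auto)
  have "poly (reduced_norm [:a:] [:b:] [:\<zeta>:] (\<lambda>i j. Y (i, j))) t = reduced_norm a b \<zeta> (\<lambda>i j. poly (Y (i, j)) t)"
    by (simp add: poly_reduced_norm)
  also have "\<dots> = reduced_norm a b \<zeta> (\<lambda>i j. poly q t * y i j)"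
    using q(2) Y(2) by (intro reduced_norm_cong) fastforce
  also have "\<dots> = poly q t ^ 3 * reduced_norm a b \<zeta> y" by (rule reduced_norm_scale)
  finally have "c * c * poly (reduced_norm [:a:] [:b:] [:\<zeta>:] (\<lambda>i j. Y (i, j))) t
      = poly q t ^ 3 * (c * c * reduced_norm a b \<zeta> y)" by (simp add: mult_ac)
  then show thesis using that[OF q, of "\<lambda>i j. Y (i, j)"] Y(1) eq by (simp add: power3_eq_cube)
qed

text \<open>
  After clearing denominators, a solution would give $t^2 N = q^3$ for polynomials in $t$. Over a
  division algebra the degree of $N$ is divisible by 3, so the left-hand side has degree 2 modulo 3.
\<close>
lemma no_norm_adjoin_self:
  fixes a :: "'a::field"
  assumes F: "is_subfield F" and aF: "a \<in> F" "b \<in> F" "\<zeta> \<in> F" and t: "transc F t"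
    and an: "\<And>y i j. (\<And>i j. i < 3 \<Longrightarrow> j < 3 \<Longrightarrow> y i j \<in> F) \<Longrightarrow> reduced_norm a b \<zeta> y = 0 \<Longrightarrow>
               i < 3 \<Longrightarrow> j < 3 \<Longrightarrow> y i j = (0::'a)"
  shows "no_norm a b t \<zeta> (adjoin F t)"
  unfolding no_norm_def
proof (intro allI impI notI)
  fix y assume y: "\<forall>i<3. \<forall>j<3. y i j \<in> adjoin F t" and eq: "t * t * reduced_norm a b \<zeta> y = 1"
  obtain q Y where q: "q \<in> polys F" "poly q t \<noteq> 0" and Y: "\<And>i j. i < 3 \<Longrightarrow> j < 3 \<Longrightarrow> Y i j \<in> polys F"
     and e: "t * t * poly (reduced_norm [:a:] [:b:] [:\<zeta>:] Y) t = poly (q * q * q) t"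
    by (rule norm_solution_in_adjoin[OF F _ eq]) (use y in auto)
  let ?n = "reduced_norm [:a:] [:b:] [:\<zeta>:] Y"
  have "poly (pCons 0 (pCons 0 ?n) - q * q * q) t = 0" using e by (simp add: mult.assoc)
  moreover have "pCons 0 (pCons 0 ?n) - q * q * q \<in> polys F"
    using q Y aF is_subfieldD[OF F] by (intro polys_closed[OF F] reduced_norm_polys F) auto
  ultimately have "pCons 0 (pCons 0 ?n) - q * q * q = 0" using t unfolding transc_def by blast
  then have id: "pCons 0 (pCons 0 ?n) = q * q * q" by simp
  have q0: "q \<noteq> 0" using q by auto
  then have n0: "?n \<noteq> 0" using id by auto
  have "\<exists>ij\<in>{..<3}\<times>{..<3}. (case ij of (i, j) \<Rightarrow> Y i j) \<noteq> 0"
  proof (rule ccontr)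
    assume "\<not> ?thesis"
    then have "\<forall>i<3. \<forall>j<3. Y i j = 0" by auto
    then have "?n = 0" by (simp add: reduced_norm_def norm3_def mixed_def)
    then show False using n0 by simp
  qed
  then obtain e where e: "\<And>ij. ij \<in> {..<3}\<times>{..<3} \<Longrightarrow> Polynomial.degree (case ij of (i, j) \<Rightarrow> Y i j) \<le> e"
     "\<exists>ij\<in>{..<3}\<times>{..<3}. Polynomial.coeff (case ij of (i, j) \<Rightarrow> Y i j) e \<noteq> 0"
    by (rule exists_common_degree[rotated]) auto
  have e1: "Polynomial.degree (Y i j) \<le> e" if "i < 3" "j < 3" for i j using e(1)[of "(i, j)"] that by simp
  have nz: "Polynomial.coeff ?n (3 * e) \<noteq> 0"
  proof
    assume "Polynomial.coeff ?n (3 * e) = 0"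
    then have "reduced_norm a b \<zeta> (\<lambda>i j. Polynomial.coeff (Y i j) e) = 0"
      using degree_reduced_norm(2)[OF e1, where a = a and b = b and \<zeta> = \<zeta>] by simp
    then have "Polynomial.coeff (Y i j) e = 0" if "i < 3" "j < 3" for i j
      using an[of "\<lambda>i j. Polynomial.coeff (Y i j) e" i j] that Y by (auto simp: polys_def)
    then show False using e(2) by auto
  qed
  have "Polynomial.degree ?n = 3 * e"
    by (intro le_antisym degree_reduced_norm(1) e1 le_degree nz)
  then have "Polynomial.degree (pCons 0 (pCons 0 ?n)) = 3 * e + 2" using n0 by simp
  moreover have "Polynomial.degree (q * q * q) = 3 * Polynomial.degree q" using q0 by (simp add: degree_mult_eq)
  ultimately have "3 * e + 2 = 3 * Polynomial.degree q" using id by simp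
  then show False by presburger
qed

text \<open>
  A solution over $K(t)$ can be specialised at some natural number where the denominator does
  not vanish, which gives a solution over $K$.
\<close>
lemma no_norm_adjoin:
  fixes a :: "'a::field_char_0"
  assumes K: "is_subfield K" and aK: "a \<in> K" "b \<in> K" "c \<in> K" "\<zeta> \<in> K" and t: "transc K t" and nn: "no_norm a b c \<zeta> K"
  shows "no_norm a b c \<zeta> (adjoin K t)"
  unfolding no_norm_def
proof (intro allI impI notI)
  fix y assume y: "\<forall>i<3. \<forall>j<3. y i j \<in> adjoin K t" and eq: "c * c * reduced_norm a b \<zeta> y = 1"
  obtain q Y where q: "q \<in> polys K" "poly q t \<noteq> 0" and Y: "\<And>i j. i < 3 \<Longrightarrow> j < 3 \<Longrightarrow> Y i j \<in> polys K"
     and e: "c * c * poly (reduced_norm [:a:] [:b:] [:\<zeta>:] Y) t = poly (q * q * q) t"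
    by (rule norm_solution_in_adjoin[OF K _ eq]) (use y in auto)
  let ?n = "reduced_norm [:a:] [:b:] [:\<zeta>:] Y"
  have "poly ([:c * c:] * ?n - q * q * q) t = 0" using e by simp
  moreover have "[:c * c:] * ?n - q * q * q \<in> polys K"
    using q Y aK is_subfieldD[OF K] by (intro polys_closed[OF K] reduced_norm_polys K) auto
  ultimately have "[:c * c:] * ?n - q * q * q = 0" using t unfolding transc_def by blast
  then have id: "[:c * c:] * ?n = q * q * q" by simp
  have "finite {x. poly q x = 0}" using q by (intro poly_roots_finite) auto
  moreover have "infinite (range (of_nat :: nat \<Rightarrow> 'a))" by (simp add: range_inj_infinite inj_of_nat)
  ultimately obtain n where n: "poly q (of_nat n) \<noteq> 0"
    by (metis (mono_tags, lifting) finite_subset image_subsetI mem_Collect_eq)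
  let ?x = "of_nat n :: 'a"
  have x: "?x \<in> K" using is_subfieldD[OF K] by auto
  define z where "z = (\<lambda>i j. inverse (poly q ?x) * poly (Y i j) ?x)"
  have zK: "\<forall>i<3. \<forall>j<3. z i j \<in> K"
    using poly_in_subfield[OF K _ x] q Y is_subfieldD[OF K] unfolding z_def by auto
  have "c * c * reduced_norm a b \<zeta> z = inverse (poly q ?x) ^ 3 * (c * c * poly ?n ?x)"
    unfolding z_def reduced_norm_scale by (simp add: poly_reduced_norm)
  also have "c * c * poly ?n ?x = poly ([:c * c:] * ?n) ?x" by simp
  also have "\<dots> = poly q ?x ^ 3" unfolding id by (simp add: power3_eq_cube)
  finally have "c * c * reduced_norm a b \<zeta> z = 1" using n by (simp add: power_inverse)
  then show False using nn zK unfolding no_norm_def by blast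
qed

text \<open>
  A solution of the norm equation involves only nine elements, so the condition passes to unions of chains.
\<close>
lemma exists_maximal_no_norm:
  fixes F :: "'a::field set"
  assumes F: "is_subfield F" "no_norm a b c \<zeta> F"
  obtains K where "is_subfield K" "F \<subseteq> K" "no_norm a b c \<zeta> K"
    "\<And>K'. is_subfield K' \<Longrightarrow> K \<subseteq> K' \<Longrightarrow> no_norm a b c \<zeta> K' \<Longrightarrow> K' = K"
proof -
  let ?A = "{K. is_subfield K \<and> F \<subseteq> K \<and> no_norm a b c \<zeta> K}"
  have "\<exists>M\<in>?A. \<forall>U\<in>?A. M \<subseteq> U \<longrightarrow> U = M"
  proof (rule subset_Zorn_nonempty)
    show "?A \<noteq> {}" using F by auto
    fix C assume C: "C \<noteq> {}" "subset.chain ?A C"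
    from C(2) have CA: "C \<subseteq> ?A" unfolding subset_chain_def by (rule conjunct1)
    from C(2) have ch: "U \<subseteq> Y \<or> Y \<subseteq> U" if "U \<in> C" "Y \<in> C" for U Y
      using that unfolding subset_chain_def by simp
    have sub: "is_subfield (\<Union>C)" using C CA ch by (intro is_subfield_UN_chain) auto
    have fin: "\<exists>U\<in>C. S \<subseteq> U" if "finite S" "S \<subseteq> \<Union>C" for S
      using that
    proof (induction S)
      case empty
      then show ?case using C by blast
    next
      case (insert x S)
      then obtain U Y where "U \<in> C" "S \<subseteq> U" "Y \<in> C" "x \<in> Y" by auto
      then show ?case using ch[of U Y] by blast
    qed
    have "no_norm a b c \<zeta> (\<Union>C)" unfolding no_norm_def
    proof (intro allI impI)
      fix y :: "nat \<Rightarrow> nat \<Rightarrow> 'a" assume y: "\<forall>i<3. \<forall>j<3. y i j \<in> \<Union>C"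
      have "\<exists>U\<in>C. (\<lambda>(i, j). y i j) ` ({..<3} \<times> {..<3}) \<subseteq> U"
        using y by (intro fin) auto
      then obtain U where U: "U \<in> C" "\<forall>i<3. \<forall>j<3. y i j \<in> U" by auto
      then show "c * c * reduced_norm a b \<zeta> y \<noteq> 1" using CA unfolding no_norm_def by blast
    qed
    then show "\<Union>C \<in> ?A" using sub C CA by auto
  qed
  then obtain K where "K \<in> ?A" "\<forall>U\<in>?A. K \<subseteq> U \<longrightarrow> U = K" by blast
  then show thesis using that[of K] by auto
qed

text \<open>
  The tower \<open>\<rat>(\<zeta>) \<subseteq> F1 \<subseteq> F2 \<subseteq> F3\<close> adjoins algebraically independent elements $a$, $b$, $c$ one at a
  time. A maximal field over \<open>F3\<close> on which the norm equation stays unsolvable leaves no transcendental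
  element, since such an element could be adjoined.
\<close>
theorem exists_base_field:
  obtains K :: "complex set" and a b c \<zeta> where "is_subfield K" "a \<in> K" "b \<in> K" "c \<in> K" "\<zeta> \<in> K"
    "a \<noteq> 0" "b \<noteq> 0" "c \<noteq> 0" "1 + \<zeta> + \<zeta> * \<zeta> = 0" "no_norm a b c \<zeta> K" "\<And>t. \<not> transc K t"
proof -
  obtain \<zeta> :: complex where zeta: "poly [:1, 1, 1:] \<zeta> = 0"
    using fundamental_theorem_of_algebra_alt[of "[:1, 1, 1:] :: complex poly"] by auto
  have Q: "is_subfield (\<rat> :: complex set)" unfolding is_subfield_def by auto
  define F0 where "F0 = adjoin (\<rat> :: complex set) \<zeta>"
  have F0: "is_subfield F0" "\<zeta> \<in> F0" "countable F0"
    unfolding F0_def by (simp_all add: is_subfield_adjoin mem_adjoin countable_adjoin Q countable_rat)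
  obtain a where a: "transc F0 a" using exists_transc[OF F0(3)] .
  define F1 where "F1 = adjoin F0 a"
  have F1: "is_subfield F1" "F0 \<subseteq> F1" "a \<in> F1" "countable F1"
    unfolding F1_def by (simp_all add: is_subfield_adjoin mem_adjoin countable_adjoin F0 subset_adjoin)
  have an1: "y 0 = 0 \<and> y 1 = 0 \<and> y 2 = 0"
    if "\<And>i. i < 3 \<Longrightarrow> y i \<in> F1" "norm3 a (y 0) (y 1) (y 2) = 0" for y :: "nat \<Rightarrow> complex"
    by (rule norm3_anisotropic[OF F0(1) a that(1)[unfolded F1_def] that(2)])
  obtain b where b: "transc F1 b" using exists_transc[OF F1(4)] .
  define F2 where "F2 = adjoin F1 b"
  have F2: "is_subfield F2" "F1 \<subseteq> F2" "b \<in> F2" "countable F2"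
    unfolding F2_def by (simp_all add: is_subfield_adjoin mem_adjoin countable_adjoin F1 subset_adjoin)
  have an2: "y i j = 0" if "\<And>i j. i < 3 \<Longrightarrow> j < 3 \<Longrightarrow> y i j \<in> F2" "reduced_norm a b \<zeta> y = 0" "i < 3" "j < 3" for y i j
    by (rule reduced_norm_anisotropic[OF F1(1) F1(3) subsetD[OF F1(2) F0(2)] b an1 that(1)[unfolded F2_def] that(2-4)])
  obtain c where c: "transc F2 c" using exists_transc[OF F2(4)] .
  define F3 where "F3 = adjoin F2 c"
  have F3: "is_subfield F3" "F2 \<subseteq> F3" "c \<in> F3"
    unfolding F3_def by (simp_all add: is_subfield_adjoin mem_adjoin F2 subset_adjoin)
  have nn: "no_norm a b c \<zeta> F3" unfolding F3_def
  proof (rule no_norm_adjoin_self[OF F2(1) _ _ _ c])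
    show "a \<in> F2" "b \<in> F2" "\<zeta> \<in> F2" using F0 F1 F2 by auto
  qed (rule an2)
  have nz: "t \<noteq> 0" if "is_subfield F" "transc F t" for F and t :: complex
  proof
    assume "t = 0"
    moreover have "[:0, 1:] \<in> polys F" using that by (intro polys_closed(1,7) is_subfieldD(1,2))
    moreover have "poly [:0, 1:] (0 :: complex) = 0" by simp
    ultimately have "[:0, 1:] = (0 :: complex poly)" using that(2) unfolding transc_def by blast
    then show False by simp
  qed
  obtain K where K: "is_subfield K" "F3 \<subseteq> K" "no_norm a b c \<zeta> K"
    "\<And>K'. is_subfield K' \<Longrightarrow> K \<subseteq> K' \<Longrightarrow> no_norm a b c \<zeta> K' \<Longrightarrow> K' = K"
    using exists_maximal_no_norm[OF F3(1) nn] by metis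
  have in_K: "a \<in> K" "b \<in> K" "c \<in> K" "\<zeta> \<in> K" using K(2) F0 F1 F2 F3 by auto
  have "\<not> transc K t" for t
  proof
    assume t: "transc K t"
    have "adjoin K t = K"
      by (intro K(4) is_subfield_adjoin no_norm_adjoin subset_adjoin K(1,3) in_K t)
    then have "t \<in> K" using mem_adjoin[OF K(1), of t] by simp
    then have "[:- t, 1:] \<in> polys K" using K(1) by (intro polys_closed(1,7) is_subfieldD(1,2,4))
    moreover have "poly [:- t, 1:] t = 0" by simp
    ultimately have "[:- t, 1:] = 0" using t unfolding transc_def by blast
    then show False by simp
  qed
  moreover have "1 + \<zeta> + \<zeta> * \<zeta> = 0" using zeta by (simp add: algebra_simps)
  ultimately show thesis
    by (intro that[OF K(1) in_K nz[OF F0(1) a] nz[OF F1(1) b] nz[OF F2(1) c] _ K(3)])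
qed

section \<open>Automorphisms of an algebraically closed field\<close>

text \<open>
  The graph of a ring homomorphism from a subring of the field to the field. Graphs instead of functions
  with a domain make extension the same as inclusion, as Zorn's lemma needs it.
\<close>
definition hom_graph :: "('a::field \<times> 'a) set \<Rightarrow> bool"
  where "hom_graph G \<longleftrightarrow> (1, 1) \<in> G \<and> (\<forall>x a b. (x, a) \<in> G \<longrightarrow> (x, b) \<in> G \<longrightarrow> a = b) \<and>
     (\<forall>x a y b. (x, a) \<in> G \<longrightarrow> (y, b) \<in> G \<longrightarrow> (x + y, a + b) \<in> G \<and> (x * y, a * b) \<in> G) \<and>
     (\<forall>x a. (x, a) \<in> G \<longrightarrow> (- x, - a) \<in> G)"

lemma hom_graphD:
  assumes "hom_graph G"
  shows "(1, 1) \<in> G" "(0, 0) \<in> G" "(x, a) \<in> G \<Longrightarrow> (x, b) \<in> G \<Longrightarrow> a = b"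
    "(x, a) \<in> G \<Longrightarrow> (y, b) \<in> G \<Longrightarrow> (x + y, a + b) \<in> G"
    "(x, a) \<in> G \<Longrightarrow> (y, b) \<in> G \<Longrightarrow> (x * y, a * b) \<in> G"
    "(x, a) \<in> G \<Longrightarrow> (- x, - a) \<in> G"
    "(x, a) \<in> G \<Longrightarrow> (y, b) \<in> G \<Longrightarrow> (x - y, a - b) \<in> G"
proof -
  show 1: "(1, 1) \<in> G" "(x, a) \<in> G \<Longrightarrow> (x, b) \<in> G \<Longrightarrow> a = b"
    "(x, a) \<in> G \<Longrightarrow> (y, b) \<in> G \<Longrightarrow> (x + y, a + b) \<in> G"
    "(x, a) \<in> G \<Longrightarrow> (y, b) \<in> G \<Longrightarrow> (x * y, a * b) \<in> G"
    "(x, a) \<in> G \<Longrightarrow> (- x, - a) \<in> G" for x a y b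
    using assms unfolding hom_graph_def by simp_all
  show "(0, 0) \<in> G" using 1(3)[OF 1(1) 1(5)[OF 1(1)]] by simp
  show "(x, a) \<in> G \<Longrightarrow> (y, b) \<in> G \<Longrightarrow> (x - y, a - b) \<in> G"
    using 1(3)[of x a "- y" "- b"] 1(5)[of y b] by simp
qed

text \<open>
  Pairs of a polynomial over the domain and its image under the homomorphism on coefficients.
\<close>
definition poly_pairs :: "('a::field \<times> 'a) set \<Rightarrow> ('a poly \<times> 'a poly) set"
  where "poly_pairs G = {(p, q). \<forall>i. (Polynomial.coeff p i, Polynomial.coeff q i) \<in> G}"

lemma hom_graph_sum:
  assumes "hom_graph G" "\<And>i. i \<in> I \<Longrightarrow> (f i, g i) \<in> G"
  shows "(sum f I, sum g I) \<in> G"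
  using assms(2) by (induction I rule: infinite_finite_induct) (auto intro: hom_graphD(2,4)[OF assms(1)])

lemma hom_graph_poly:
  assumes "hom_graph G" "(x, a) \<in> G" "(p, q) \<in> poly_pairs G"
  shows "(poly p x, poly q a) \<in> G"
  using assms(3)
proof (induction p arbitrary: q)
  case 0
  then have "Polynomial.coeff q i = 0" for i
    using hom_graphD(2,3)[OF assms(1)] by (auto simp: poly_pairs_def)
  then have "q = 0" by (simp add: poly_eq_iff)
  then show ?case using hom_graphD(2)[OF assms(1)] by simp
next
  case (pCons c r)
  obtain c' r' where q: "q = pCons c' r'" by (cases q)
  have *: "(Polynomial.coeff (pCons c r) i, Polynomial.coeff q i) \<in> G" for i
    using pCons.prems by (simp add: poly_pairs_def)
  have "(c, c') \<in> G" using *[of 0] by (simp add: q)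
  moreover have "(r, r') \<in> poly_pairs G"
    unfolding poly_pairs_def using *[of "Suc _"] by (simp add: q)
  ultimately show ?case
    unfolding q poly_pCons by (intro hom_graphD(4,5)[OF assms(1)] assms(2) pCons.IH)
qed

lemma poly_pairs_closed:
  assumes "hom_graph G"
  shows "(p, q) \<in> poly_pairs G \<Longrightarrow> (p', q') \<in> poly_pairs G \<Longrightarrow> (p + p', q + q') \<in> poly_pairs G"
    "(p, q) \<in> poly_pairs G \<Longrightarrow> (p', q') \<in> poly_pairs G \<Longrightarrow> (p * p', q * q') \<in> poly_pairs G"
    "(p, q) \<in> poly_pairs G \<Longrightarrow> (p', q') \<in> poly_pairs G \<Longrightarrow> (p - p', q - q') \<in> poly_pairs G"
    "(p, q) \<in> poly_pairs G \<Longrightarrow> (- p, - q) \<in> poly_pairs G"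
    "(x, a) \<in> G \<Longrightarrow> (Polynomial.monom x n, Polynomial.monom a n) \<in> poly_pairs G"
    "(x, a) \<in> G \<Longrightarrow> (p, q) \<in> poly_pairs G \<Longrightarrow> (pCons x p, pCons a q) \<in> poly_pairs G"
    "(0, 0) \<in> poly_pairs G"
proof -
  note d = hom_graphD[OF assms]
  have m: "(p, q) \<in> poly_pairs G \<longleftrightarrow> (\<forall>i. (Polynomial.coeff p i, Polynomial.coeff q i) \<in> G)" for p q
    by (simp add: poly_pairs_def)
  show "(p, q) \<in> poly_pairs G \<Longrightarrow> (p', q') \<in> poly_pairs G \<Longrightarrow> (p * p', q * q') \<in> poly_pairs G"
  proof -
    assume "(p, q) \<in> poly_pairs G" "(p', q') \<in> poly_pairs G"
    then have "(Polynomial.coeff p i * Polynomial.coeff p' j, Polynomial.coeff q i * Polynomial.coeff q' j) \<in> G" for i j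
      unfolding m by (intro d(5)) blast+
    then show ?thesis unfolding m coeff_mult by (intro allI hom_graph_sum[OF assms])
  qed
  show "(p, q) \<in> poly_pairs G \<Longrightarrow> (p', q') \<in> poly_pairs G \<Longrightarrow> (p + p', q + q') \<in> poly_pairs G"
    "(p, q) \<in> poly_pairs G \<Longrightarrow> (p', q') \<in> poly_pairs G \<Longrightarrow> (p - p', q - q') \<in> poly_pairs G"
    "(p, q) \<in> poly_pairs G \<Longrightarrow> (- p, - q) \<in> poly_pairs G"
    "(x, a) \<in> G \<Longrightarrow> (Polynomial.monom x n, Polynomial.monom a n) \<in> poly_pairs G"
    "(0, 0) \<in> poly_pairs G"
    unfolding m by (auto simp: Polynomial.coeff_monom intro: d(2) d(4) d(6) d(7))
  show "(x, a) \<in> G \<Longrightarrow> (p, q) \<in> poly_pairs G \<Longrightarrow> (pCons x p, pCons a q) \<in> poly_pairs G"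
    unfolding m by (simp add: coeff_pCons split: nat.split)
qed

text \<open>
  Domains are closed under inverses although this is not part of \<open>hom_graph\<close>: from a polynomial
  relation $c + x r(x) = 0$ of least degree over $K$ one reads off $x^{-1} = - c^{-1} r(x)$.
\<close>
lemma field_hom_graph_inverse:
  assumes G: "hom_graph G" and K: "is_subfield K" "Id_on K \<subseteq> G" and alg: "\<not> transc K x"
    and x: "(x, a) \<in> G" "x \<noteq> 0"
  shows "(inverse x, inverse a) \<in> G \<and> a \<noteq> 0"
proof -
  define Q where "Q = (\<lambda>n. \<exists>p\<in>polys K. p \<noteq> 0 \<and> poly p x = 0 \<and> Polynomial.degree p = n)"
  from alg have "\<exists>n. Q n" unfolding transc_def Q_def by blast
  then have Q: "Q (LEAST n. Q n)" "\<And>n. Q n \<Longrightarrow> (LEAST n. Q n) \<le> n" by (auto intro: LeastI_ex Least_le)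
  then obtain p where p: "p \<in> polys K" "p \<noteq> 0" "poly p x = 0" "Polynomial.degree p = (LEAST n. Q n)"
    unfolding Q_def by blast
  obtain c r where cr: "p = pCons c r" by (cases p)
  have co: "Polynomial.coeff p i \<in> K" for i using p(1) by (simp add: polys_def)
  have mem: "c \<in> K" "Polynomial.coeff r i \<in> K" for i
    using co[of 0] co[of "Suc i"] by (simp_all add: cr)
  have c: "c \<noteq> 0"
  proof
    assume "c = 0"
    then have "r \<noteq> 0" "poly r x = 0" using p cr x by auto
    then have "Q (Polynomial.degree r)" unfolding Q_def using mem by (auto simp: polys_def)
    then have "(LEAST n. Q n) \<le> Polynomial.degree r" by (rule Q(2))
    then show False using p(4) cr \<open>r \<noteq> 0\<close> by simp
  qed
  have ck: "(- inverse c, - inverse c) \<in> G" using mem(1) is_subfieldD(4,6)[OF K(1)] K(2) by (auto simp: Id_on_def)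
  have "(r, r) \<in> poly_pairs G" using mem K(2) by (auto simp: poly_pairs_def Id_on_def)
  then have i: "(- inverse c * poly r x, - inverse c * poly r a) \<in> G"
    by (intro hom_graphD(5)[OF G] ck hom_graph_poly[OF G x(1)])
  have ix: "- inverse c * poly r x = inverse x"
  proof -
    have "c + x * poly r x = 0" using p(3) cr by simp
    then have "x * poly r x = - c" by (simp add: add_eq_0_iff)
    then show ?thesis using c x(2) by (simp add: field_simps)
  qed
  have "(x * inverse x, a * (- inverse c * poly r a)) \<in> G"
    using hom_graphD(5)[OF G x(1) i[unfolded ix]] .
  then have "a * (- inverse c * poly r a) = 1"
    using hom_graphD(1,3)[OF G] x(2) by auto
  then have "a \<noteq> 0" "inverse a = - inverse c * poly r a" by (auto simp: inverse_unique)
  then show ?thesis using i ix by auto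
qed

text \<open>
  The homomorphism that sends $z$ to $z'$ and continues the given one to the ring generated by $z$.
\<close>
definition extend :: "('a::field \<times> 'a) set \<Rightarrow> 'a \<Rightarrow> 'a \<Rightarrow> ('a \<times> 'a) set"
  where "extend G z z' = {(poly p z, poly q z') | p q. (p, q) \<in> poly_pairs G}"

text \<open>
  Division with remainder by the minimal relation \<open>m\<close> of \<open>z\<close> shows that every relation of \<open>z\<close> is
  respected by \<open>z'\<close>; this is what makes \<open>extend\<close> single valued.
\<close>
lemma hom_graph_extend:
  assumes G: "hom_graph G" and K: "is_subfield K" "Id_on K \<subseteq> G" and alg: "\<And>x. \<not> transc K x"
    and m: "(m, m') \<in> poly_pairs G" "m \<noteq> 0" "poly m z = 0" "poly m' z' = 0"
    and min: "\<forall>p q. (p, q) \<in> poly_pairs G \<longrightarrow> p \<noteq> 0 \<longrightarrow> poly p z = 0 \<longrightarrow> Polynomial.degree m \<le> Polynomial.degree p"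
  shows "hom_graph (extend G z z')" "G \<subseteq> extend G z z'" "(z, z') \<in> extend G z z'"
proof -
  have key: "poly q z' = 0" if "(p, q) \<in> poly_pairs G" "poly p z = 0" for p q
    using that
  proof (induction "Polynomial.degree p" arbitrary: p q rule: less_induct)
    case less
    show ?case
    proof (cases "p = 0")
      case True
      then have "Polynomial.coeff q i = 0" for i
        using less.prems(1) hom_graphD(2,3)[OF G] by (auto simp: poly_pairs_def)
      then have "q = 0" by (simp add: poly_eq_iff)
      then show ?thesis by simp
    next
      case False
      let ?d = "Polynomial.degree p" and ?e = "Polynomial.degree m"
      have le: "?e \<le> ?d" using min less.prems False by blast
      have lm: "(Polynomial.coeff m ?e, Polynomial.coeff m' ?e) \<in> G" using m(1) by (simp add: poly_pairs_def)
      have nz: "Polynomial.coeff m ?e \<noteq> 0" using m(2) by simp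
      have inv: "(inverse (Polynomial.coeff m ?e), inverse (Polynomial.coeff m' ?e)) \<in> G"
        using field_hom_graph_inverse[OF G K alg lm nz] by simp
      define c where "c = Polynomial.coeff p ?d * inverse (Polynomial.coeff m ?e)"
      define c' where "c' = Polynomial.coeff q ?d * inverse (Polynomial.coeff m' ?e)"
      have cG: "(c, c') \<in> G" unfolding c_def c'_def
        using less.prems(1) inv by (intro hom_graphD(5)[OF G]) (auto simp: poly_pairs_def)
      define p1 where "p1 = p - Polynomial.monom c (?d - ?e) * m"
      define q1 where "q1 = q - Polynomial.monom c' (?d - ?e) * m'"
      have pq1: "(p1, q1) \<in> poly_pairs G" unfolding p1_def q1_def
        by (intro poly_pairs_closed[OF G] less.prems(1) m(1) cG)
      have p1z: "poly p1 z = 0" using less.prems(2) m(3) by (simp add: p1_def)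
      have q1z: "poly q1 z' = poly q z'" using m(4) by (simp add: q1_def)
      have "Polynomial.degree (Polynomial.monom c (?d - ?e) * m) \<le> ?d"
        using degree_mult_le[of "Polynomial.monom c (?d - ?e)" m] degree_monom_le[of c "?d - ?e"] le by linarith
      then have d1: "Polynomial.degree p1 \<le> ?d" unfolding p1_def by (intro degree_diff_le) auto
      have "Polynomial.coeff (Polynomial.monom c (?d - ?e) * m) ?d = c * Polynomial.coeff m ?e"
        using le by (simp add: coeff_monom_mult)
      also have "\<dots> = Polynomial.coeff p ?d" using nz by (simp add: c_def)
      finally have "Polynomial.coeff p1 ?d = 0" by (simp add: p1_def)
      then have "p1 = 0 \<or> Polynomial.degree p1 < ?d" using d1 by (rule eq_zero_or_degree_less[rotated])
      then have "poly q1 z' = 0"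
      proof
        assume "p1 = 0"
        then have "Polynomial.coeff q1 i = 0" for i
          using pq1 hom_graphD(2,3)[OF G] by (auto simp: poly_pairs_def)
        then have "q1 = 0" by (simp add: poly_eq_iff)
        then show ?thesis by simp
      next
        assume "Polynomial.degree p1 < ?d"
        then show ?thesis using less.hyps pq1 p1z by blast
      qed
      then show ?thesis using q1z by simp
    qed
  qed
  have const: "([:x:], [:a:]) \<in> poly_pairs G" if "(x, a) \<in> G" for x a
    using that by (intro poly_pairs_closed(6,7)[OF G])
  show sub: "G \<subseteq> extend G z z'"
  proof
    fix y assume "y \<in> G"
    then obtain x a where "y = (x, a)" "(x, a) \<in> G" by (cases y) auto
    then have "y = (poly [:x:] z, poly [:a:] z')" "([:x:], [:a:]) \<in> poly_pairs G" using const by auto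
    then show "y \<in> extend G z z'" unfolding extend_def by blast
  qed
  have "([:0, 1:], [:0, 1:]) \<in> poly_pairs G"
    by (intro poly_pairs_closed(6,7)[OF G] hom_graphD(1,2)[OF G])
  moreover have "(z, z') = (poly [:0, 1:] z, poly [:0, 1:] z')" by simp
  ultimately show "(z, z') \<in> extend G z z'" unfolding extend_def by blast
  show "hom_graph (extend G z z')"
    unfolding hom_graph_def
  proof (intro conjI allI impI)
    show "(1, 1) \<in> extend G z z'" using sub hom_graphD(1)[OF G] by blast
  next
    fix x a b assume "(x, a) \<in> extend G z z'" "(x, b) \<in> extend G z z'"
    then obtain p q p' q' where *: "x = poly p z" "a = poly q z'" "(p, q) \<in> poly_pairs G"
       "x = poly p' z" "b = poly q' z'" "(p', q') \<in> poly_pairs G" unfolding extend_def by blast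
    have "poly (q - q') z' = 0"
      by (rule key[of "p - p'"]) (use * poly_pairs_closed(3)[OF G] in auto)
    then show "a = b" using * by simp
  next
    fix x a y b assume "(x, a) \<in> extend G z z'" "(y, b) \<in> extend G z z'"
    then obtain p q p' q' where *: "x = poly p z" "a = poly q z'" "(p, q) \<in> poly_pairs G"
       "y = poly p' z" "b = poly q' z'" "(p', q') \<in> poly_pairs G" unfolding extend_def by blast
    have "(x + y, a + b) = (poly (p + p') z, poly (q + q') z')" using * by simp
    then show "(x + y, a + b) \<in> extend G z z'"
      unfolding extend_def using poly_pairs_closed(1)[OF G *(3) *(6)] by blast
    have "(x * y, a * b) = (poly (p * p') z, poly (q * q') z')" using * by simp
    then show "(x * y, a * b) \<in> extend G z z'"
      unfolding extend_def using poly_pairs_closed(2)[OF G *(3) *(6)] by blast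
  next
    fix x a assume "(x, a) \<in> extend G z z'"
    then obtain p q where *: "x = poly p z" "a = poly q z'" "(p, q) \<in> poly_pairs G" unfolding extend_def by blast
    have "(- x, - a) = (poly (- p) z, poly (- q) z')" using * by simp
    then show "(- x, - a) \<in> extend G z z'"
      unfolding extend_def using poly_pairs_closed(4)[OF G *(3)] by blast
  qed
qed

lemma exists_minimal_pair:
  assumes K: "Id_on K \<subseteq> G" and alg: "\<not> transc K z"
  obtains m m' where "(m, m') \<in> poly_pairs G" "m \<noteq> 0" "poly m z = 0"
    "\<forall>p q. (p, q) \<in> poly_pairs G \<longrightarrow> p \<noteq> 0 \<longrightarrow> poly p z = 0 \<longrightarrow> Polynomial.degree m \<le> Polynomial.degree p"
proof -
  define Q where "Q = (\<lambda>n. \<exists>p q. (p, q) \<in> poly_pairs G \<and> p \<noteq> 0 \<and> poly p z = 0 \<and> Polynomial.degree p = n)"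
  from alg obtain p where "p \<in> polys K" "p \<noteq> 0" "poly p z = 0" unfolding transc_def by blast
  moreover from this K have "(p, p) \<in> poly_pairs G" by (auto simp: poly_pairs_def polys_def Id_on_def)
  ultimately have "\<exists>n. Q n" unfolding Q_def by blast
  then have Q: "Q (LEAST n. Q n)" "\<And>n. Q n \<Longrightarrow> (LEAST n. Q n) \<le> n" by (auto intro: LeastI_ex Least_le)
  from Q(1) obtain m m' where "(m, m') \<in> poly_pairs G" "m \<noteq> 0" "poly m z = 0" "Polynomial.degree m = (LEAST n. Q n)"
    unfolding Q_def by blast
  moreover from this(4) have "Polynomial.degree m \<le> Polynomial.degree p"
    if "(p, q) \<in> poly_pairs G" "p \<noteq> 0" "poly p z = 0" for p q
    using Q(2)[of "Polynomial.degree p"] that unfolding Q_def by auto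
  ultimately show thesis using that by blast
qed

definition is_aut :: "'a::field set \<Rightarrow> ('a \<Rightarrow> 'a) \<Rightarrow> bool"
  where "is_aut K s \<longleftrightarrow> bij s \<and> (\<forall>x y. s (x + y) = s x + s y) \<and> (\<forall>x y. s (x * y) = s x * s y) \<and> (\<forall>x\<in>K. s x = x)"

text \<open>
  A maximal extension is total, because a minimal relation of a further element $z$ has an image of
  positive degree, and this image has a root to which $z$ can be sent. A total one is injective since inverses exist,
  and surjective since it permutes the finitely many roots of each polynomial over $K$.
\<close>
lemma hom_graph_extends_to_aut:
  fixes K :: "'a::alg_closed_field set"
  assumes K: "is_subfield K" and alg: "\<And>x. \<not> transc K x" and G: "hom_graph G" "Id_on K \<subseteq> G"
  obtains s where "is_aut K s" "\<And>x a. (x, a) \<in> G \<Longrightarrow> s x = a"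
proof -
  let ?A = "{H. hom_graph H \<and> G \<subseteq> H}"
  have "\<exists>M\<in>?A. \<forall>U\<in>?A. M \<subseteq> U \<longrightarrow> U = M"
  proof (rule subset_Zorn_nonempty)
    show "?A \<noteq> {}" using G by auto
    fix C assume C: "C \<noteq> {}" "subset.chain ?A C"
    from C(2) have CA: "C \<subseteq> ?A" unfolding subset_chain_def by (rule conjunct1)
    from C(2) have ch: "U \<subseteq> V \<or> V \<subseteq> U" if "U \<in> C" "V \<in> C" for U V
      using that unfolding subset_chain_def by simp
    have two: "\<exists>U\<in>C. x \<in> U \<and> y \<in> U" if "x \<in> \<Union>C" "y \<in> \<Union>C" for x y
      using that ch by blast
    have CH: "hom_graph U" if "U \<in> C" for U using CA that by blast
    have "hom_graph (\<Union>C)" unfolding hom_graph_def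
    proof (intro conjI allI impI)
      show "(1, 1) \<in> \<Union>C" using C(1) CH hom_graphD(1) by blast
    next
      fix x a b assume "(x, a) \<in> \<Union>C" "(x, b) \<in> \<Union>C"
      from two[OF this] obtain U where "U \<in> C" "(x, a) \<in> U" "(x, b) \<in> U" by blast
      then show "a = b" using hom_graphD(3)[OF CH] by blast
    next
      fix x a y b assume "(x, a) \<in> \<Union>C" "(y, b) \<in> \<Union>C"
      from two[OF this] obtain U where U: "U \<in> C" "(x, a) \<in> U" "(y, b) \<in> U" by blast
      show "(x + y, a + b) \<in> \<Union>C" "(x * y, a * b) \<in> \<Union>C"
        using hom_graphD(4,5)[OF CH[OF U(1)] U(2,3)] U(1) by blast+
    next
      fix x a assume "(x, a) \<in> \<Union>C"
      then obtain U where U: "U \<in> C" "(x, a) \<in> U" by blast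
      show "(- x, - a) \<in> \<Union>C" using hom_graphD(6)[OF CH[OF U(1)] U(2)] U(1) by blast
    qed
    moreover have "G \<subseteq> \<Union>C" using C(1) CA by blast
    ultimately show "\<Union>C \<in> ?A" by blast
  qed
  then obtain M where M0: "M \<in> ?A" "\<forall>U\<in>?A. M \<subseteq> U \<longrightarrow> U = M" by (rule bexE)
  then have M: "hom_graph M" "G \<subseteq> M" "hom_graph U \<Longrightarrow> G \<subseteq> U \<Longrightarrow> M \<subseteq> U \<Longrightarrow> U = M" for U by simp_all
  have KM: "Id_on K \<subseteq> M" using G(2) M(2) by blast
  have total: "\<exists>a. (z, a) \<in> M" for z
  proof -
    obtain m m' where m: "(m, m') \<in> poly_pairs M" "m \<noteq> 0" "poly m z = 0"
      "\<forall>p q. (p, q) \<in> poly_pairs M \<longrightarrow> p \<noteq> 0 \<longrightarrow> poly p z = 0 \<longrightarrow> Polynomial.degree m \<le> Polynomial.degree p"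
      using exists_minimal_pair[OF KM alg] by metis
    have "Polynomial.degree m \<noteq> 0"
    proof
      assume "Polynomial.degree m = 0"
      then obtain c where "m = [:c:]" by (rule degree_eq_zeroE)
      then show False using m by simp
    qed
    moreover have "Polynomial.coeff m' (Polynomial.degree m) \<noteq> 0"
    proof -
      have "(Polynomial.coeff m (Polynomial.degree m), Polynomial.coeff m' (Polynomial.degree m)) \<in> M"
        using m(1) by (simp add: poly_pairs_def)
      then show ?thesis using field_hom_graph_inverse[OF M(1) K KM alg] m(2) by simp
    qed
    then have "Polynomial.degree m \<le> Polynomial.degree m'" by (rule le_degree)
    ultimately have "Polynomial.degree m' > 0" by simp
    then obtain z' where z': "poly m' z' = 0" using alg_closed_imp_poly_has_root[of m'] by blast
    note e = hom_graph_extend[OF M(1) K KM alg m(1-3) z' m(4)]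
    have "extend M z z' = M" using e M(2) by (intro M(3)) auto
    then show ?thesis using e(3) by auto
  qed
  define s where "s = (\<lambda>x. SOME a. (x, a) \<in> M)"
  have sM: "(x, s x) \<in> M" for x unfolding s_def using total[of x] by (rule someI_ex)
  have s_eq: "s x = a" if "(x, a) \<in> M" for x a using hom_graphD(3)[OF M(1) sM that] .
  have hom: "s (x + y) = s x + s y" "s (x * y) = s x * s y" "s (x - y) = s x - s y" for x y
    using hom_graphD(4,5,7)[OF M(1) sM sM] by (auto intro: s_eq)
  have fix_K: "s x = x" if "x \<in> K" for x using that KM by (intro s_eq) (auto simp: Id_on_def)
  have inj: "inj s"
  proof (rule injI)
    fix x y assume "s x = s y"
    then have "s (x - y) = 0" using hom(3) by simp
    then have "x - y = 0"
      using field_hom_graph_inverse[OF M(1) K KM alg sM, of "x - y"] by auto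
    then show "x = y" by simp
  qed
  have "surj s"
  proof -
    have "\<exists>x. s x = y" for y
    proof -
      obtain p where p: "p \<in> polys K" "p \<noteq> 0" "poly p y = 0" using alg[of y] unfolding transc_def by blast
      let ?R = "{x. poly p x = 0}"
      have fin: "finite ?R" using p(2) by (rule poly_roots_finite)
      have pp: "(p, p) \<in> poly_pairs M" using p(1) KM by (auto simp: poly_pairs_def polys_def Id_on_def)
      have "s (poly p x) = poly p (s x)" for x
        by (rule s_eq[OF hom_graph_poly[OF M(1) sM pp]])
      moreover have "s 0 = 0" using hom_graphD(2)[OF M(1)] by (rule s_eq)
      ultimately have "poly p (s x) = 0" if "poly p x = 0" for x using that by metis
      then have "s ` ?R \<subseteq> ?R" by auto
      then have "s ` ?R = ?R" using fin inj by (intro endo_inj_surj) (auto intro: inj_on_subset)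
      moreover have "y \<in> ?R" using p(3) by simp
      ultimately have "y \<in> s ` ?R" by simp
      then show ?thesis by blast
    qed
    then show ?thesis by (metis surj_def)
  qed
  then have "is_aut K s" unfolding is_aut_def using inj hom fix_K by (auto intro: bijI)
  then show thesis using that[of s] s_eq M(2) by blast
qed

lemma hom_graph_Id_on:
  assumes "is_subfield K" shows "hom_graph (Id_on K)"
  unfolding hom_graph_def using is_subfieldD(2,3,4,5)[OF assms] by (auto simp: Id_on_def)

text \<open>
  The minimal polynomial of $x$ has degree at least 2 and, in characteristic 0, only simple roots.
  Hence it has a root other than $x$, and sending $x$ to it extends to an automorphism.
\<close>
theorem exists_moving_aut:
  fixes K :: "'a::{alg_closed_field,field_char_0} set"
  assumes K: "is_subfield K" and alg: "\<And>x. \<not> transc K x" and x: "x \<notin> K"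
  obtains s where "is_aut K s" "s x \<noteq> x"
proof -
  let ?G = "Id_on K"
  note G = hom_graph_Id_on[OF K]
  obtain m m' where m: "(m, m') \<in> poly_pairs ?G" "m \<noteq> 0" "poly m x = 0"
      "\<forall>p q. (p, q) \<in> poly_pairs ?G \<longrightarrow> p \<noteq> 0 \<longrightarrow> poly p x = 0 \<longrightarrow> Polynomial.degree m \<le> Polynomial.degree p"
      using exists_minimal_pair[OF order.refl alg] by metis
  have mK: "m \<in> polys K" and mm: "m' = m" using m(1) by (auto simp: poly_pairs_def polys_def Id_on_def poly_eq_iff)
  from m(3) obtain r where r: "m = [:- x, 1:] * r" unfolding poly_eq_0_iff_dvd by (rule dvdE)
  have r0: "r \<noteq> 0" using m(2) r by auto
  have deg_m: "Polynomial.degree m = Suc (Polynomial.degree r)" unfolding r using r0 by (subst degree_mult_eq) auto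
  have "Polynomial.degree r \<noteq> 0"
  proof
    assume "Polynomial.degree r = 0"
    then obtain c where c: "r = [:c:]" by (rule degree_eq_zeroE)
    have "Polynomial.coeff m 0 \<in> K" "Polynomial.coeff m 1 \<in> K" using mK by (auto simp: polys_def)
    then have "- x * c \<in> K" "c \<in> K" unfolding r c by (simp_all add: mult.commute)
    then have "- (- x * c / c) \<in> K" by (intro is_subfieldD(4,8)[OF K])
    then show False using x c r0 by simp
  qed
  then obtain x' where x': "poly r x' = 0" using alg_closed_imp_poly_has_root[of r] by blast
  have "poly r x \<noteq> 0"
  proof
    assume "poly r x = 0"
    moreover have "pderiv m = [:- x, 1:] * pderiv r + r * pderiv [:- x, 1:]" unfolding r by (rule pderiv_mult)
    ultimately have "poly (pderiv m) x = 0" by (simp add: pderiv_pCons)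
    moreover have "pderiv m \<noteq> 0" using deg_m by (simp add: pderiv_eq_0_iff)
    moreover have "(pderiv m, pderiv m) \<in> poly_pairs ?G"
      using polys_closed(9)[OF K mK] by (auto simp: poly_pairs_def polys_def Id_on_def)
    ultimately have "Polynomial.degree m \<le> Polynomial.degree (pderiv m)" using m(4) by blast
    then show False using deg_m degree_pderiv[of m] by simp
  qed
  then have ne: "x' \<noteq> x" using x' by auto
  have "poly m' x' = 0" using x' by (simp add: mm r)
  note e = hom_graph_extend[OF G K order.refl alg m(1-3) this m(4)]
  obtain s where "is_aut K s" "\<And>y a. (y, a) \<in> extend ?G x x' \<Longrightarrow> s y = a"
    using hom_graph_extends_to_aut[OF K alg e(1,2)] by metis
  then show thesis using that e(3) ne by metis
qed

section \<open>The complex numbers as an algebraic closure\<close>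

abbreviation LC :: "complex ring" where "LC \<equiv> ring_of_type_algebra"

lemma LC_simps [simp]:
  "carrier LC = UNIV" "x \<otimes>\<^bsub>LC\<^esub> y = x * y" "\<one>\<^bsub>LC\<^esub> = 1" "\<zero>\<^bsub>LC\<^esub> = 0" "x \<oplus>\<^bsub>LC\<^esub> y = x + y"
  by (simp_all add: ring_of_type_algebra_def)

lemma field_LC: "field LC" by (rule field_from_type_algebra)

interpretation LC: domain LC using field_LC by (rule field.axioms(1))

lemma LC_a_inv [simp]: "\<ominus>\<^bsub>LC\<^esub> x = - x"
  by (rule LC.minus_equality) auto

lemma LC_pow [simp]: "x [^]\<^bsub>LC\<^esub> (n::nat) = x ^ n"
  by (induction n) (auto simp: mult.commute)

lemma LC_inv: "x \<noteq> 0 \<Longrightarrow> inv\<^bsub>LC\<^esub> x = inverse x"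
  by (rule LC.inv_unique'[symmetric]) auto

lemma LC_finsum [simp]: "finsum LC f I = sum f I"
proof (induction I rule: infinite_finite_induct)
  case (infinite A)
  then show ?case by (simp add: LC.add.finprod_infinite flip: finsum_def)
qed (auto simp: LC.finsum_insert)

lemma LC_eval: "LC.eval p x = poly (Poly (rev p)) x"
  by (induction p) (auto simp: Poly_append poly_monom)

lemma subfield_LC: assumes "is_subfield K" shows "subfield K LC"
proof (rule field.subfieldI'[OF field_LC])
  show "subring K LC" using is_subfieldD[OF assms] by (intro LC.subringI) auto
  show "\<And>k. k \<in> K - {\<zero>\<^bsub>LC\<^esub>} \<Longrightarrow> inv\<^bsub>LC\<^esub> k \<in> K" using is_subfieldD(6)[OF assms] by (auto simp: LC_inv)
qed

lemma poly_list_carrier: "p \<in> carrier (univ_poly LC K) \<longleftrightarrow> p = [] \<or> set p \<subseteq> K \<and> hd p \<noteq> 0"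
  by (simp add: univ_poly_carrier[symmetric] polynomial_def)

lemma list_to_poly: 
  assumes "p \<in> carrier (univ_poly LC K)" "0 \<in> K"
  shows "Poly (rev p) \<in> polys K" "Polynomial.degree (Poly (rev p)) = length p - 1" "Poly (rev p) = 0 \<longleftrightarrow> p = []"
proof -
  have set: "set p \<subseteq> K" and hd: "p \<noteq> [] \<Longrightarrow> hd p \<noteq> 0" using assms by (auto simp: poly_list_carrier)
  show "Poly (rev p) \<in> polys K"
    unfolding polys_def using set assms(2) by (auto simp: nth_default_def) (metis length_rev nth_mem set_rev subsetD)
  have "dropWhile ((=) 0) p = p" by (cases p) (use hd in auto)
  then have co: "coeffs (Poly (rev p)) = rev p" by (simp add: strip_while_def)
  show "Polynomial.degree (Poly (rev p)) = length p - 1"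
    unfolding degree_eq_length_coeffs co by simp
  show "Poly (rev p) = 0 \<longleftrightarrow> p = []" using co by (metis coeffs_eq_Nil rev.simps(1) rev_rev_ident)
qed

lemma poly_to_list:
  assumes "p \<in> polys K"
  shows "rev (coeffs p) \<in> carrier (univ_poly LC K)"
proof (cases "p = 0")
  case False
  then have "hd (rev (coeffs p)) \<noteq> 0" by (simp add: hd_rev last_coeffs_eq_coeff_degree)
  moreover have "set (coeffs p) \<subseteq> K" using assms by (auto simp: coeffs_def polys_def)
  ultimately show ?thesis by (simp add: poly_list_carrier)
qed (simp add: poly_list_carrier)

lemma LC_algebraically_closed: "algebraically_closed LC"
proof (rule field.algebraically_closedI[OF field_LC])
  fix p assume p: "p \<in> carrier (univ_poly LC (carrier LC))" "length p - 1 > 1"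
  then have "Polynomial.degree (Poly (rev p)) > 0" using list_to_poly(2)[of p UNIV] by simp
  then obtain x where "poly (Poly (rev p)) x = 0" using alg_closed_imp_poly_has_root by blast
  then show "\<exists>x\<in>carrier LC. LC.eval p x = \<zero>\<^bsub>LC\<^esub>" by (auto simp: LC_eval)
qed

lemma algebraic_LC:
  assumes "\<not> transc K x"
  shows "(LC.algebraic over K) x"
proof -
  obtain p where p: "p \<in> polys K" "p \<noteq> 0" "poly p x = 0" using assms unfolding transc_def by blast
  have "rev (coeffs p) \<in> carrier (univ_poly LC K)" "[] \<in> carrier (univ_poly LC K)"
    using poly_to_list[OF p(1)] by (auto simp: poly_list_carrier)
  moreover have "LC.eval (rev (coeffs p)) x = LC.eval [] x" using p(3) unfolding LC_eval by simp
  moreover have "rev (coeffs p) \<noteq> []" using p(2) by simp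
  ultimately have "\<not> inj_on (\<lambda>p. LC.eval p x) (carrier (univ_poly LC K))" unfolding inj_on_def by blast
  then show ?thesis unfolding over_def LC.transcendental_def by simp
qed

theorem algebraic_closure_LC:
  assumes "is_subfield K" "\<And>x. \<not> transc K x"
  shows "algebraic_closure LC K"
proof (intro algebraic_closure.intro algebraic_closure_axioms.intro)
  show "field LC" by (rule field_LC)
  show "subfield K LC" by (rule subfield_LC[OF assms(1)])
  show "(LC.algebraic over K) x" for x using assms(2) by (rule algebraic_LC)
  show "LC.splitted P" if "P \<in> carrier (univ_poly LC K)" for P
    using algebraically_closed.roots_over_carrier[OF LC_algebraically_closed, of P] that
    by (auto simp: poly_list_carrier)
qed

text \<open>
  A double root $y$ of a minimal polynomial would also be a root of its derivative. That polynomial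
  is the minimal polynomial of $y$ as well, and in characteristic 0 its derivative is nonzero of
  smaller degree.
\<close>
lemma sep_closure_LC:
  assumes K: "is_subfield K" and alg: "\<And>x. \<not> transc K x"
  shows "algebraic_closure.sep_closure LC K = UNIV"
proof -
  interpret algebraic_closure LC K by (rule algebraic_closure_LC[OF assms])
  note sf = subfield_LC[OF K]
  have mem: "x \<in> carrier LC" for x by simp
  have "LC.alg_mult (LC.Irr K x) y \<le> 1" for x y
  proof (rule ccontr)
    let ?p = "LC.Irr K x" and ?r = "[1, - y]"
    assume "\<not> LC.alg_mult ?p y \<le> 1"
    then have two: "2 \<le> LC.alg_mult ?p y" by simp
    note irr = LC.IrrE[OF sf mem algebraic_LC[OF alg], of x]
    have pc: "?p \<in> carrier (univ_poly LC (carrier LC))" using irr(1) by (auto simp: poly_list_carrier)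
    interpret UP: cring "univ_poly LC (carrier LC)"
      by (rule LC.univ_poly_is_cring[OF LC.carrier_is_subring])
    have rc: "?r \<in> carrier (univ_poly LC (carrier LC))" by (simp add: poly_list_carrier)
    have "(?r [^]\<^bsub>univ_poly LC (carrier LC)\<^esub> (2::nat)) pdivides\<^bsub>LC\<^esub> ?p"
      using LC.le_alg_mult_imp_pdivides[OF mem pc two] by simp
    then obtain q where q: "q \<in> carrier (univ_poly LC (carrier LC))"
      "?p = (?r [^]\<^bsub>univ_poly LC (carrier LC)\<^esub> (2::nat)) \<otimes>\<^bsub>univ_poly LC (carrier LC)\<^esub> q"
      unfolding pdivides_def factor_def by blast
    have ev: "LC.eval ?p z = (z - y) ^ 2 * LC.eval q z" for z
    proof -
      interpret ev: ring_hom_cring "univ_poly LC (carrier LC)" LC "\<lambda>p. LC.eval p z"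
        using LC.eval_cring_hom[OF LC.carrier_is_subring, of z] by simp
      have sq: "?r [^]\<^bsub>univ_poly LC (carrier LC)\<^esub> (2::nat) = ?r \<otimes>\<^bsub>univ_poly LC (carrier LC)\<^esub> ?r"
        unfolding numeral_2_eq_2 UP.nat_pow_Suc UP.nat_pow_0 UP.l_one[OF rc] ..
      have "LC.eval ?r z = z - y" by simp
      then show ?thesis
        unfolding q(2) sq ev.hom_mult[OF UP.m_closed[OF rc rc] q(1)] ev.hom_mult[OF rc rc]
        by (simp add: power2_eq_square)
    qed
    define P where "P = Poly (rev ?p)"
    have "poly P z = poly ([:- y, 1:] ^ 2 * Poly (rev q)) z" for z
      using ev[of z] unfolding P_def LC_eval by simp
    then have P: "P = [:- y, 1:] ^ 2 * Poly (rev q)" unfolding poly_eq_poly_eq_iff[symmetric] by (rule ext)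
    have dP: "pderiv P = [:- y, 1:] ^ 2 * pderiv (Poly (rev q)) + Poly (rev q) * pderiv ([:- y, 1:] ^ 2)"
      unfolding P by (rule pderiv_mult)
    have "poly (pderiv ([:- y, 1:] ^ 2)) y = 0" by (simp add: power2_eq_square pderiv_mult del: mult_pCons_left mult_pCons_right)
    then have roots: "poly P y = 0" "poly (pderiv P) y = 0"
      by (simp add: P, simp add: dP)
    have ev_y: "LC.eval ?p y = 0" using roots(1) by (simp add: P_def LC_eval)
    have same: "LC.Irr K y = ?p"
      using LC.minimal_polynomial_is_unique[OF sf mem algebraic_LC[OF alg], of y]
        LC.IrrE[OF sf mem algebraic_LC[OF alg], of y] irr ev_y by auto
    have PK: "P \<in> polys K" unfolding P_def by (rule list_to_poly(1)[OF irr(1)]) (rule is_subfieldD(1)[OF K])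
    have "?p \<noteq> []" using two by (auto simp: LC.alg_mult_def)
    then have "P \<noteq> 0" using list_to_poly(3)[OF irr(1) is_subfieldD(1)[OF K]] by (simp add: P_def)
    have "Polynomial.degree P > 0"
    proof (rule ccontr)
      assume "\<not> ?thesis"
      then have "Polynomial.degree P = 0" by simp
      then obtain c where "P = [:c:]" by (rule degree_eq_zeroE)
      then show False using roots(1) \<open>P \<noteq> 0\<close> by simp
    qed
    let ?d = "rev (coeffs (pderiv P))"
    have dK: "?d \<in> carrier (univ_poly LC K)" by (intro poly_to_list polys_closed(9)[OF K] PK)
    have "LC.eval ?d y = \<zero>\<^bsub>LC\<^esub>" using roots(2) by (simp add: LC_eval)
    then have "LC.Irr K y pdivides\<^bsub>LC\<^esub> ?d" by (intro LC.Irr_minimal[OF sf mem algebraic_LC[OF alg] dK])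
    moreover have "?d \<noteq> []" using \<open>Polynomial.degree P > 0\<close> by (simp add: pderiv_eq_0_iff)
    ultimately have "length ?p - 1 \<le> length ?d - 1"
      using LC.pdivides_imp_degree_le[OF subfieldE(1)[OF sf] irr(1) dK] same by simp
    moreover have "length ?p - 1 = Polynomial.degree P" unfolding P_def
      by (rule list_to_poly(2)[symmetric, OF irr(1)]) (rule is_subfieldD(1)[OF K])
    moreover have "length ?d - 1 < Polynomial.degree P"
      using degree_pderiv[of P] \<open>Polynomial.degree P > 0\<close> degree_eq_length_coeffs[of "pderiv P"] by simp
    ultimately show False by simp
  qed
  then show ?thesis unfolding sep_closure_def by auto
qed

lemma Gal_LC:
  assumes K: "is_subfield K" and alg: "\<And>x. \<not> transc K x"
  shows "algebraic_closure.Gal LC K = {s. is_aut K s}"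
proof -
  interpret algebraic_closure LC K by (rule algebraic_closure_LC[OF assms])
  have one: "s 1 = 1" if "is_aut K s" for s using that is_subfieldD(2)[OF K] by (simp add: is_aut_def)
  show ?thesis
    unfolding Gal_def sep_closure_LC[OF assms] ring_iso_def ring_hom_def
    using one by (auto simp: is_aut_def extensional_def)
qed

section \<open>Matrices and general linear groups\<close>

definition mats :: "nat \<Rightarrow> 'a sqmat set" where "mats m = (idx m \<rightarrow>\<^sub>E UNIV)"

definition mmul :: "nat \<Rightarrow> 'a::comm_ring_1 sqmat \<Rightarrow> 'a sqmat \<Rightarrow> 'a sqmat"
  where "mmul m A B = (\<lambda>(i, j)\<in>idx m. \<Sum>k<m. A (i, k) * B (k, j))"

definition mone :: "nat \<Rightarrow> 'a::comm_ring_1 sqmat"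
  where "mone m = (\<lambda>(i, j)\<in>idx m. if i = j then 1 else 0)"

lemma mats_eqI:
  assumes "A \<in> mats m" "B \<in> mats m" "\<And>i j. i < m \<Longrightarrow> j < m \<Longrightarrow> A (i, j) = B (i, j)"
  shows "A = B"
  by (rule extensionalityI[of _ "idx m"]) (use assms in \<open>auto simp: PiE_def mats_def\<close>)

lemma restrict_mats [simp]: "restrict f (idx m) \<in> mats m"
  by (auto simp: PiE_def mats_def)

lemma mmul_mats [simp]: "mmul m A B \<in> mats m"
  unfolding mmul_def by (rule restrict_mats)

lemma mone_mats [simp]: "mone m \<in> mats m"
  unfolding mone_def by (rule restrict_mats)

lemma mmul_entry: "i < m \<Longrightarrow> j < m \<Longrightarrow> mmul m A B (i, j) = (\<Sum>k<m. A (i, k) * B (k, j))"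
  by (simp add: mmul_def)

lemma mone_entry: "i < m \<Longrightarrow> j < m \<Longrightarrow> mone m (i, j) = (if i = j then 1 else 0)"
  by (simp add: mone_def)

lemma mmul_assoc: "mmul m (mmul m A B) C = mmul m A (mmul m B C)"
proof (rule mats_eqI)
  fix i j assume ij: "i < m" "j < m"
  have "mmul m (mmul m A B) C (i, j) = (\<Sum>k<m. \<Sum>l<m. A (i, l) * B (l, k) * C (k, j))"
    using ij by (simp add: mmul_entry sum_distrib_right)
  also have "\<dots> = (\<Sum>l<m. \<Sum>k<m. A (i, l) * B (l, k) * C (k, j))" by (rule sum.swap)
  also have "\<dots> = mmul m A (mmul m B C) (i, j)"
    using ij by (simp add: mmul_entry sum_distrib_left mult.assoc)
  finally show "mmul m (mmul m A B) C (i, j) = mmul m A (mmul m B C) (i, j)" .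
qed auto

lemma mmul_one: 
  assumes "A \<in> mats m"
  shows "mmul m (mone m) A = A" "mmul m A (mone m) = A"
proof -
  show "mmul m (mone m) A = A"
  proof (rule mats_eqI)
    fix i j assume ij: "i < m" "j < m"
    then have "mmul m (mone m) A (i, j) = (\<Sum>k<m. if k = i then A (k, j) else 0)"
      unfolding mmul_entry[OF ij] by (intro sum.cong) (auto simp: mone_entry)
    then show "mmul m (mone m) A (i, j) = A (i, j)" using ij by simp
  qed (use assms in auto)
  show "mmul m A (mone m) = A"
  proof (rule mats_eqI)
    fix i j assume ij: "i < m" "j < m"
    then have "mmul m A (mone m) (i, j) = (\<Sum>k<m. if k = j then A (i, k) else 0)"
      unfolding mmul_entry[OF ij] by (intro sum.cong) (auto simp: mone_entry)
    then show "mmul m A (mone m) (i, j) = A (i, j)" using ij by simp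
  qed (use assms in auto)
qed

locale base_field =
  fixes K :: "complex set"
  assumes subfield: "is_subfield K" and algebraic: "\<And>x. \<not> transc K x"

sublocale base_field \<subseteq> algebraic_closure LC K
  by (rule algebraic_closure_LC[OF subfield algebraic])

context base_field
begin

lemma sep_closure_UNIV [simp]: "sep_closure = UNIV"
  by (rule sep_closure_LC[OF subfield algebraic])

lemma Gal_iff: "s \<in> Gal \<longleftrightarrow> is_aut K s"
  unfolding Gal_LC[OF subfield algebraic] by simp

lemma Gal_fixed:
  assumes "\<And>s. s \<in> Gal \<Longrightarrow> s x = x" shows "x \<in> K"
  using exists_moving_aut[OF subfield algebraic, of x] assms Gal_iff by metis

lemma GalD:
  assumes "s \<in> Gal"
  shows "s (x + y) = s x + s y" "s (x * y) = s x * s y" "s 0 = 0" "s 1 = 1" "s (- x) = - s x"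
    "s (x - y) = s x - s y" "s (inverse x) = inverse (s x)" "s (x / y) = s x / s y" "s (x ^ n) = s x ^ n"
    "x \<in> K \<Longrightarrow> s x = x" "s x = 0 \<longleftrightarrow> x = 0"
proof -
  have s: "bij s" "\<And>x y. s (x + y) = s x + s y" "\<And>x y. s (x * y) = s x * s y" "\<And>x. x \<in> K \<Longrightarrow> s x = x"
    using assms unfolding Gal_iff is_aut_def by auto
  show "s (x + y) = s x + s y" "s (x * y) = s x * s y" "x \<in> K \<Longrightarrow> s x = x" using s by auto
  show 0: "s 0 = 0" and 1: "s 1 = 1" using s(4) is_subfieldD(1,2)[OF subfield] by auto
  show u: "s (- x) = - s x" for x using s(2)[of x "- x"] 0 by (simp add: add_eq_0_iff2 add.commute[of "s x"])
  show "s (x - y) = s x - s y" using s(2)[of x "- y"] u by simp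
  show inv: "s (inverse x) = inverse (s x)" for x
  proof (cases "x = 0")
    case False
    then have "s x * s (inverse x) = 1" using s(3)[of x "inverse x"] 1 by simp
    then show ?thesis by (metis inverse_unique)
  qed (simp add: 0)
  show "s (x / y) = s x / s y" by (simp add: divide_inverse s inv)
  show "s (x ^ n) = s x ^ n" by (induction n) (auto simp: 1 s)
  show "s x = 0 \<longleftrightarrow> x = 0" using s(1) 0 by (metis bij_def injD)
qed

lemma Gal_sum: "s \<in> Gal \<Longrightarrow> s (sum f I) = (\<Sum>i\<in>I. s (f i))"
  by (induction I rule: infinite_finite_induct) (auto simp: GalD)

lemma Gal_comp: "s \<in> Gal \<Longrightarrow> t \<in> Gal \<Longrightarrow> s \<circ> t \<in> Gal"
  unfolding Gal_iff is_aut_def by (auto intro: bij_comp)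

lemma Gal_id: "id \<in> Gal" unfolding Gal_iff is_aut_def by auto

lemma Gal_inv: assumes "s \<in> Gal" shows "inv_into UNIV s \<in> Gal"
proof -
  define t where "t = inv_into UNIV s"
  have b: "bij s" using assms unfolding Gal_iff is_aut_def by auto
  have eq: "t x = y" if "x = s y" for x y using that b by (simp add: t_def bij_is_inj)
  have "s (t x) = x" for x using b by (simp add: t_def bij_is_surj surj_f_inv_f)
  then have "t (x + y) = t x + t y" "t (x * y) = t x * t y" for x y
    by (auto intro!: eq simp: GalD[OF assms])
  moreover have "t x = x" if "x \<in> K" for x by (rule eq) (simp add: GalD(10)[OF assms that])
  moreover have "bij t" using b unfolding t_def by (rule bij_imp_bij_inv)
  ultimately show ?thesis unfolding Gal_iff is_aut_def t_def by blast
qed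

lemma mat_ring_simps [simp]:
  "carrier (mat_ring m) = mats m" "A \<otimes>\<^bsub>mat_ring m\<^esub> B = mmul m A B" "\<one>\<^bsub>mat_ring m\<^esub> = mone m"
  "\<zero>\<^bsub>mat_ring m\<^esub> = (\<lambda>ij\<in>idx m. 0)" "A \<oplus>\<^bsub>mat_ring m\<^esub> B = (\<lambda>ij\<in>idx m. A ij + B ij)"
  by (simp_all add: mat_ring_def mmul_def mone_def mats_def) (auto simp: restrict_def)

lemma ring_mat_ring: "ring (mat_ring m)"
proof (rule ringI)
  show "abelian_group (mat_ring m)"
  proof (rule abelian_groupI)
    fix x assume x: "x \<in> carrier (mat_ring m)"
    have "(\<lambda>ij\<in>idx m. - x ij) \<oplus>\<^bsub>mat_ring m\<^esub> x = \<zero>\<^bsub>mat_ring m\<^esub>"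
      by (rule mats_eqI[of _ m]) simp_all
    then show "\<exists>y\<in>carrier (mat_ring m). y \<oplus>\<^bsub>mat_ring m\<^esub> x = \<zero>\<^bsub>mat_ring m\<^esub>"
      by (intro bexI[of _ "\<lambda>ij\<in>idx m. - x ij"]) simp_all
  qed (simp, simp, (rule mats_eqI[of _ m]; simp add: add_ac)+)
  show "monoid (mat_ring m)"
    by (rule monoidI) (simp_all add: mmul_assoc mmul_one)
qed (rule mats_eqI[of _ m]; simp add: mmul_entry sum.distrib algebra_simps)+

lemma mat_ring_minus:
  assumes "A \<in> mats m" "B \<in> mats m"
  shows "A \<ominus>\<^bsub>mat_ring m\<^esub> B = (\<lambda>ij\<in>idx m. A ij - B ij)"
proof -
  have ab: "abelian_group (mat_ring m)" by (rule ring.is_abelian_group[OF ring_mat_ring])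
  have "\<ominus>\<^bsub>mat_ring m\<^esub> B = (\<lambda>ij\<in>idx m. - B ij)"
  proof (rule abelian_group.minus_equality[OF ab])
    show "(\<lambda>ij\<in>idx m. - B ij) \<oplus>\<^bsub>mat_ring m\<^esub> B = \<zero>\<^bsub>mat_ring m\<^esub>"
    by (rule mats_eqI[of _ m]) simp_all
  qed (use assms in simp_all)
  then show ?thesis unfolding a_minus_def by (intro mats_eqI[of _ m]) simp_all
qed

subsection \<open>Invertible matrices\<close>

lemma GL_group: "group (GL m)"
  unfolding GL_def by (rule monoid.units_group[OF ring.axioms(2)[OF ring_mat_ring]])

lemma GL_simps [simp]: "A \<otimes>\<^bsub>GL m\<^esub> B = mmul m A B" "\<one>\<^bsub>GL m\<^esub> = mone m"
  by (simp_all add: GL_def units_of_def)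

abbreviation GLc :: "nat \<Rightarrow> complex sqmat set" where "GLc m \<equiv> carrier (GL m)"

lemma GL_carrier: "g \<in> GLc m \<longleftrightarrow> g \<in> mats m \<and> (\<exists>h\<in>mats m. mmul m h g = mone m \<and> mmul m g h = mone m)"
  by (simp add: GL_def units_of_def Units_def)

lemma GL_mats: "g \<in> GLc m \<Longrightarrow> g \<in> mats m"
  by (simp add: GL_carrier)

abbreviation minv :: "nat \<Rightarrow> complex sqmat \<Rightarrow> complex sqmat" where "minv m g \<equiv> inv\<^bsub>GL m\<^esub> g"

lemma GL_closed:
  shows "g \<in> GLc m \<Longrightarrow> h \<in> GLc m \<Longrightarrow> mmul m g h \<in> GLc m" "mone m \<in> GLc m" "g \<in> GLc m \<Longrightarrow> minv m g \<in> GLc m"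
    "g \<in> GLc m \<Longrightarrow> mmul m g (minv m g) = mone m" "g \<in> GLc m \<Longrightarrow> mmul m (minv m g) g = mone m"
    "g \<in> GLc m \<Longrightarrow> minv m (minv m g) = g"
    "g \<in> GLc m \<Longrightarrow> h \<in> GLc m \<Longrightarrow> minv m (mmul m g h) = mmul m (minv m h) (minv m g)"
proof -
  interpret G: group "GL m" by (rule GL_group)
  show "g \<in> GLc m \<Longrightarrow> h \<in> GLc m \<Longrightarrow> mmul m g h \<in> GLc m" using G.m_closed[of g h] by simp
  show "mone m \<in> GLc m" using G.one_closed by simp
  show "g \<in> GLc m \<Longrightarrow> minv m g \<in> GLc m" by (rule G.inv_closed)
  show "g \<in> GLc m \<Longrightarrow> mmul m g (minv m g) = mone m" using G.r_inv[of g] by simp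
  show "g \<in> GLc m \<Longrightarrow> mmul m (minv m g) g = mone m" using G.l_inv[of g] by simp
  show "g \<in> GLc m \<Longrightarrow> minv m (minv m g) = g" by simp
  show "g \<in> GLc m \<Longrightarrow> h \<in> GLc m \<Longrightarrow> minv m (mmul m g h) = mmul m (minv m h) (minv m g)"
    using G.inv_mult_group[of g h] by simp
qed

lemma GL_inv_unique:
  assumes "g \<in> mats m" "h \<in> mats m" "mmul m g h = mone m" "mmul m h g = mone m"
  shows "g \<in> GLc m" "minv m g = h"
proof -
  interpret G: group "GL m" by (rule GL_group)
  show g: "g \<in> GLc m" using assms by (auto simp: GL_carrier)
  have h: "h \<in> GLc m" using assms by (auto simp: GL_carrier)
  show "minv m g = h" using G.inv_equality[OF _ g h] assms(4) by simp
qed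

lemma mmul_cancel:
  assumes "g \<in> GLc m" "x \<in> mats m"
  shows "mmul m (minv m g) (mmul m g x) = x" "mmul m g (mmul m (minv m g) x) = x"
    "mmul m (mmul m x g) (minv m g) = x" "mmul m (mmul m x (minv m g)) g = x"
  by (simp_all add: GL_closed assms mmul_one flip: mmul_assoc) (simp_all add: GL_closed assms mmul_one mmul_assoc)

subsection \<open>Regular functions and closed sets\<close>

text \<open>
  Elements of \<open>reg_fun\<close> are extensional; this form ignores values outside the general linear group
  and so allows plain pointwise expressions.
\<close>
definition regular :: "complex set \<Rightarrow> nat \<Rightarrow> (complex sqmat \<Rightarrow> complex) \<Rightarrow> bool"
  where "regular F m f \<longleftrightarrow> restrict f (GLc m) \<in> reg_fun F m"

lemma reg_fun_regular: "f \<in> reg_fun F m \<Longrightarrow> regular F m f"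
  and reg_fun_extensional: "f \<in> reg_fun F m \<Longrightarrow> restrict f (GLc m) = f"
proof -
  show *: "f \<in> reg_fun F m \<Longrightarrow> restrict f (GLc m) = f" by (induction rule: reg_fun.induct) auto
  show "f \<in> reg_fun F m \<Longrightarrow> regular F m f" unfolding regular_def using * by simp
qed

lemma regular_cong: "(\<And>g. g \<in> GLc m \<Longrightarrow> f g = h g) \<Longrightarrow> regular F m f \<longleftrightarrow> regular F m h"
  unfolding regular_def by (metis restrict_ext)

lemma regular_const: "a \<in> F \<Longrightarrow> regular F m (\<lambda>g. a)"
  unfolding regular_def by (rule reg_fun.const)

lemma regular_entry: "i < m \<Longrightarrow> j < m \<Longrightarrow> regular F m (\<lambda>g. g (i, j))"
  unfolding regular_def by (rule reg_fun.entry) auto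

lemma regular_inv_entry: "i < m \<Longrightarrow> j < m \<Longrightarrow> regular F m (\<lambda>g. minv m g (i, j))"
  unfolding regular_def by (rule reg_fun.inv_entry) auto

lemma regular_add: "regular F m f \<Longrightarrow> regular F m h \<Longrightarrow> regular F m (\<lambda>g. f g + h g)"
  unfolding regular_def using reg_fun.add[of "restrict f (GLc m)" F m "restrict h (GLc m)"]
  by (simp cong: restrict_cong)

lemma regular_mult: "regular F m f \<Longrightarrow> regular F m h \<Longrightarrow> regular F m (\<lambda>g. f g * h g)"
  unfolding regular_def using reg_fun.mult[of "restrict f (GLc m)" F m "restrict h (GLc m)"]
  by (simp cong: restrict_cong)

lemma regular_diff:
  assumes "is_subfield F" "regular F m f" "regular F m h" shows "regular F m (\<lambda>g. f g - h g)"
proof -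
  have "regular F m (\<lambda>g. f g + (- 1) * h g)"
    using assms(2,3) is_subfieldD(2,4)[OF assms(1)] by (intro regular_add regular_mult regular_const) auto
  then show ?thesis by simp
qed

lemma regular_sum:
  assumes "is_subfield F" "\<And>i. i \<in> I \<Longrightarrow> regular F m (f i)" shows "regular F m (\<lambda>g. \<Sum>i\<in>I. f i g)"
  using assms(2)
  by (induction I rule: infinite_finite_induct) (auto intro: regular_add regular_const is_subfieldD(1)[OF assms(1)])

lemma is_subfield_UNIV: "is_subfield UNIV" by (simp add: is_subfield_def)

text \<open>
  Pulling back regular functions along a map only requires its entries and those of its inverse to be
  regular.
\<close>
lemma regular_compose:
  assumes \<psi>: "\<And>g. g \<in> GLc n \<Longrightarrow> \<psi> g \<in> GLc m"
    and e: "\<And>i j. i < m \<Longrightarrow> j < m \<Longrightarrow> regular F n (\<lambda>g. \<psi> g (i, j))"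
    and ie: "\<And>i j. i < m \<Longrightarrow> j < m \<Longrightarrow> regular F n (\<lambda>g. minv m (\<psi> g) (i, j))"
    and f: "regular F m f"
  shows "regular F n (\<lambda>g. f (\<psi> g))"
proof -
  have "f \<in> reg_fun F m \<Longrightarrow> regular F n (\<lambda>g. f (\<psi> g))" for f
  proof (induction rule: reg_fun.induct)
    case (const a)
    then show ?case using regular_const[of a F n] \<psi> by (simp cong: regular_cong)
  next
    case (entry ij)
    then show ?case using e[of "fst ij" "snd ij"] \<psi> by (auto cong: regular_cong)
  next
    case (inv_entry ij)
    then show ?case using ie[of "fst ij" "snd ij"] \<psi> by (auto cong: regular_cong)
  next
    case (add f h)
    then show ?case using regular_add[of F n "\<lambda>g. f (\<psi> g)" "\<lambda>g. h (\<psi> g)"] \<psi> by (simp cong: regular_cong)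
  next
    case (mult f h)
    then show ?case using regular_mult[of F n "\<lambda>g. f (\<psi> g)" "\<lambda>g. h (\<psi> g)"] \<psi> by (simp cong: regular_cong)
  qed
  from this[of "restrict f (GLc m)"] f show ?thesis
    unfolding regular_def using \<psi> by (simp cong: restrict_cong)
qed

lemma zariski_closedI:
  assumes "\<And>f. f \<in> S \<Longrightarrow> regular UNIV m f"
  shows "zariski_closed m {g \<in> GLc m. \<forall>f\<in>S. f g = 0}"
  unfolding zariski_closed_def
  by (rule exI[of _ "(\<lambda>f. restrict f (GLc m)) ` S"]) (use assms in \<open>auto simp: regular_def\<close>)

lemma zariski_closedE:
  assumes "zariski_closed m Z"
  obtains S where "\<And>f. f \<in> S \<Longrightarrow> regular UNIV m f" "Z = {g \<in> GLc m. \<forall>f\<in>S. f g = 0}"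
proof -
  from assms obtain S where S: "S \<subseteq> reg_fun UNIV m" "Z = {g \<in> GLc m. \<forall>f\<in>S. f g = 0}"
    unfolding zariski_closed_def by auto
  show thesis by (rule that[OF _ S(2)]) (use S(1) reg_fun_regular in blast)
qed

subsection \<open>Conjugation\<close>

definition conj :: "nat \<Rightarrow> complex sqmat \<Rightarrow> complex sqmat \<Rightarrow> complex sqmat"
  where "conj m P g = mmul m (mmul m P g) (minv m P)"

lemma conj_mats [simp]: "conj m P g \<in> mats m" by (simp add: conj_def)

context
  fixes m P assumes P: "P \<in> GLc m"
begin

lemma conj_GL: "g \<in> GLc m \<Longrightarrow> conj m P g \<in> GLc m"
  unfolding conj_def by (intro GL_closed P)

lemma conj_mult: "mmul m (conj m P g) (conj m P h) = conj m P (mmul m g h)" if "h \<in> mats m"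
  unfolding conj_def mmul_assoc mmul_cancel(1)[OF P mmul_mats] ..

lemma conj_one: "conj m P (mone m) = mone m"
  unfolding conj_def by (simp add: mmul_one GL_mats[OF P] GL_closed P)

lemma conj_inverse: "g \<in> mats m \<Longrightarrow> conj m (minv m P) (conj m P g) = g"
  unfolding conj_def by (simp add: GL_closed(6)[OF P] mmul_assoc GL_closed(5)[OF P] mmul_one mmul_cancel(1)[OF P])

lemma conj_inverse': "g \<in> mats m \<Longrightarrow> conj m P (conj m (minv m P) g) = g"
  unfolding conj_def by (simp add: GL_closed(6)[OF P] mmul_assoc GL_closed(4)[OF P] mmul_one mmul_cancel(2)[OF P])

lemma minv_conj: "g \<in> GLc m \<Longrightarrow> minv m (conj m P g) = conj m P (minv m g)"
  by (rule GL_inv_unique(2)) (simp_all add: conj_mult GL_mats GL_closed conj_one)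

lemma conj_entry:
  assumes "i < m" "j < m"
  shows "conj m P g (i, j) = (\<Sum>k<m. \<Sum>l<m. P (i, l) * g (l, k) * minv m P (k, j))"
  using assms by (simp add: conj_def mmul_entry sum_distrib_right)

lemma regular_conj_entry: "i < m \<Longrightarrow> j < m \<Longrightarrow> regular UNIV m (\<lambda>g. conj m P g (i, j))"
  unfolding conj_entry by (intro regular_sum is_subfield_UNIV regular_mult regular_const regular_entry) auto

lemma regular_conj_inv_entry: 
  assumes "i < m" "j < m" shows "regular UNIV m (\<lambda>g. minv m (conj m P g) (i, j))"
proof -
  have "regular UNIV m (\<lambda>g. conj m P (minv m g) (i, j))"
    unfolding conj_entry[OF assms] by (intro regular_sum is_subfield_UNIV regular_mult regular_const regular_inv_entry) auto
  then show ?thesis by (simp add: minv_conj cong: regular_cong)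
qed

lemma regular_conj: "regular UNIV m f \<Longrightarrow> regular UNIV m (\<lambda>g. f (conj m P g))"
  by (rule regular_compose[OF conj_GL regular_conj_entry regular_conj_inv_entry])

end

lemma zariski_closed_conj:
  assumes P: "P \<in> GLc m" and Z: "zariski_closed m Z"
  shows "zariski_closed m (conj m P ` Z)"
proof -
  have Q: "minv m P \<in> GLc m" by (rule GL_closed(3)[OF P])
  obtain S where S: "\<And>f. f \<in> S \<Longrightarrow> regular UNIV m f" "Z = {g \<in> GLc m. \<forall>f\<in>S. f g = 0}"
    using zariski_closedE[OF Z] by blast
  have "conj m P ` Z = {g \<in> GLc m. \<forall>f\<in>(\<lambda>f g. f (conj m (minv m P) g)) ` S. f g = 0}"
  proof (intro equalityI subsetI)
    fix g assume "g \<in> conj m P ` Z"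
    then show "g \<in> {g \<in> GLc m. \<forall>f\<in>(\<lambda>f g. f (conj m (minv m P) g)) ` S. f g = 0}"
      unfolding S(2) by (auto simp: conj_GL[OF P] conj_inverse[OF P] GL_mats)
  next
    fix g assume g: "g \<in> {g \<in> GLc m. \<forall>f\<in>(\<lambda>f g. f (conj m (minv m P) g)) ` S. f g = 0}"
    then have "conj m (minv m P) g \<in> Z" unfolding S(2) by (auto simp: conj_GL[OF Q])
    moreover have "g = conj m P (conj m (minv m P) g)" using g by (simp add: conj_inverse'[OF P] GL_mats)
    ultimately show "g \<in> conj m P ` Z" by blast
  qed
  then show ?thesis using zariski_closedI[of "(\<lambda>f g. f (conj m (minv m P) g)) ` S" m] S(1) regular_conj[OF Q] by auto
qed

lemma conj_image_inverse:
  assumes "P \<in> GLc m" "Z \<subseteq> mats m" shows "conj m (minv m P) ` conj m P ` Z = Z" "conj m P ` conj m (minv m P) ` Z = Z"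
proof -
  have "conj m (minv m P) ` conj m P ` Z = id ` Z" "conj m P ` conj m (minv m P) ` Z = id ` Z"
    unfolding image_image by (rule image_cong; use assms conj_inverse conj_inverse' in auto)+
  then show "conj m (minv m P) ` conj m P ` Z = Z" "conj m P ` conj m (minv m P) ` Z = Z" by simp_all
qed

lemma zariski_connected_conj:
  assumes P: "P \<in> GLc m" and Z: "Z \<subseteq> GLc m" "zariski_connected m Z"
  shows "zariski_connected m (conj m P ` Z)"
  unfolding zariski_connected_def
proof
  let ?c = "conj m (minv m P)"
  have Q: "minv m P \<in> GLc m" by (rule GL_closed(3)[OF P])
  have ZM: "Z \<subseteq> mats m" using Z(1) GL_mats by blast
  assume "\<exists>A B. zariski_closed m A \<and> zariski_closed m B \<and> A \<noteq> {} \<and> B \<noteq> {} \<and> A \<inter> B = {} \<and> A \<union> B = conj m P ` Z"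
  then obtain A B where AB: "zariski_closed m A" "zariski_closed m B" "A \<noteq> {}" "B \<noteq> {}" "A \<inter> B = {}" "A \<union> B = conj m P ` Z"
    by blast
  have inj: "x = y" if "?c x = ?c y" "x \<in> conj m P ` Z" "y \<in> conj m P ` Z" for x y
    using that ZM by (auto simp: conj_inverse[OF P] subset_iff)
  have "?c ` A \<inter> ?c ` B = {}"
  proof (rule equals0I)
    fix z assume "z \<in> ?c ` A \<inter> ?c ` B"
    then obtain x y where x: "x \<in> A" "z = ?c x" and y: "y \<in> B" "z = ?c y" by blast
    have "x \<in> conj m P ` Z" "y \<in> conj m P ` Z" using x(1) y(1) unfolding AB(6)[symmetric] by blast+
    then have "x = y" using x(2) y(2) by (metis inj)
    then show False using x(1) y(1) AB(5) by blast
  qed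
  moreover have "?c ` A \<union> ?c ` B = Z"
    unfolding image_Un[symmetric] AB(6) by (rule conj_image_inverse(1)[OF P ZM])
  moreover have "zariski_closed m (?c ` A)" "zariski_closed m (?c ` B)"
    using AB(1,2) by (auto intro: zariski_closed_conj[OF Q])
  moreover have "?c ` A \<noteq> {}" "?c ` B \<noteq> {}" using AB(3,4) by simp_all
  ultimately show False using Z(2) unfolding zariski_connected_def by blast
qed

lemma unipotent_conj:
  assumes P: "P \<in> GLc m" and g: "g \<in> mats m" "unipotent m (conj m P g)"
  shows "unipotent m g"
proof -
  interpret R: ring "mat_ring m" by (rule ring_mat_ring)
  have Q: "minv m P \<in> GLc m" by (rule GL_closed(3)[OF P])
  let ?c = "conj m (minv m P)"
  have pow: "?c (A [^]\<^bsub>mat_ring m\<^esub> (k::nat)) = (?c A) [^]\<^bsub>mat_ring m\<^esub> k" if "A \<in> mats m" for A k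
  proof (induction k)
    case (Suc k)
    have "?c (mmul m (A [^]\<^bsub>mat_ring m\<^esub> k) A) = mmul m (?c (A [^]\<^bsub>mat_ring m\<^esub> k)) (?c A)"
      using conj_mult[OF Q that] by simp
    then show ?case using Suc by simp
  qed (simp add: conj_one[OF Q])
  have sub: "?c (\<lambda>ij\<in>idx m. A ij - mone m ij) = (\<lambda>ij\<in>idx m. ?c A ij - mone m ij)" for A
  proof (rule mats_eqI)
    fix i j assume ij: "i < m" "j < m"
    have "?c (\<lambda>ij\<in>idx m. A ij - mone m ij) (i, j) = ?c A (i, j) - ?c (mone m) (i, j)"
      using ij by (simp add: conj_entry[OF Q] sum_subtractf algebra_simps)
    then show "?c (\<lambda>ij\<in>idx m. A ij - mone m ij) (i, j) = (\<lambda>ij\<in>idx m. ?c A ij - mone m ij) (i, j)"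
      using ij by (simp add: conj_one[OF Q])
  qed auto
  from g(2) obtain k :: nat where k: "(\<lambda>ij\<in>idx m. conj m P g ij - mone m ij) [^]\<^bsub>mat_ring m\<^esub> k = (\<lambda>ij\<in>idx m. 0)"
    unfolding unipotent_def mat_ring_simps mat_ring_minus[OF conj_mats mone_mats] by blast
  have e: "(\<lambda>ij\<in>idx m. g ij - mone m ij) = ?c (\<lambda>ij\<in>idx m. conj m P g ij - mone m ij)"
    unfolding sub conj_inverse[OF P g(1)] ..
  have "(\<lambda>ij\<in>idx m. g ij - mone m ij) [^]\<^bsub>mat_ring m\<^esub> k = ?c (\<lambda>ij\<in>idx m. 0)"
    by (subst e, subst pow[symmetric], simp, subst k, rule refl)
  also have "?c (\<lambda>ij\<in>idx m. 0) = (\<lambda>ij\<in>idx m. 0)"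
    by (rule mats_eqI[of _ m]) (simp_all add: conj_entry[OF Q])
  finally have "(\<lambda>ij\<in>idx m. g ij - mone m ij) [^]\<^bsub>mat_ring m\<^esub> k = (\<lambda>ij\<in>idx m. 0)" .
  then show ?thesis
    unfolding unipotent_def by (intro exI[of _ k]) (simp add: mat_ring_minus[OF g(1) mone_mats])
qed

end

section \<open>Connectedness by rational curves\<close>

text \<open>
  On the complement of the zeros of \<open>q\<close>, the function is a polynomial divided by a power of \<open>q\<close>.
\<close>
definition ratfun :: "'a::field poly \<Rightarrow> ('a \<Rightarrow> 'a) \<Rightarrow> bool"
  where "ratfun q f \<longleftrightarrow> (\<exists>p k. \<forall>x. poly q x \<noteq> 0 \<longrightarrow> f x * poly q x ^ k = poly p x)"

lemma ratfun_poly: "ratfun q (poly p)"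
  unfolding ratfun_def by (intro exI[of _ p] exI[of _ 0]) simp

lemma ratfun_const: "ratfun q (\<lambda>x. c)"
  unfolding ratfun_def by (intro exI[of _ "[:c:]"] exI[of _ 0]) simp

lemma ratfun_cong: "(\<And>x. poly q x \<noteq> 0 \<Longrightarrow> f x = g x) \<Longrightarrow> ratfun q f \<longleftrightarrow> ratfun q g"
  unfolding ratfun_def by (metis (no_types, lifting))

lemma ratfun_inverse: "ratfun q (\<lambda>x. inverse (poly q x))"
  unfolding ratfun_def by (intro exI[of _ 1] exI[of _ 1]) simp

lemma ratfun_add:
  assumes "ratfun q f" "ratfun q g" shows "ratfun q (\<lambda>x. f x + g x)"
proof -
  obtain p k p' k' where *: "\<forall>x. poly q x \<noteq> 0 \<longrightarrow> f x * poly q x ^ k = poly p x"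
    "\<forall>x. poly q x \<noteq> 0 \<longrightarrow> g x * poly q x ^ k' = poly p' x"
    using assms unfolding ratfun_def by blast
  have "(f x + g x) * poly q x ^ (k + k') = poly (p * q ^ k' + p' * q ^ k) x" if "poly q x \<noteq> 0" for x
  proof -
    have "(f x + g x) * poly q x ^ (k + k') = f x * poly q x ^ k * poly q x ^ k' + g x * poly q x ^ k' * poly q x ^ k"
      by (simp add: power_add algebra_simps)
    then show ?thesis using * that by simp
  qed
  then show ?thesis unfolding ratfun_def by blast
qed

lemma ratfun_mult:
  assumes "ratfun q f" "ratfun q g" shows "ratfun q (\<lambda>x. f x * g x)"
proof -
  obtain p k p' k' where *: "\<forall>x. poly q x \<noteq> 0 \<longrightarrow> f x * poly q x ^ k = poly p x"
    "\<forall>x. poly q x \<noteq> 0 \<longrightarrow> g x * poly q x ^ k' = poly p' x"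
    using assms unfolding ratfun_def by blast
  have "(f x * g x) * poly q x ^ (k + k') = poly (p * p') x" if "poly q x \<noteq> 0" for x
  proof -
    have "(f x * g x) * poly q x ^ (k + k') = (f x * poly q x ^ k) * (g x * poly q x ^ k')"
      by (simp add: power_add algebra_simps)
    then show ?thesis using * that by simp
  qed
  then show ?thesis unfolding ratfun_def by blast
qed

lemma ratfun_zero:
  assumes "ratfun q f" "infinite {x. poly q x \<noteq> 0 \<and> f x = 0}" "poly q x \<noteq> 0"
  shows "f x = 0"
proof -
  obtain p k where *: "\<forall>x. poly q x \<noteq> 0 \<longrightarrow> f x * poly q x ^ k = poly p x"
    using assms(1) unfolding ratfun_def by blast
  have "{x. poly q x \<noteq> 0 \<and> f x = 0} \<subseteq> {x. poly p x = 0}" using * by auto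
  then have "infinite {x. poly p x = 0}" using assms(2) finite_subset by blast
  then have "p = 0" using poly_roots_finite by blast
  then have "f x * poly q x ^ k = 0" using * assms(3) by simp
  then show ?thesis using assms(3) by simp
qed

context base_field
begin

lemma ratfun_regular:
  assumes \<phi>: "\<And>x. poly q x \<noteq> 0 \<Longrightarrow> \<phi> x \<in> GLc m"
    and e: "\<And>i j. i < m \<Longrightarrow> j < m \<Longrightarrow> ratfun q (\<lambda>x. \<phi> x (i, j))"
    and ie: "\<And>i j. i < m \<Longrightarrow> j < m \<Longrightarrow> ratfun q (\<lambda>x. minv m (\<phi> x) (i, j))"
    and f: "regular UNIV m f"
  shows "ratfun q (\<lambda>x. f (\<phi> x))"
proof -
  have "f \<in> reg_fun UNIV m \<Longrightarrow> ratfun q (\<lambda>x. f (\<phi> x))" for f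
  proof (induction rule: reg_fun.induct)
    case (const a)
    then show ?case using ratfun_const[of q a] \<phi> by (simp cong: ratfun_cong)
  next
    case (entry ij)
    then show ?case using e[of "fst ij" "snd ij"] \<phi> by (auto cong: ratfun_cong)
  next
    case (inv_entry ij)
    then show ?case using ie[of "fst ij" "snd ij"] \<phi> by (auto cong: ratfun_cong)
  next
    case (add f h)
    then show ?case using ratfun_add[of q "\<lambda>g. f (\<phi> g)" "\<lambda>g. h (\<phi> g)"] \<phi> by (simp cong: ratfun_cong)
  next
    case (mult f h)
    then show ?case using ratfun_mult[of q "\<lambda>g. f (\<phi> g)" "\<lambda>g. h (\<phi> g)"] \<phi> by (simp cong: ratfun_cong)
  qed
  from this[of "restrict f (GLc m)"] f show ?thesis
    unfolding regular_def using \<phi> by (simp cong: ratfun_cong)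
qed

text \<open>
  The parameter curve is the affine line without the zeros of a polynomial \<open>q\<close>. The entries of the
  inverse matrix have to be controlled as well because they enter the regular functions.
\<close>
definition joined_by_curve :: "nat \<Rightarrow> complex sqmat set \<Rightarrow> complex sqmat \<Rightarrow> complex sqmat \<Rightarrow> bool"
  where "joined_by_curve m Z g h \<longleftrightarrow> (\<exists>q \<phi>. poly q 0 \<noteq> 0 \<and> poly q 1 \<noteq> 0 \<and> \<phi> 0 = g \<and> \<phi> 1 = h \<and>
    (\<forall>x. poly q x \<noteq> 0 \<longrightarrow> \<phi> x \<in> Z) \<and>
    (\<forall>i<m. \<forall>j<m. ratfun q (\<lambda>x. \<phi> x (i, j)) \<and> ratfun q (\<lambda>x. minv m (\<phi> x) (i, j))))"

text \<open>
  Of two closed sets that cover a curve one contains infinitely many of its points. The equations of that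
  closed set then vanish identically along the curve, so it contains both end points.
\<close>
lemma zariski_connected_if_joined:
  assumes Z: "Z \<subseteq> GLc m" and joined: "\<And>g h. g \<in> Z \<Longrightarrow> h \<in> Z \<Longrightarrow> joined_by_curve m Z g h"
  shows "zariski_connected m Z"
  unfolding zariski_connected_def
proof
  assume "\<exists>A B. zariski_closed m A \<and> zariski_closed m B \<and> A \<noteq> {} \<and> B \<noteq> {} \<and> A \<inter> B = {} \<and> A \<union> B = Z"
  then obtain A B where AB: "zariski_closed m A" "zariski_closed m B" "A \<noteq> {}" "B \<noteq> {}" "A \<inter> B = {}" "A \<union> B = Z"
    by blast
  obtain g h where gh: "g \<in> A" "h \<in> B" using AB(3,4) by blast
  then have "g \<in> Z" "h \<in> Z" using AB(6) by blast+
  from joined[OF this] obtain q \<phi> where q: "poly q 0 \<noteq> 0" "poly q 1 \<noteq> 0" "\<phi> 0 = g" "\<phi> 1 = h"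
    and \<phi>: "\<And>x. poly q x \<noteq> 0 \<Longrightarrow> \<phi> x \<in> Z"
    and e: "\<And>i j. i < m \<Longrightarrow> j < m \<Longrightarrow> ratfun q (\<lambda>x. \<phi> x (i, j))"
    and ie: "\<And>i j. i < m \<Longrightarrow> j < m \<Longrightarrow> ratfun q (\<lambda>x. minv m (\<phi> x) (i, j))"
    unfolding joined_by_curve_def by blast
  have \<phi>GL: "\<phi> x \<in> GLc m" if "poly q x \<noteq> 0" for x using \<phi>[OF that] Z by blast
  have key: "\<phi> y \<in> C" if C: "zariski_closed m C" and inf: "infinite {x. poly q x \<noteq> 0 \<and> \<phi> x \<in> C}" and y: "poly q y \<noteq> 0" for C y
  proof -
    obtain S where S: "\<And>f. f \<in> S \<Longrightarrow> regular UNIV m f" "C = {g \<in> GLc m. \<forall>f\<in>S. f g = 0}"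
      using zariski_closedE[OF C] by blast
    have "f (\<phi> y) = 0" if f: "f \<in> S" for f
    proof (rule ratfun_zero[OF ratfun_regular[OF \<phi>GL e ie S(1)[OF f]] _ y])
      have "{x. poly q x \<noteq> 0 \<and> \<phi> x \<in> C} \<subseteq> {x. poly q x \<noteq> 0 \<and> f (\<phi> x) = 0}" using f unfolding S(2) by blast
      then show "infinite {x. poly q x \<noteq> 0 \<and> f (\<phi> x) = 0}" using inf finite_subset by blast
    qed
    then show ?thesis unfolding S(2) using \<phi>GL[OF y] by blast
  qed
  have "q \<noteq> 0" using q(1) by auto
  then have "finite {x. poly q x = 0}" by (rule poly_roots_finite)
  then have "infinite (UNIV - {x. poly q x = 0})" using infinite_UNIV_char_0 by (rule Diff_infinite_finite)
  moreover have "UNIV - {x. poly q x = 0} \<subseteq> {x. poly q x \<noteq> 0 \<and> \<phi> x \<in> A} \<union> {x. poly q x \<noteq> 0 \<and> \<phi> x \<in> B}"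
    using \<phi> AB(6) by blast
  ultimately have "infinite {x. poly q x \<noteq> 0 \<and> \<phi> x \<in> A} \<or> infinite {x. poly q x \<noteq> 0 \<and> \<phi> x \<in> B}"
    by (meson finite_Un finite_subset)
  then show False
  proof
    assume "infinite {x. poly q x \<noteq> 0 \<and> \<phi> x \<in> A}"
    from key[OF AB(1) this q(2)] show False using q(4) gh(2) AB(5) by blast
  next
    assume "infinite {x. poly q x \<noteq> 0 \<and> \<phi> x \<in> B}"
    from key[OF AB(2) this q(1)] show False using q(3) gh(1) AB(5) by blast
  qed
qed

section \<open>Galois descent for closed sets\<close>

lemma gal_act_mats [simp]: "gal_act m s g \<in> mats m" by (simp add: gal_act_def)

lemma gal_act_entry: "i < m \<Longrightarrow> j < m \<Longrightarrow> gal_act m s g (i, j) = s (g (i, j))" by (simp add: gal_act_def)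

lemma gal_act_mmul: "s \<in> Gal \<Longrightarrow> gal_act m s (mmul m A B) = mmul m (gal_act m s A) (gal_act m s B)"
  by (rule mats_eqI[of _ m]) (simp_all add: gal_act_entry mmul_entry Gal_sum GalD(2))

lemma gal_act_mone: "s \<in> Gal \<Longrightarrow> gal_act m s (mone m) = mone m"
  by (rule mats_eqI[of _ m]) (simp_all add: gal_act_entry mone_entry GalD(3,4))

lemma gal_act_GL:
  assumes "s \<in> Gal" "g \<in> GLc m"
  shows "gal_act m s g \<in> GLc m" "minv m (gal_act m s g) = gal_act m s (minv m g)"
proof -
  have "mmul m (gal_act m s g) (gal_act m s (minv m g)) = mone m" "mmul m (gal_act m s (minv m g)) (gal_act m s g) = mone m"
    using assms by (simp_all add: gal_act_mone GL_closed flip: gal_act_mmul)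
  then show "gal_act m s g \<in> GLc m" "minv m (gal_act m s g) = gal_act m s (minv m g)"
    using GL_inv_unique[OF gal_act_mats gal_act_mats] by blast+
qed

lemma reg_fun_gal_act:
  assumes "h \<in> reg_fun K m" "s \<in> Gal" "g \<in> GLc m"
  shows "h (gal_act m s g) = s (h g)"
  using assms(1)
proof (induction rule: reg_fun.induct)
  case (inv_entry ij)
  then show ?case using assms(2,3) by (auto simp: gal_act_GL gal_act_entry)
qed (use assms(2,3) in \<open>auto simp: gal_act_GL gal_act_entry GalD\<close>)

text \<open>
  In a nonzero solution with the fewest nonzero entries, one entry can be scaled to 1. Applying an
  automorphism and subtracting gives a shorter solution, so all entries are fixed by the Galois group and
  lie in $K$; the equation for the identity then contradicts independence over $K$.
\<close>
lemma artin_independence: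
  assumes fin: "finite I"
    and indep: "\<And>k. (\<And>i. i \<in> I \<Longrightarrow> k i \<in> K) \<Longrightarrow> (\<Sum>i\<in>I. k i * a i) = 0 \<Longrightarrow> (\<forall>i\<in>I. k i = 0)"
    and eqs: "\<And>s. s \<in> Gal \<Longrightarrow> (\<Sum>i\<in>I. s (a i) * x i) = 0"
  shows "\<forall>i\<in>I. x i = 0"
  using eqs
proof (induction "card {i\<in>I. x i \<noteq> 0}" arbitrary: x rule: less_induct)
  case less
  show ?case
  proof (rule ccontr)
    assume "\<not> ?thesis"
    then obtain j where j: "j \<in> I" "x j \<noteq> 0" by blast
    define y where "y = (\<lambda>i. x i / x j)"
    have y: "(\<Sum>i\<in>I. s (a i) * y i) = 0" if "s \<in> Gal" for s
    proof -
      have "(\<Sum>i\<in>I. s (a i) * y i) = (\<Sum>i\<in>I. s (a i) * x i) / x j"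
        by (simp add: y_def sum_divide_distrib)
      then show ?thesis using less.prems[OF that] by simp
    qed
    have "t (y i) = y i" if t: "t \<in> Gal" and i: "i \<in> I" for t i
    proof -
      let ?z = "\<lambda>i. t (y i) - y i"
      have "\<forall>i\<in>I. ?z i = 0"
      proof (rule less.hyps)
        have yj: "y j = 1" using j by (simp add: y_def)
        have "{i \<in> I. ?z i \<noteq> 0} \<subset> {i \<in> I. x i \<noteq> 0}"
        proof
          show "{i \<in> I. ?z i \<noteq> 0} \<subseteq> {i \<in> I. x i \<noteq> 0}" by (auto simp: y_def GalD[OF t])
          have "j \<notin> {i \<in> I. ?z i \<noteq> 0}" by (simp add: yj GalD(4)[OF t])
          moreover have "j \<in> {i \<in> I. x i \<noteq> 0}" using j by simp
          ultimately show "{i \<in> I. ?z i \<noteq> 0} \<noteq> {i \<in> I. x i \<noteq> 0}" by blast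
        qed
        then show "card {i \<in> I. ?z i \<noteq> 0} < card {i \<in> I. x i \<noteq> 0}"
          using fin by (intro psubset_card_mono) auto
        fix s assume s: "s \<in> Gal"
        have "bij t" using t unfolding Gal_iff is_aut_def by blast
        then have tt: "t (inv_into UNIV t w) = w" for w by (simp add: bij_is_surj surj_f_inv_f)
        have "(\<Sum>i\<in>I. (inv_into UNIV t \<circ> s) (a i) * y i) = 0"
          by (intro y Gal_comp Gal_inv t s)
        then have "t (\<Sum>i\<in>I. (inv_into UNIV t \<circ> s) (a i) * y i) = 0" by (simp add: GalD(3)[OF t])
        then have "(\<Sum>i\<in>I. s (a i) * t (y i)) = 0" by (simp add: Gal_sum[OF t] GalD(2)[OF t] tt)
        then show "(\<Sum>i\<in>I. s (a i) * ?z i) = 0" using y[OF s] by (simp add: right_diff_distrib sum_subtractf)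
      qed
      then show ?thesis using i by simp
    qed
    then have "y i \<in> K" if "i \<in> I" for i using Gal_fixed that by blast
    moreover have "(\<Sum>i\<in>I. y i * a i) = 0" using y[OF Gal_id] by (simp add: mult.commute)
    ultimately have "\<forall>i\<in>I. y i = 0" by (rule indep)
    then show False using j by (auto simp: y_def)
  qed
qed

lemma sum_list_product:
  fixes f :: "'b \<Rightarrow> 'a::comm_ring_1"
  shows "sum_list (map (\<lambda>(x, y). f x * g y) (List.product xs ys)) = sum_list (map f xs) * sum_list (map g ys)"
  by (induction xs) (simp_all add: o_def distrib_right sum_list_const_mult)

lemma reg_fun_base_change:
  assumes "f \<in> reg_fun UNIV m"
  shows "\<exists>xs. set xs \<subseteq> UNIV \<times> reg_fun K m \<and> (\<forall>g\<in>GLc m. f g = (\<Sum>(a, h)\<leftarrow>xs. a * h g))"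
  using assms
proof (induction rule: reg_fun.induct)
  case (const a)
  show ?case using reg_fun.const[of 1 K m] is_subfieldD(2)[OF subfield] by (intro exI[of _ "[(a, \<lambda>g\<in>GLc m. 1)]"]) auto
next
  case (entry ij)
  then show ?case using reg_fun.entry[of ij m K] by (intro exI[of _ "[(1, \<lambda>g\<in>GLc m. g ij)]"]) auto
next
  case (inv_entry ij)
  then show ?case using reg_fun.inv_entry[of ij m K] by (intro exI[of _ "[(1, \<lambda>g\<in>GLc m. minv m g ij)]"]) auto
next
  case (add f h)
  then obtain xs ys where "set xs \<subseteq> UNIV \<times> reg_fun K m" "\<forall>g\<in>GLc m. f g = (\<Sum>(a, h)\<leftarrow>xs. a * h g)"
    "set ys \<subseteq> UNIV \<times> reg_fun K m" "\<forall>g\<in>GLc m. h g = (\<Sum>(a, h)\<leftarrow>ys. a * h g)" by blast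
  then show ?case by (intro exI[of _ "xs @ ys"]) auto
next
  case (mult f h)
  then obtain xs ys where xs: "set xs \<subseteq> UNIV \<times> reg_fun K m" "\<forall>g\<in>GLc m. f g = (\<Sum>(a, h)\<leftarrow>xs. a * h g)"
    and ys: "set ys \<subseteq> UNIV \<times> reg_fun K m" "\<forall>g\<in>GLc m. h g = (\<Sum>(a, h)\<leftarrow>ys. a * h g)" by blast
  let ?zs = "map (\<lambda>((a, f), (b, h)). (a * b, \<lambda>g\<in>GLc m. f g * h g)) (List.product xs ys)"
  have "set ?zs \<subseteq> UNIV \<times> reg_fun K m"
    using xs(1) ys(1) reg_fun.mult[of _ K m] by fastforce
  moreover have "f g * h g = (\<Sum>(a, h)\<leftarrow>?zs. a * h g)" if g: "g \<in> GLc m" for g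
  proof -
    have "(\<Sum>(a, h)\<leftarrow>?zs. a * h g) = sum_list (map (\<lambda>(x, y). (case x of (a, f) \<Rightarrow> a * f g) * (case y of (b, h) \<Rightarrow> b * h g)) (List.product xs ys))"
      using g by (simp add: o_def case_prod_unfold mult_ac)
    also have "\<dots> = f g * h g" unfolding sum_list_product using xs(2) ys(2) g by simp
    finally show ?thesis by simp
  qed
  ultimately show ?case by (intro exI[of _ ?zs]) simp
qed

text \<open>
  A relation over $K$ between the coefficients shortens the sum. If the coefficients are independent over $K$,
  the conjugates of the equation at the points of $Z$ force each term to vanish on $Z$.
\<close>
lemma descend_vanishing:
  fixes I :: "nat set"
  assumes Z: "Z \<subseteq> GLc m" and stable: "\<And>s g. s \<in> Gal \<Longrightarrow> g \<in> Z \<Longrightarrow> gal_act m s g \<in> Z"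
    and I: "finite I" "\<And>i. i \<in> I \<Longrightarrow> h i \<in> reg_fun K m" and van: "\<And>g. g \<in> Z \<Longrightarrow> (\<Sum>i\<in>I. a i * h i g) = 0"
  shows "\<exists>(J :: nat set) b k. finite J \<and> (\<forall>i\<in>J. k i \<in> vanishing K m Z) \<and>
     (\<forall>g\<in>GLc m. (\<Sum>i\<in>I. a i * h i g) = (\<Sum>i\<in>J. b i * k i g))"
  using I van
proof (induction "card I" arbitrary: I a h rule: less_induct)
  case less
  show ?case
  proof (cases "\<exists>c. (\<forall>i\<in>I. c i \<in> K) \<and> (\<Sum>i\<in>I. c i * a i) = 0 \<and> (\<exists>i\<in>I. c i \<noteq> 0)")
    case True
    then obtain c j where c: "\<forall>i\<in>I. c i \<in> K" "(\<Sum>i\<in>I. c i * a i) = 0" and j: "j \<in> I" "c j \<noteq> 0" by blast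
    define d where "d = (\<lambda>i. - (c i / c j))"
    define h' where "h' = (\<lambda>i. \<lambda>g\<in>GLc m. h i g + d i * h j g)"
    have dK: "d i \<in> K" if "i \<in> I" for i
      unfolding d_def using c(1) j that by (intro is_subfieldD(4,8)[OF subfield]) auto
    have aj: "a j = (\<Sum>i\<in>I - {j}. d i * a i)"
    proof -
      have "c j * a j + (\<Sum>i\<in>I - {j}. c i * a i) = 0"
        using c(2) less.prems(1) j by (simp add: sum.remove)
      then have "a j = - ((\<Sum>i\<in>I - {j}. c i * a i) / c j)"
        using j by (simp add: field_simps add_eq_0_iff)
      also have "\<dots> = (\<Sum>i\<in>I - {j}. d i * a i)"
        by (simp add: d_def sum_divide_distrib sum_negf)
      finally show ?thesis .
    qed
    have eq: "(\<Sum>i\<in>I - {j}. a i * h' i g) = (\<Sum>i\<in>I. a i * h i g)" if g: "g \<in> GLc m" for g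
    proof -
      have "(\<Sum>i\<in>I - {j}. a i * h' i g) = (\<Sum>i\<in>I - {j}. a i * h i g) + (\<Sum>i\<in>I - {j}. d i * a i) * h j g"
        using g by (simp add: h'_def sum.distrib algebra_simps sum_distrib_left)
      also have "\<dots> = (\<Sum>i\<in>I. a i * h i g)"
        using less.prems(1) j by (simp add: aj[symmetric] sum.remove[of I j])
      finally show ?thesis .
    qed
    have "\<exists>(J :: nat set) b k. finite J \<and> (\<forall>i\<in>J. k i \<in> vanishing K m Z) \<and>
       (\<forall>g\<in>GLc m. (\<Sum>i\<in>I - {j}. a i * h' i g) = (\<Sum>i\<in>J. b i * k i g))"
    proof (rule less.hyps)
      show "card (I - {j}) < card I" using less.prems(1) j by (intro psubset_card_mono) auto
      show "finite (I - {j})" using less.prems(1) by simp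
      fix i assume i: "i \<in> I - {j}"
      have "regular K m (\<lambda>g. h i g + d i * h j g)"
        using i j less.prems(2) dK by (intro regular_add regular_mult regular_const reg_fun_regular) auto
      then show "h' i \<in> reg_fun K m" unfolding h'_def regular_def .
    next
      fix g assume "g \<in> Z"
      then show "(\<Sum>i\<in>I - {j}. a i * h' i g) = 0" using eq[OF subsetD[OF Z]] less.prems(3)[of g] by simp
    qed
    then show ?thesis using eq by simp
  next
    case False
    have "h i g = 0" if i: "i \<in> I" and g: "g \<in> Z" for i g
    proof -
      have "\<forall>i\<in>I. h i g = 0"
      proof (rule artin_independence[OF less.prems(1)])
        show "\<forall>i\<in>I. k i = 0" if "\<And>i. i \<in> I \<Longrightarrow> k i \<in> K" "(\<Sum>i\<in>I. k i * a i) = 0" for k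
          using False that by blast
        fix s assume s: "s \<in> Gal"
        let ?t = "inv_into UNIV s"
        have "bij s" using s unfolding Gal_iff is_aut_def by blast
        then have st: "s (?t w) = w" for w by (simp add: bij_is_surj surj_f_inv_f)
        have "(\<Sum>i\<in>I. a i * h i (gal_act m ?t g)) = 0"
          by (intro less.prems(3) stable Gal_inv s g)
        then have "(\<Sum>i\<in>I. a i * ?t (h i g)) = 0"
          using less.prems(2) g Z by (simp add: reg_fun_gal_act[OF _ Gal_inv[OF s]] subset_iff)
        then have "s (\<Sum>i\<in>I. a i * ?t (h i g)) = 0" by (simp add: GalD(3)[OF s])
        then show "(\<Sum>i\<in>I. s (a i) * h i g) = 0" by (simp add: Gal_sum[OF s] GalD(2)[OF s] st)
      qed
      then show ?thesis using i by blast
    qed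
    then have "\<forall>i\<in>I. h i \<in> vanishing K m Z" using less.prems(2) by (simp add: vanishing_def)
    then show ?thesis using less.prems(1) by blast
  qed
qed

theorem defined_over_base_if_stable:
  assumes Z: "Z \<subseteq> GLc m" and stable: "\<And>s g. s \<in> Gal \<Longrightarrow> g \<in> Z \<Longrightarrow> gal_act m s g \<in> Z"
  shows "defined_over_base m Z"
  unfolding defined_over_base_def
proof
  fix f assume "f \<in> vanishing (carrier LC) m Z"
  then have f: "f \<in> reg_fun UNIV m" "\<And>g. g \<in> Z \<Longrightarrow> f g = 0" by (simp_all add: vanishing_def)
  obtain xs where xs: "set xs \<subseteq> UNIV \<times> reg_fun K m" "\<forall>g\<in>GLc m. f g = (\<Sum>(a, h)\<leftarrow>xs. a * h g)"
    using reg_fun_base_change[OF f(1)] by blast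
  let ?I = "{..<length xs}" and ?a = "\<lambda>i. fst (xs ! i)" and ?h = "\<lambda>i. snd (xs ! i)"
  have fx: "f g = (\<Sum>i\<in>?I. ?a i * ?h i g)" if "g \<in> GLc m" for g
    using xs(2) that by (simp add: sum_list_sum_nth case_prod_unfold atLeast0LessThan)
  have "?h i \<in> reg_fun K m" if "i \<in> ?I" for i
  proof -
    have "xs ! i \<in> UNIV \<times> reg_fun K m" using xs(1) nth_mem[of i xs] that by blast
    then show ?thesis by (simp add: mem_Times_iff)
  qed
  moreover have "(\<Sum>i\<in>?I. ?a i * ?h i g) = 0" if "g \<in> Z" for g
    using fx[of g] f(2)[OF that] subsetD[OF Z that] by simp
  ultimately have "\<exists>(J :: nat set) b k. finite J \<and> (\<forall>i\<in>J. k i \<in> vanishing K m Z) \<and>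
     (\<forall>g\<in>GLc m. (\<Sum>i\<in>?I. ?a i * ?h i g) = (\<Sum>i\<in>J. b i * k i g))"
    by (intro descend_vanishing[where h = ?h and a = ?a] Z stable finite_lessThan)
  then obtain J :: "nat set" and b k where J: "finite J" "\<forall>i\<in>J. k i \<in> vanishing K m Z"
     "\<forall>g\<in>GLc m. (\<Sum>i\<in>?I. ?a i * ?h i g) = (\<Sum>i\<in>J. b i * k i g)" by blast
  obtain e where e: "bij_betw e {..<card J} J" using ex_bij_betw_nat_finite[OF J(1)] by (auto simp: atLeast0LessThan)
  have "f = (\<lambda>g\<in>GLc m. \<Oplus>\<^bsub>LC\<^esub>i\<in>{..<card J}. (b \<circ> e) i \<otimes>\<^bsub>LC\<^esub> (k \<circ> e) i g)"
  proof -
    have "f = restrict f (GLc m)" using reg_fun_extensional[OF f(1)] by simp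
    also have "\<dots> = (\<lambda>g\<in>GLc m. \<Sum>i<card J. b (e i) * k (e i) g)"
    proof (intro restrict_ext)
      fix g assume g: "g \<in> GLc m"
      have "f g = (\<Sum>i\<in>J. b i * k i g)" using fx[OF g] J(3) g by simp
      also have "\<dots> = (\<Sum>i<card J. b (e i) * k (e i) g)" by (rule sum.reindex_bij_betw[OF e, symmetric])
      finally show "f g = (\<Sum>i<card J. b (e i) * k (e i) g)" .
    qed
    finally show ?thesis by simp
  qed
  moreover have "k \<circ> e \<in> {..<card J} \<rightarrow> vanishing K m Z" using J(2) bij_betwE[OF e] by auto
  ultimately show "\<exists>(r::nat) a h. a \<in> {..<r} \<rightarrow> carrier LC \<and> h \<in> {..<r} \<rightarrow> vanishing K m Z \<and>
      f = (\<lambda>g\<in>GLc m. \<Oplus>\<^bsub>LC\<^esub>i\<in>{..<r}. a i \<otimes>\<^bsub>LC\<^esub> h i g)"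
    by (intro exI[of _ "card J"] exI[of _ "b \<circ> e"] exI[of _ "k \<circ> e"]) auto
qed

end

section \<open>Matrices of size three and their tensor products\<close>

lemma sum3: "(\<Sum>k<(3::nat). f k) = f 0 + f 1 + f 2"
  by (simp add: numeral_3_eq_3 numeral_2_eq_2)

lemma less3E:
  assumes "i < (3::nat)" "P 0" "P 1" "P 2" shows "P i"
proof -
  have "i = 0 \<or> i = 1 \<or> i = 2" using assms(1) by linarith
  then show ?thesis using assms(2-) by auto
qed

lemma mats3_eqI:
  assumes "A \<in> mats 3" "B \<in> mats 3"
    "A (0, 0) = B (0, 0)" "A (0, 1) = B (0, 1)" "A (0, 2) = B (0, 2)"
    "A (1, 0) = B (1, 0)" "A (1, 1) = B (1, 1)" "A (1, 2) = B (1, 2)"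
    "A (2, 0) = B (2, 0)" "A (2, 1) = B (2, 1)" "A (2, 2) = B (2, 2)"
  shows "A = B"
proof (rule mats_eqI[OF assms(1,2)])
  fix i j :: nat assume ij: "i < 3" "j < 3"
  show "A (i, j) = B (i, j)"
    by (rule less3E[OF ij(1)]; rule less3E[OF ij(2)]) (fact assms)+
qed

definition det3 :: "'a::comm_ring_1 sqmat \<Rightarrow> 'a"
  where "det3 x = x (0, 0) * (x (1, 1) * x (2, 2) - x (1, 2) * x (2, 1))
    - x (0, 1) * (x (1, 0) * x (2, 2) - x (1, 2) * x (2, 0))
    + x (0, 2) * (x (1, 0) * x (2, 1) - x (1, 1) * x (2, 0))"

definition tr3 :: "'a::comm_ring_1 sqmat \<Rightarrow> 'a"
  where "tr3 x = x (0, 0) + x (1, 1) + x (2, 2)"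

text \<open>
  The second coefficient of the characteristic polynomial.
\<close>
definition minors3 :: "'a::comm_ring_1 sqmat \<Rightarrow> 'a"
  where "minors3 x = x (0, 0) * x (1, 1) - x (0, 1) * x (1, 0) + x (0, 0) * x (2, 2) - x (0, 2) * x (2, 0)
    + x (1, 1) * x (2, 2) - x (1, 2) * x (2, 1)"

definition diag3 :: "(nat \<Rightarrow> 'a::comm_ring_1) \<Rightarrow> 'a sqmat"
  where "diag3 y = (\<lambda>(i, j)\<in>idx 3. if i = j then y i else 0)"

lemma mmul3_entry:
  assumes "i < 3" "j < 3"
  shows "mmul 3 A B (i, j) = A (i, 0) * B (0, j) + A (i, 1) * B (1, j) + A (i, 2) * B (2, j)"
  unfolding mmul_entry[OF assms] sum3 ..

lemma det3_mmul: "det3 (mmul 3 A B) = det3 A * det3 (B :: 'a::field sqmat)"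
  unfolding det3_def by (simp add: mmul3_entry algebra_simps)

lemmas mmul3_entries =
  mmul3_entry[OF three(1) three(1)] mmul3_entry[OF three(1) three(2)] mmul3_entry[OF three(1) three(3)]
  mmul3_entry[OF three(2) three(1)] mmul3_entry[OF three(2) three(2)] mmul3_entry[OF three(2) three(3)]
  mmul3_entry[OF three(3) three(1)] mmul3_entry[OF three(3) three(2)] mmul3_entry[OF three(3) three(3)]

lemma tr3_square: "tr3 (mmul 3 A A) = tr3 A * tr3 A - 2 * minors3 (A :: 'a::field sqmat)"
proof -
  have "(a * a + b * d + c * g) + (d * b + e * e + f * h) + (g * c + h * f + i * i) = (a + e + i) * (a + e + i) - 2 * (a * e - b * d + a * i - c * g + e * i - f * h)" for a b c d e f g h i :: 'a
    by Groebner_Basis.algebra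
  then show ?thesis unfolding tr3_def minors3_def mmul3_entries .
qed

lemma minors3_square: "minors3 (mmul 3 A A) = minors3 A * minors3 A - 2 * tr3 A * det3 (A :: 'a::field sqmat)"
proof -
  have "(a * a + b * d + c * g) * (d * b + e * e + f * h) - (a * b + b * e + c * h) * (d * a + e * d + f * g) + (a * a + b * d + c * g) * (g * c + h * f + i * i) - (a * c + b * f + c * i) * (g * a + h * d + i * g) + (d * b + e * e + f * h) * (g * c + h * f + i * i) - (d * c + e * f + f * i) * (g * b + h * e + i * h) = (a * e - b * d + a * i - c * g + e * i - f * h) * (a * e - b * d + a * i - c * g + e * i - f * h) - 2 * (a + e + i) * (a * (e * i - f * h) - b * (d * i - f * g) + c * (d * h - e * g))" for a b c d e f g h i :: 'a
    by Groebner_Basis.algebra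
  then show ?thesis unfolding tr3_def minors3_def det3_def mmul3_entries .
qed

lemma diag3_mats [simp]: "diag3 y \<in> mats 3" unfolding diag3_def by simp

lemma diag3_entry: "i < 3 \<Longrightarrow> j < 3 \<Longrightarrow> diag3 y (i, j) = (if i = j then y i else 0)"
  by (simp add: diag3_def)

lemma det3_diag3: "det3 (diag3 y) = y 0 * y 1 * y 2"
  by (simp add: det3_def diag3_entry)

lemma mmul_diag3: "mmul 3 (diag3 y) (diag3 z) = diag3 (\<lambda>i. y i * z i)"
  by (rule mats3_eqI) (simp_all add: mmul3_entry diag3_entry)

lemma mone_diag3: "mone 3 = diag3 (\<lambda>_. 1)"
  by (rule mats3_eqI) (simp_all add: mone_entry diag3_entry)

lemma det3_mone: "det3 (mone 3) = 1" unfolding mone_diag3 det3_diag3 by simp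

lemma diag3_cong: "(\<And>i. i < 3 \<Longrightarrow> y i = z i) \<Longrightarrow> diag3 y = diag3 z"
  by (rule mats_eqI[of _ 3]) (auto simp: diag3_entry)

lemma diag_eq_diag3:
  assumes "x \<in> mats 3" "\<And>i j. i < 3 \<Longrightarrow> j < 3 \<Longrightarrow> i \<noteq> j \<Longrightarrow> x (i, j) = 0"
  shows "x = diag3 (\<lambda>i. x (i, i))"
  by (rule mats_eqI[of _ 3]) (use assms in \<open>auto simp: diag3_entry\<close>)

definition adj3 :: "'a::comm_ring_1 sqmat \<Rightarrow> 'a sqmat"
  where "adj3 x = (\<lambda>(i, j)\<in>idx 3. x ((j + 1) mod 3, (i + 1) mod 3) * x ((j + 2) mod 3, (i + 2) mod 3)
     - x ((j + 1) mod 3, (i + 2) mod 3) * x ((j + 2) mod 3, (i + 1) mod 3))"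

definition inv3 :: "'a::field sqmat \<Rightarrow> 'a sqmat"
  where "inv3 x = (\<lambda>ij\<in>idx 3. inverse (det3 x) * adj3 x ij)"

lemma inv3_mats [simp]: "inv3 x \<in> mats 3" unfolding inv3_def by simp

lemma adj3_entries:
  "adj3 x (0, 0) = x (1, 1) * x (2, 2) - x (1, 2) * x (2, 1)"
  "adj3 x (0, 1) = x (2, 1) * x (0, 2) - x (2, 2) * x (0, 1)"
  "adj3 x (0, 2) = x (0, 1) * x (1, 2) - x (0, 2) * x (1, 1)"
  "adj3 x (1, 0) = x (1, 2) * x (2, 0) - x (1, 0) * x (2, 2)"
  "adj3 x (1, 1) = x (2, 2) * x (0, 0) - x (2, 0) * x (0, 2)"
  "adj3 x (1, 2) = x (0, 2) * x (1, 0) - x (0, 0) * x (1, 2)"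
  "adj3 x (2, 0) = x (1, 0) * x (2, 1) - x (1, 1) * x (2, 0)"
  "adj3 x (2, 1) = x (2, 0) * x (0, 1) - x (2, 1) * x (0, 0)"
  "adj3 x (2, 2) = x (0, 0) * x (1, 1) - x (0, 1) * x (1, 0)"
  by (simp_all add: adj3_def flip: numeral_2_eq_2)

lemma mmul_adj3: "mmul 3 x (adj3 x) = diag3 (\<lambda>_. det3 x)" "mmul 3 (adj3 x) x = diag3 (\<lambda>_. det3 x)"
proof -
  note s = mmul3_entry diag3_entry adj3_entries[unfolded One_nat_def] adj3_entries det3_def
  show "mmul 3 x (adj3 x) = diag3 (\<lambda>_. det3 x)"
    by (rule mats3_eqI) (simp_all add: s algebra_simps)
  show "mmul 3 (adj3 x) x = diag3 (\<lambda>_. det3 x)"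
    by (rule mats3_eqI) (simp_all add: s algebra_simps)
qed

lemma mmul_inv3:
  assumes "det3 x \<noteq> 0"
  shows "mmul 3 x (inv3 x) = mone 3" "mmul 3 (inv3 x) x = mone 3"
proof -
  have 1: "mmul 3 x (inv3 x) (i, j) = inverse (det3 x) * mmul 3 x (adj3 x) (i, j)"
    "mmul 3 (inv3 x) x (i, j) = inverse (det3 x) * mmul 3 (adj3 x) x (i, j)" if "i < 3" "j < 3" for i j
    using that by (simp_all add: mmul3_entry inv3_def algebra_simps)
  show "mmul 3 x (inv3 x) = mone 3" "mmul 3 (inv3 x) x = mone 3"
    by (rule mats_eqI[of _ 3]; use assms in \<open>simp add: 1 mmul_adj3 diag3_entry mone_entry\<close>)+
qed

text \<open>
  The Kronecker product, where \<open>i mod 3\<close> indexes the first factor and \<open>i div 3\<close> the second.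
  With a diagonal second factor the result is block diagonal with blocks proportional to the first factor.
\<close>
definition tens :: "'a::comm_ring_1 sqmat \<Rightarrow> 'a sqmat \<Rightarrow> 'a sqmat"
  where "tens x y = (\<lambda>(i, j)\<in>idx 9. x (i mod 3, j mod 3) * y (i div 3, j div 3))"

lemma tens_mats [simp]: "tens x y \<in> mats 9" unfolding tens_def by simp

lemma tens_entry: "i < 9 \<Longrightarrow> j < 9 \<Longrightarrow> tens x y (i, j) = x (i mod 3, j mod 3) * y (i div 3, j div 3)"
  by (simp add: tens_def)

lemma sum9: "(\<Sum>k<(9::nat). f (k mod 3) (k div 3)) = (\<Sum>k<3. \<Sum>p<3. f k p)"
proof -
  have "{..<9} = {0,1,2,3,4,5,6,7,8::nat}" by auto
  then show ?thesis by (simp add: sum3 add_ac flip: numeral_2_eq_2)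
qed

lemma div3_less: "i < 9 \<Longrightarrow> i div 3 < (3::nat)" by linarith

lemma tens_mmul: "mmul 9 (tens x y) (tens x' y') = tens (mmul 3 x x') (mmul 3 y y')"
proof (rule mats_eqI)
  fix i j :: nat assume ij: "i < 9" "j < 9"
  have "mmul 9 (tens x y) (tens x' y') (i, j)
      = (\<Sum>k<9. (x (i mod 3, k mod 3) * x' (k mod 3, j mod 3)) * (y (i div 3, k div 3) * y' (k div 3, j div 3)))"
    unfolding mmul_entry[OF ij] by (rule sum.cong) (use ij in \<open>auto simp: tens_entry\<close>)
  also have "\<dots> = (\<Sum>k<3. \<Sum>p<3. (x (i mod 3, k) * x' (k, j mod 3)) * (y (i div 3, p) * y' (p, j div 3)))"
    by (rule sum9)
  also have "\<dots> = (\<Sum>k<3. x (i mod 3, k) * x' (k, j mod 3)) * (\<Sum>p<3. y (i div 3, p) * y' (p, j div 3))"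
    by (rule sum_product[symmetric])
  also have "\<dots> = tens (mmul 3 x x') (mmul 3 y y') (i, j)"
    using ij div3_less by (simp add: tens_entry mmul_entry)
  finally show "mmul 9 (tens x y) (tens x' y') (i, j) = tens (mmul 3 x x') (mmul 3 y y') (i, j)" .
qed auto

lemma eq_iff_div_mod3: "(i::nat) = j \<longleftrightarrow> i mod 3 = j mod 3 \<and> i div 3 = j div 3"
  by (metis div_mult_mod_eq)

lemma tens_mone: "tens (mone 3) (mone 3) = mone 9"
proof (rule mats_eqI)
  fix i j :: nat assume ij: "i < 9" "j < 9"
  then show "tens (mone 3) (mone 3) (i, j) = mone 9 (i, j)"
    using div3_less eq_iff_div_mod3[of i j] by (auto simp: tens_entry mone_entry)
qed auto

lemma tens_scale: "tens (\<lambda>ij\<in>idx 3. r * x ij) (diag3 y) = tens x (diag3 (\<lambda>i. r * y i))"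
  by (rule mats_eqI[of _ 9]) (auto simp: tens_entry diag3_entry div3_less)

section \<open>The split group and its diagonal torus\<close>

text \<open>
  Over the complex numbers this is \<open>(SL\<^sub>3 \<times> S) / \<mu>\<^sub>3\<close> with the torus $S$ of diagonal matrices of determinant 1.
  The homomorphism from pairs \<open>(x, y)\<close> to \<open>tens x (diag3 y)\<close> identifies pairs that differ by
  a scalar and its inverse, and the condition on the product is invariant under this change.
\<close>
definition std :: "complex sqmat set"
  where "std = {tens x (diag3 y) | x y. x \<in> mats 3 \<and> det3 x * (y 0 * y 1 * y 2) = 1}"

definition std_torus :: "complex sqmat set"
  where "std_torus = {tens (diag3 x) (diag3 y) | x y. x 0 * x 1 * x 2 * (y 0 * y 1 * y 2) = 1}"

lemma stdE:
  assumes "g \<in> std"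
  obtains x y where "g = tens x (diag3 y)" "x \<in> mats 3" "det3 x * (y 0 * y 1 * y 2) = 1"
  using assms unfolding std_def by blast

lemma stdI: "x \<in> mats 3 \<Longrightarrow> det3 x * (y 0 * y 1 * y 2) = 1 \<Longrightarrow> tens x (diag3 y) \<in> std"
  unfolding std_def by blast

lemma std_torusE:
  assumes "g \<in> std_torus"
  obtains x y where "g = tens (diag3 x) (diag3 y)" "x 0 * x 1 * x 2 * (y 0 * y 1 * y 2) = 1"
  using assms unfolding std_torus_def by blast

lemma std_torusI: "x 0 * x 1 * x 2 * (y 0 * y 1 * y 2) = 1 \<Longrightarrow> tens (diag3 x) (diag3 y) \<in> std_torus"
  unfolding std_torus_def by blast

lemma std_torus_subset: "std_torus \<subseteq> std"
  by (auto elim!: std_torusE intro!: stdI simp: det3_diag3)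

context base_field
begin

lemma tens_GL:
  assumes "det3 x \<noteq> 0" "det3 y \<noteq> 0"
  shows "tens x y \<in> GLc 9" "minv 9 (tens x y) = tens (inv3 x) (inv3 y)"
proof -
  have "mmul 9 (tens x y) (tens (inv3 x) (inv3 y)) = mone 9" "mmul 9 (tens (inv3 x) (inv3 y)) (tens x y) = mone 9"
    unfolding tens_mmul by (simp_all add: mmul_inv3 assms tens_mone)
  then show "tens x y \<in> GLc 9" "minv 9 (tens x y) = tens (inv3 x) (inv3 y)"
    using GL_inv_unique[OF tens_mats tens_mats] by blast+
qed

lemma tens_diag3_GL:
  assumes "det3 x * (y 0 * y 1 * y 2) = 1"
  shows "tens x (diag3 y) \<in> GLc 9" "minv 9 (tens x (diag3 y)) = tens (inv3 x) (diag3 (\<lambda>i. inverse (y i)))"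
proof -
  have nz: "det3 x \<noteq> 0" "y 0 \<noteq> 0" "y 1 \<noteq> 0" "y 2 \<noteq> 0" using assms by auto
  then have y: "y i \<noteq> 0" if "i < 3" for i by (intro less3E[OF that, of "\<lambda>i. y i \<noteq> 0"])
  have "mmul 3 (diag3 y) (diag3 (\<lambda>i. inverse (y i))) = mone 3" "mmul 3 (diag3 (\<lambda>i. inverse (y i))) (diag3 y) = mone 3"
    using y unfolding mmul_diag3 mone_diag3 by (auto intro!: diag3_cong)
  then have "mmul 9 (tens x (diag3 y)) (tens (inv3 x) (diag3 (\<lambda>i. inverse (y i)))) = mone 9"
     "mmul 9 (tens (inv3 x) (diag3 (\<lambda>i. inverse (y i)))) (tens x (diag3 y)) = mone 9"
    unfolding tens_mmul by (simp_all add: mmul_inv3 nz tens_mone)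
  then show "tens x (diag3 y) \<in> GLc 9" "minv 9 (tens x (diag3 y)) = tens (inv3 x) (diag3 (\<lambda>i. inverse (y i)))"
    using GL_inv_unique[OF tens_mats tens_mats] by blast+
qed

lemma std_GL: "std \<subseteq> GLc 9"
  using tens_diag3_GL(1) by (auto elim!: stdE)

lemma std_mult: "g \<in> std \<Longrightarrow> h \<in> std \<Longrightarrow> mmul 9 g h \<in> std"
proof (elim stdE)
  fix x y x' y' assume *: "g = tens x (diag3 y)" "det3 x * (y 0 * y 1 * y 2) = 1" "h = tens x' (diag3 y')" "det3 x' * (y' 0 * y' 1 * y' 2) = 1"
  have "det3 (mmul 3 x x') * (y 0 * y' 0 * (y 1 * y' 1) * (y 2 * y' 2)) = (det3 x * (y 0 * y 1 * y 2)) * (det3 x' * (y' 0 * y' 1 * y' 2))"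
    by (simp add: det3_mmul mult_ac)
  also have "\<dots> = 1" unfolding *(2,4) by simp
  finally show ?thesis unfolding *(1,3) tens_mmul mmul_diag3 by (rule stdI[OF mmul_mats])
qed

lemma det3_inv3: "det3 x \<noteq> 0 \<Longrightarrow> det3 (inv3 x) = inverse (det3 x)"
  using det3_mmul[of x "inv3 x"] by (simp add: mmul_inv3 det3_mone inverse_unique)

lemma std_inv: "g \<in> std \<Longrightarrow> minv 9 g \<in> std"
proof (elim stdE)
  fix x y assume *: "g = tens x (diag3 y)" "det3 x * (y 0 * y 1 * y 2) = 1"
  then have nz: "det3 x \<noteq> 0" by auto
  have "inverse (det3 x * (y 0 * y 1 * y 2)) = 1" using *(2) by simp
  then show ?thesis unfolding *(1) tens_diag3_GL(2)[OF *(2)]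
    by (intro stdI) (simp_all add: det3_inv3[OF nz] mult_ac)
qed

lemma std_one: "mone 9 \<in> std"
  unfolding tens_mone[symmetric] using stdI[of "mone 3" "\<lambda>_. 1"] by (simp add: det3_mone mone_diag3[symmetric])

lemma std_torus_mult: "g \<in> std_torus \<Longrightarrow> h \<in> std_torus \<Longrightarrow> mmul 9 g h \<in> std_torus"
proof (elim std_torusE)
  fix x y x' y' assume *: "g = tens (diag3 x) (diag3 y)" "x 0 * x 1 * x 2 * (y 0 * y 1 * y 2) = 1"
     "h = tens (diag3 x') (diag3 y')" "x' 0 * x' 1 * x' 2 * (y' 0 * y' 1 * y' 2) = 1"
  have "x 0 * x' 0 * (x 1 * x' 1) * (x 2 * x' 2) * (y 0 * y' 0 * (y 1 * y' 1) * (y 2 * y' 2))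
     = (x 0 * x 1 * x 2 * (y 0 * y 1 * y 2)) * (x' 0 * x' 1 * x' 2 * (y' 0 * y' 1 * y' 2))"
    by (simp add: mult_ac)
  also have "\<dots> = 1" unfolding *(2,4) by simp
  finally show ?thesis unfolding *(1,3) tens_mmul mmul_diag3 by (rule std_torusI)
qed

lemma std_torus_commute: "g \<in> std_torus \<Longrightarrow> h \<in> std_torus \<Longrightarrow> mmul 9 g h = mmul 9 h g"
  by (auto elim!: std_torusE simp: tens_mmul mmul_diag3 mult.commute)

lemma minv_tens_diag3:
  assumes "x 0 * x 1 * x 2 * (y 0 * y 1 * y 2) = 1"
  shows "minv 9 (tens (diag3 x) (diag3 y)) = tens (diag3 (\<lambda>i. inverse (x i))) (diag3 (\<lambda>i. inverse (y i)))"
proof -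
  have nz: "x 0 \<noteq> 0" "x 1 \<noteq> 0" "x 2 \<noteq> 0" "y 0 \<noteq> 0" "y 1 \<noteq> 0" "y 2 \<noteq> 0" using assms by auto
  have x: "x i \<noteq> 0" if "i < 3" for i by (rule less3E[OF that nz(1-3)])
  have y: "y i \<noteq> 0" if "i < 3" for i by (rule less3E[OF that nz(4-6)])
  show ?thesis
    by (rule GL_inv_unique(2)) (simp_all add: tens_mmul mmul_diag3 tens_mone[symmetric] mone_diag3 x y cong: diag3_cong)
qed

lemma std_torus_inv: "g \<in> std_torus \<Longrightarrow> minv 9 g \<in> std_torus"
proof (elim std_torusE)
  fix x y assume *: "g = tens (diag3 x) (diag3 y)" "x 0 * x 1 * x 2 * (y 0 * y 1 * y 2) = 1"
  have "inverse (x 0 * x 1 * x 2 * (y 0 * y 1 * y 2)) = 1" using *(2) by simp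
  then show ?thesis unfolding *(1) minv_tens_diag3[OF *(2)]
    by (intro std_torusI) (simp add: mult_ac)
qed

lemma std_torus_one: "mone 9 \<in> std_torus"
  unfolding tens_mone[symmetric] mone_diag3 by (intro std_torusI) simp

subsection \<open>Equations\<close>

text \<open>
  The determinant of the matrix whose row \<open>i\<close> is row \<open>i\<close> of the diagonal block with number \<open>i\<close>. On
  \<open>tens x (diag3 y)\<close> it is $\det x \cdot y_0 y_1 y_2$, a polynomial in the entries, whereas the
  entries determine \<open>x\<close> and \<open>y\<close> only up to scalars.
\<close>
definition mixed_det :: "complex sqmat \<Rightarrow> complex"
  where "mixed_det g = g (0, 0) * (g (4, 4) * g (8, 8) - g (4, 5) * g (8, 7))
        - g (0, 1) * (g (4, 3) * g (8, 8) - g (4, 5) * g (8, 6))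
        + g (0, 2) * (g (4, 3) * g (8, 7) - g (4, 4) * g (8, 6))"

lemma mixed_det_tens: "mixed_det (tens x (diag3 y)) = det3 x * (y 0 * y 1 * y 2)"
  by (simp add: mixed_det_def tens_entry diag3_entry det3_def algebra_simps flip: numeral_2_eq_2)

text \<open>
  The entries off the diagonal blocks vanish, the diagonal blocks are proportional to each other, and the product of
  the two determinants is 1.
\<close>
definition std_equations :: "(complex sqmat \<Rightarrow> complex) set"
  where "std_equations =
     (\<lambda>(i, j) g. g (i, j)) ` {(i, j) \<in> idx 9. i div 3 \<noteq> j div 3} \<union>
     (\<lambda>(p, q, k, l, k', l') g. g (3*p+k, 3*p+l) * g (3*q+k', 3*q+l') - g (3*q+k, 3*q+l) * g (3*p+k', 3*p+l'))
        ` ({..<3} \<times> {..<3} \<times> {..<3} \<times> {..<3} \<times> {..<3} \<times> {..<3}) \<union>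
     {\<lambda>g. mixed_det g - 1}"

lemma std_equations_regular: "f \<in> std_equations \<Longrightarrow> regular UNIV 9 f"
  unfolding std_equations_def mixed_det_def
  by (auto intro!: regular_diff regular_add regular_mult regular_entry regular_const is_subfield_UNIV)

lemma tens_diag3_block_entry:
  "p < 3 \<Longrightarrow> q < 3 \<Longrightarrow> k < 3 \<Longrightarrow> l < 3 \<Longrightarrow> tens x (diag3 y) (3*p+k, 3*q+l) = (if p = q then x (k, l) * y p else 0)"
  by (simp add: tens_entry diag3_entry)

text \<open>
  Conversely, the first block of an invertible solution is not zero, and the ratios of the other blocks to it
  provide the diagonal factor.
\<close>
lemma std_closed_eq: "std = {g \<in> GLc 9. \<forall>f\<in>std_equations. f g = 0}"
proof (intro equalityI subsetI)
  fix g assume "g \<in> std"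
  then obtain x y where g: "g = tens x (diag3 y)" "x \<in> mats 3" and d: "det3 x * (y 0 * y 1 * y 2) = 1" by (rule stdE)
  have "f g = 0" if "f \<in> std_equations" for f
    using that unfolding std_equations_def
  proof (elim UnE imageE)
    fix ij assume "f = (\<lambda>(i, j) g. g (i, j)) ij" "ij \<in> {(i, j) \<in> idx 9. i div 3 \<noteq> j div 3}"
    then show ?thesis unfolding g(1) using div3_less by (auto simp: tens_entry diag3_entry)
  next
    fix z assume "f = (\<lambda>(p, q, k, l, k', l') g. g (3*p+k, 3*p+l) * g (3*q+k', 3*q+l') - g (3*q+k, 3*q+l) * g (3*p+k', 3*p+l')) z"
      "z \<in> {..<3} \<times> {..<3} \<times> {..<3} \<times> {..<3} \<times> {..<3} \<times> {..<3}"
    then show ?thesis unfolding g(1) by (auto simp: tens_diag3_block_entry)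
  next
    assume "f \<in> {\<lambda>g. mixed_det g - 1}"
    then have "f = (\<lambda>g. mixed_det g - 1)" by (rule singletonD)
    then show ?thesis using d by (simp add: g(1) mixed_det_tens)
  qed
  then show "g \<in> {g \<in> GLc 9. \<forall>f\<in>std_equations. f g = 0}" using tens_diag3_GL(1)[OF d] g by simp
next
  fix g assume "g \<in> {g \<in> GLc 9. \<forall>f\<in>std_equations. f g = 0}"
  then have gm: "g \<in> mats 9" and eq: "\<And>f. f \<in> std_equations \<Longrightarrow> f g = 0" using GL_mats by auto
  have off: "g (i, j) = 0" if "i < 9" "j < 9" "i div 3 \<noteq> j div 3" for i j
    using eq[of "\<lambda>g. g (i, j)"] that unfolding std_equations_def by fastforce
  have ratio: "g (3*p+k, 3*p+l) * g (3*q+k', 3*q+l') = g (3*q+k, 3*q+l) * g (3*p+k', 3*p+l')"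
    if "p < 3" "q < 3" "k < 3" "l < 3" "k' < 3" "l' < 3" for p q k l k' l'
  proof -
    have "(\<lambda>g. g (3*p+k, 3*p+l) * g (3*q+k', 3*q+l') - g (3*q+k, 3*q+l) * g (3*p+k', 3*p+l')) \<in> std_equations"
      unfolding std_equations_def
      by (rule UnI1, rule UnI2, rule image_eqI[of _ _ "(p, q, k, l, k', l')"]) (use that in auto)
    from eq[OF this] show ?thesis by simp
  qed
  have mixed: "mixed_det g - 1 = 0"
    by (rule eq) (simp add: std_equations_def)
  have "\<exists>l0<3. g (0, l0) \<noteq> 0"
  proof (rule ccontr)
    assume "\<not> ?thesis"
    then have "g (0, 0) = 0" "g (0, 1) = 0" "g (0, 2) = 0" by auto
    then show False using mixed by (simp add: mixed_det_def)
  qed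
  then obtain l0 where l0: "l0 < 3" "g (0, l0) \<noteq> 0" by blast
  define x where "x = (\<lambda>(k, l)\<in>idx 3. g (k, l))"
  define y where "y = (\<lambda>p. g (3*p, 3*p+l0) / g (0, l0))"
  have x: "x (k, l) = g (k, l)" if "k < 3" "l < 3" for k l using that by (simp add: x_def)
  have block: "g (3*p+k, 3*p+l) = x (k, l) * y p" if "p < 3" "k < 3" "l < 3" for p k l
    using ratio[of 0 p k l 0 l0] that l0 by (simp add: x y_def field_simps)
  have g_eq: "g = tens x (diag3 y)"
  proof (rule mats_eqI[OF gm tens_mats])
    fix i j :: nat assume ij: "i < 9" "j < 9"
    show "g (i, j) = tens x (diag3 y) (i, j)"
    proof (cases "i div 3 = j div 3")
      case True
      have "g (3 * (i div 3) + i mod 3, 3 * (i div 3) + j mod 3) = x (i mod 3, j mod 3) * y (i div 3)"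
        using ij div3_less by (intro block) auto
      moreover have "3 * (i div 3) + i mod 3 = i" by (rule mult_div_mod_eq)
      moreover have "3 * (i div 3) + j mod 3 = j" unfolding True by (rule mult_div_mod_eq)
      ultimately show ?thesis using ij True by (simp add: tens_entry diag3_entry div3_less)
    next
      case False
      then show ?thesis using ij off by (simp add: tens_entry diag3_entry div3_less)
    qed
  qed
  have "det3 x * (y 0 * y 1 * y 2) = 1"
    using mixed unfolding g_eq mixed_det_tens by simp
  then show "g \<in> std" unfolding g_eq by (intro stdI) (simp_all add: x_def)
qed

lemma zariski_closed_std: "zariski_closed 9 std"
  unfolding std_closed_eq by (rule zariski_closedI) (rule std_equations_regular)

lemma std_torus_closed_eq:
  "std_torus = {g \<in> GLc 9. \<forall>f\<in>std_equations \<union> (\<lambda>(i, j) g. g (i, j)) ` {(i, j) \<in> idx 9. i \<noteq> j}. f g = 0}"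
proof (intro equalityI subsetI)
  fix g assume g: "g \<in> std_torus"
  then have "g \<in> {g \<in> GLc 9. \<forall>f\<in>std_equations. f g = 0}" using std_torus_subset std_closed_eq by blast
  moreover obtain x y where g: "g = tens (diag3 x) (diag3 y)" using g by (rule std_torusE)
  have "g (i, j) = 0" if "i < 9" "j < 9" "i \<noteq> j" for i j
    unfolding g using that eq_iff_div_mod3[of i j] by (auto simp: tens_entry diag3_entry div3_less)
  ultimately show "g \<in> {g \<in> GLc 9. \<forall>f\<in>std_equations \<union> (\<lambda>(i, j) g. g (i, j)) ` {(i, j) \<in> idx 9. i \<noteq> j}. f g = 0}"
    by auto
next
  fix g assume g: "g \<in> {g \<in> GLc 9. \<forall>f\<in>std_equations \<union> (\<lambda>(i, j) g. g (i, j)) ` {(i, j) \<in> idx 9. i \<noteq> j}. f g = 0}"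
  then have "g \<in> std" unfolding std_closed_eq by blast
  then obtain x y where xy: "g = tens x (diag3 y)" "x \<in> mats 3" "det3 x * (y 0 * y 1 * y 2) = 1" by (rule stdE)
  have off: "g (i, j) = 0" if "i < 9" "j < 9" "i \<noteq> j" for i j
    using g that by fastforce
  have y0: "y 0 \<noteq> 0" using xy(3) by auto
  have "x (k, l) = 0" if "k < 3" "l < 3" "k \<noteq> l" for k l
    using off[of k l] that y0 by (simp add: xy(1) tens_entry diag3_entry)
  then have x: "x = diag3 (\<lambda>i. x (i, i))" by (intro diag_eq_diag3 xy(2))
  have "x (0, 0) * x (1, 1) * x (2, 2) * (y 0 * y 1 * y 2) = 1"
    using xy(3) by (subst (asm) x) (simp add: det3_diag3)
  then show "g \<in> std_torus" unfolding xy(1) by (subst x) (rule std_torusI)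
qed

lemma zariski_closed_std_torus: "zariski_closed 9 std_torus"
  unfolding std_torus_closed_eq
  by (rule zariski_closedI) (auto intro: std_equations_regular regular_entry)

subsection \<open>Connectedness\<close>

text \<open>
  Normalising the first entry of \<open>y\<close> to 1 removes the ambiguity in \<open>tens x (diag3 y)\<close> and identifies
  \<open>std\<close> with \<open>GL\<^sub>3 \<times> GL\<^sub>1\<close> as a variety, hence with an open part of an affine space.
\<close>
definition std_chart :: "complex sqmat \<Rightarrow> complex \<Rightarrow> complex sqmat"
  where "std_chart x t = tens x (diag3 (\<lambda>i. if i = 0 then 1 else if i = 1 then t else inverse (t * det3 x)))"

lemma std_chart_std: "x \<in> mats 3 \<Longrightarrow> det3 x \<noteq> 0 \<Longrightarrow> t \<noteq> 0 \<Longrightarrow> std_chart x t \<in> std"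
  unfolding std_chart_def by (rule stdI) (simp_all add: field_simps)

lemma det3_scale: "det3 (\<lambda>ij\<in>idx 3. r * x ij) = r ^ 3 * det3 (x :: complex sqmat)"
  by (simp add: det3_def algebra_simps power3_eq_cube)

lemma tens_eq_std_chart:
  assumes "det3 x * (y 0 * y 1 * y 2) = 1"
  shows "tens x (diag3 y) = std_chart (\<lambda>ij\<in>idx 3. y 0 * x ij) (y 1 / y 0)" "y 0 \<noteq> 0" "y 1 \<noteq> 0" "det3 (\<lambda>ij\<in>idx 3. y 0 * x ij) \<noteq> 0"
proof -
  have nz: "det3 x \<noteq> 0" "y 0 \<noteq> 0" "y 1 \<noteq> 0" "y 2 \<noteq> 0" using assms by auto
  then show "y 0 \<noteq> 0" "y 1 \<noteq> 0" "det3 (\<lambda>ij\<in>idx 3. y 0 * x ij) \<noteq> 0" by (simp_all add: det3_scale)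
  have "y 2 = y 0 * inverse (y 1 / y 0 * (y 0 ^ 3 * det3 x))"
    using assms nz by (simp add: field_simps power3_eq_cube)
  then show "tens x (diag3 y) = std_chart (\<lambda>ij\<in>idx 3. y 0 * x ij) (y 1 / y 0)"
    unfolding std_chart_def tens_scale det3_scale
    by (intro arg_cong[of _ _ "tens x"] diag3_cong) (erule less3E; use nz in simp)
qed

lemma ratfun_if: "(c \<Longrightarrow> ratfun q f) \<Longrightarrow> (\<not> c \<Longrightarrow> ratfun q g) \<Longrightarrow> ratfun q (\<lambda>x. if c then f x else g x)"
  by (cases c) simp_all

text \<open>
  The curve is the straight segment in the chart, defined wherever the determinant and the second coordinate do not
  vanish. The set \<open>W\<close> is a parameter so that the torus, on which segments between diagonal matrices
  stay diagonal, is covered too.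
\<close>
lemma joined_std_chart:
  assumes x: "x \<in> mats 3" "det3 x \<noteq> 0" "t \<noteq> 0" and x': "x' \<in> mats 3" "det3 x' \<noteq> 0" "t' \<noteq> 0"
    and W: "\<And>r s. s \<noteq> 0 \<Longrightarrow> det3 (\<lambda>ij\<in>idx 3. x ij + r * (x' ij - x ij)) \<noteq> 0 \<Longrightarrow>
       std_chart (\<lambda>ij\<in>idx 3. x ij + r * (x' ij - x ij)) s \<in> W"
  shows "joined_by_curve 9 W (std_chart x t) (std_chart x' t')"
proof -
  define M where "M = (\<lambda>ij. [:x ij, x' ij - x ij:])"
  define tp where "tp = [:t, t' - t:]"
  define xr where "xr = (\<lambda>r. \<lambda>ij\<in>idx 3. x ij + r * (x' ij - x ij))"
  define q where "q = det3 M * tp"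
  define \<phi> where "\<phi> = (\<lambda>r. std_chart (xr r) (poly tp r))"
  have xr: "xr r (k, l) = poly (M (k, l)) r" if "k < 3" "l < 3" for r k l
    using that by (simp add: xr_def M_def)
  have det: "det3 (xr r) = poly (det3 M) r" for r by (simp add: det3_def xr)
  have adj: "adj3 (xr r) (k, l) = poly (adj3 M (k, l)) r" if "k < 3" "l < 3" for r k l
    using that by (simp add: adj3_def xr)
  have q: "poly q r = det3 (xr r) * poly tp r" for r by (simp add: q_def det)
  have ends: "xr 0 = x" "xr 1 = x'" "poly tp 0 = t" "poly tp 1 = t'"
    by (auto simp: xr_def tp_def intro!: mats_eqI[of _ 3] x(1) x'(1))
  have rx: "ratfun q (\<lambda>r. xr r (k, l))" if "k < 3" "l < 3" for k l
    unfolding xr[OF that] by (rule ratfun_poly)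
  have rt: "ratfun q (\<lambda>r. poly tp r)" "ratfun q (\<lambda>r. inverse (poly tp r * det3 (xr r)))"
    using ratfun_poly[of q tp] ratfun_inverse[of q] by (simp_all add: q mult.commute)
  have rd: "ratfun q (\<lambda>r. det3 (xr r))" unfolding det by (rule ratfun_poly)
  show ?thesis
    unfolding joined_by_curve_def
  proof (intro exI conjI allI impI)
    show "poly q 0 \<noteq> 0" "poly q 1 \<noteq> 0" using x x' by (simp_all add: q ends)
    show "\<phi> 0 = std_chart x t" "\<phi> 1 = std_chart x' t'" by (simp_all add: \<phi>_def ends)
    show "\<phi> r \<in> W" if "poly q r \<noteq> 0" for r
      unfolding \<phi>_def xr_def by (rule W) (use that in \<open>auto simp: q xr_def\<close>)
    fix i j :: nat assume ij: "i < 9" "j < 9"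
    have m: "i mod 3 < 3" "j mod 3 < 3" by simp_all
    note d = div3_less[OF ij(1)] div3_less[OF ij(2)]
    show "ratfun q (\<lambda>r. \<phi> r (i, j))"
      unfolding \<phi>_def std_chart_def tens_entry[OF ij] diag3_entry[OF d]
      by (intro ratfun_mult rx m ratfun_if ratfun_const rt)
    have e: "minv 9 (\<phi> r) (i, j) = (poly tp r * inverse (poly q r)) * poly (adj3 M (i mod 3, j mod 3)) r *
         (if i div 3 = j div 3 then (if i div 3 = 0 then 1 else if i div 3 = 1 then det3 (xr r) * inverse (poly q r) else poly q r) else 0)"
      if nz: "poly q r \<noteq> 0" for r
    proof -
      have n2: "det3 (xr r) \<noteq> 0" "poly tp r \<noteq> 0" using nz by (auto simp: q)
      have "minv 9 (\<phi> r) = tens (inv3 (xr r)) (diag3 (\<lambda>i. inverse (if i = 0 then 1 else if i = 1 then poly tp r else inverse (poly tp r * det3 (xr r)))))"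
        unfolding \<phi>_def std_chart_def by (rule tens_diag3_GL(2)) (use n2 in \<open>simp add: field_simps\<close>)
      then show ?thesis
        using n2 m by (simp add: tens_entry[OF ij] diag3_entry[OF d] inv3_def adj q field_simps)
    qed
    have "ratfun q (\<lambda>r. (poly tp r * inverse (poly q r)) * poly (adj3 M (i mod 3, j mod 3)) r *
         (if i div 3 = j div 3 then (if i div 3 = 0 then 1 else if i div 3 = 1 then det3 (xr r) * inverse (poly q r) else poly q r) else 0))"
      by (intro ratfun_mult ratfun_if ratfun_const rt rd ratfun_inverse ratfun_poly)
    then show "ratfun q (\<lambda>r. minv 9 (\<phi> r) (i, j))" using e by (simp cong: ratfun_cong)
  qed
qed

lemma zariski_connected_std: "zariski_connected 9 std"
proof (rule zariski_connected_if_joined[OF std_GL])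
  fix g h assume "g \<in> std" "h \<in> std"
  then show "joined_by_curve 9 std g h"
  proof (elim stdE)
    fix x y x' y' assume *: "g = tens x (diag3 y)" "det3 x * (y 0 * y 1 * y 2) = 1" "h = tens x' (diag3 y')" "det3 x' * (y' 0 * y' 1 * y' 2) = 1"
    show ?thesis
      unfolding *(1,3) tens_eq_std_chart(1)[OF *(2)] tens_eq_std_chart(1)[OF *(4)]
      by (rule joined_std_chart) (use tens_eq_std_chart(2-4)[OF *(2)] tens_eq_std_chart(2-4)[OF *(4)] std_chart_std in auto)
  qed
qed

lemma zariski_connected_std_torus: "zariski_connected 9 std_torus"
proof (rule zariski_connected_if_joined)
  show "std_torus \<subseteq> GLc 9" using std_torus_subset std_GL by blast
  fix g h assume "g \<in> std_torus" "h \<in> std_torus"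
  then show "joined_by_curve 9 std_torus g h"
  proof (elim std_torusE)
    fix x y x' y' assume *: "g = tens (diag3 x) (diag3 y)" "x 0 * x 1 * x 2 * (y 0 * y 1 * y 2) = 1"
      "h = tens (diag3 x') (diag3 y')" "x' 0 * x' 1 * x' 2 * (y' 0 * y' 1 * y' 2) = 1"
    define d where "d = (\<lambda>r i. y 0 * x i + r * (y' 0 * x' i - y 0 * x i))"
    have dets: "det3 (diag3 x) * (y 0 * y 1 * y 2) = 1" "det3 (diag3 x') * (y' 0 * y' 1 * y' 2) = 1"
      using *(2,4) by (simp_all add: det3_diag3)
    have lin: "(\<lambda>ij\<in>idx 3. (\<lambda>ij\<in>idx 3. y 0 * diag3 x ij) ij + r * ((\<lambda>ij\<in>idx 3. y' 0 * diag3 x' ij) ij - (\<lambda>ij\<in>idx 3. y 0 * diag3 x ij) ij))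
       = diag3 (d r)" for r
      by (rule mats_eqI[of _ 3]) (auto simp: diag3_entry d_def)
    show ?thesis
      unfolding *(1,3) tens_eq_std_chart(1)[OF dets(1)] tens_eq_std_chart(1)[OF dets(2)]
    proof (rule joined_std_chart)
      fix r s :: complex assume s: "s \<noteq> 0" and dn: "det3 (\<lambda>ij\<in>idx 3. (\<lambda>ij\<in>idx 3. y 0 * diag3 x ij) ij + r * ((\<lambda>ij\<in>idx 3. y' 0 * diag3 x' ij) ij - (\<lambda>ij\<in>idx 3. y 0 * diag3 x ij) ij)) \<noteq> 0"
      show "std_chart (\<lambda>ij\<in>idx 3. (\<lambda>ij\<in>idx 3. y 0 * diag3 x ij) ij + r * ((\<lambda>ij\<in>idx 3. y' 0 * diag3 x' ij) ij - (\<lambda>ij\<in>idx 3. y 0 * diag3 x ij) ij)) s \<in> std_torus"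
        using dn s unfolding lin std_chart_def det3_diag3 by (intro std_torusI) (simp add: field_simps)
    qed (use tens_eq_std_chart(2-4)[OF dets(1)] tens_eq_std_chart(2-4)[OF dets(2)] in auto)
  qed
qed

subsection \<open>Unipotent elements\<close>

text \<open>
  The formulas for the invariants of a square allow induction on the exponent: if all three vanish for
  $n^2$, then so do those of $n$.
\<close>
lemma nilpotent_invariants:
  assumes "n \<in> mats 3" "n [^]\<^bsub>mat_ring 3\<^esub> (k::nat) = (\<lambda>ij\<in>idx 3. 0)"
  shows "tr3 n = 0 \<and> minors3 n = 0 \<and> det3 n = 0"
  using assms
proof (induction k arbitrary: n rule: less_induct)
  case (less k)
  interpret R: ring "mat_ring 3" by (rule ring_mat_ring)
  consider "k = 0" | "k = 1" | "k \<ge> 2" by linarith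
  then show ?case
  proof cases
    case 1
    then have "mone 3 (0, 0) = (0 :: complex)" using less.prems(2) by simp
    then show ?thesis by (simp add: mone_entry)
  next
    case 2
    then have "n = (\<lambda>ij\<in>idx 3. 0)" using less.prems by (simp add: mmul_one restrict_def)
    then show ?thesis by (simp add: tr3_def minors3_def det3_def)
  next
    case 3
    define j where "j = (k + 1) div 2"
    have j: "j < k" "k \<le> 2 * j" using 3 by (auto simp: j_def)
    have nc: "n \<in> carrier (mat_ring 3)" using less.prems(1) by simp
    have sq: "n [^]\<^bsub>mat_ring 3\<^esub> (2::nat) = mmul 3 n n"
      using less.prems(1) by (simp add: numeral_2_eq_2 mmul_one)
    have "(mmul 3 n n) [^]\<^bsub>mat_ring 3\<^esub> j = n [^]\<^bsub>mat_ring 3\<^esub> (2 * j)"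
      unfolding sq[symmetric] by (rule R.nat_pow_pow[OF nc])
    also have "\<dots> = n [^]\<^bsub>mat_ring 3\<^esub> (k + (2 * j - k))" using j by simp
    also have "\<dots> = n [^]\<^bsub>mat_ring 3\<^esub> k \<otimes>\<^bsub>mat_ring 3\<^esub> n [^]\<^bsub>mat_ring 3\<^esub> (2 * j - k)"
      by (rule R.nat_pow_mult[OF nc, symmetric])
    also have "\<dots> = (\<lambda>ij\<in>idx 3. 0)"
      unfolding less.prems(2) by (rule mats_eqI[of _ 3]) (simp_all add: mmul_entry)
    finally have "tr3 (mmul 3 n n) = 0 \<and> minors3 (mmul 3 n n) = 0 \<and> det3 (mmul 3 n n) = 0"
      by (intro less.IH[OF j(1)]) simp_all
    then have *: "tr3 n * tr3 n - 2 * minors3 n = 0" "minors3 n * minors3 n - 2 * tr3 n * det3 n = 0" "det3 n * det3 n = 0"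
      unfolding tr3_square minors3_square det3_mmul by blast+
    have "det3 n = 0" using *(3) by simp
    moreover from this have "minors3 n = 0" using *(2) by simp
    moreover from this have "tr3 n = 0" using *(1) by simp
    ultimately show ?thesis by simp
  qed
qed

definition block :: "nat \<Rightarrow> complex sqmat \<Rightarrow> complex sqmat"
  where "block p g = (\<lambda>(k, l)\<in>idx 3. g (3 * p + k, 3 * p + l))"

definition block_diagonal :: "complex sqmat \<Rightarrow> bool"
  where "block_diagonal g \<longleftrightarrow> (\<forall>i<9. \<forall>j<9. i div 3 \<noteq> j div 3 \<longrightarrow> g (i, j) = 0)"

text \<open>
  Unipotence is studied on the three diagonal blocks separately.
\<close>
lemma block_mmul:
  assumes g: "block_diagonal g" and p: "p < 3"
  shows "block p (mmul 9 g h) = mmul 3 (block p g) (block p h)"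
proof (rule mats_eqI[of _ 3])
  fix k l :: nat assume kl: "k < 3" "l < 3"
  define f where "f = (\<lambda>a b. g (3 * p + k, 3 * b + a) * h (3 * b + a, 3 * p + l))"
  have "block p (mmul 9 g h) (k, l) = (\<Sum>i<9. g (3 * p + k, i) * h (i, 3 * p + l))"
    using kl p by (simp add: block_def mmul_entry)
  also have "\<dots> = (\<Sum>i<9. f (i mod 3) (i div 3))" by (simp add: f_def)
  also have "\<dots> = (\<Sum>a<3. \<Sum>b<3. f a b)" by (rule sum9)
  also have "\<dots> = (\<Sum>a<3. f a p)"
  proof (rule sum.cong[OF refl])
    fix a :: nat assume a: "a \<in> {..<3}"
    have "f a b = 0" if "b < 3" "b \<noteq> p" for b
      using g a that kl p unfolding block_diagonal_def f_def by simp
    then have "(\<Sum>b<3. f a b) = (\<Sum>b<3. if b = p then f a p else 0)" by (intro sum.cong) auto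
    then show "(\<Sum>b<3. f a b) = f a p" using p by simp
  qed
  also have "\<dots> = mmul 3 (block p g) (block p h) (k, l)" using kl by (simp add: mmul_entry block_def f_def)
  finally show "block p (mmul 9 g h) (k, l) = mmul 3 (block p g) (block p h) (k, l)" .
qed (simp_all add: block_def)

lemma block_diagonal_mmul: "block_diagonal g \<Longrightarrow> block_diagonal h \<Longrightarrow> block_diagonal (mmul 9 g h)"
  unfolding block_diagonal_def
proof (intro allI impI)
  fix i j :: nat assume g: "\<forall>i<9. \<forall>j<9. i div 3 \<noteq> j div 3 \<longrightarrow> g (i, j) = 0" and h: "\<forall>i<9. \<forall>j<9. i div 3 \<noteq> j div 3 \<longrightarrow> h (i, j) = 0"
    and ij: "i < 9" "j < 9" "i div 3 \<noteq> j div 3"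
  have "g (i, k) * h (k, j) = 0" if "k < 9" for k
    using g h ij that by (cases "i div 3 = k div 3") auto
  then show "mmul 9 g h (i, j) = 0" unfolding mmul_entry[OF ij(1,2)] by (intro sum.neutral) auto
qed

lemma unipotent_tens:
  assumes u: "unipotent 9 (tens x (diag3 y))" and p: "p < 3"
  defines "n \<equiv> (\<lambda>ij\<in>idx 3. y p * x ij - mone 3 ij)"
  shows "tr3 n = 0 \<and> minors3 n = 0 \<and> det3 n = 0"
proof -
  define v where "v = (\<lambda>ij\<in>idx 9. tens x (diag3 y) ij - mone 9 ij)"
  have bd: "block_diagonal v"
    unfolding block_diagonal_def v_def by (auto simp: tens_entry diag3_entry div3_less mone_entry)
  have bv: "block p v = n"
    by (rule mats_eqI[of _ 3]) (use p in \<open>auto simp: block_def v_def n_def tens_diag3_block_entry mone_entry\<close>)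
  from u obtain k :: nat where k: "v [^]\<^bsub>mat_ring 9\<^esub> k = (\<lambda>ij\<in>idx 9. 0)"
    unfolding unipotent_def mat_ring_simps mat_ring_minus[OF tens_mats mone_mats] v_def by blast
  have "block_diagonal (v [^]\<^bsub>mat_ring 9\<^esub> j) \<and> block p (v [^]\<^bsub>mat_ring 9\<^esub> j) = n [^]\<^bsub>mat_ring 3\<^esub> j" for j :: nat
  proof (induction j)
    case 0
    have "block_diagonal (mone 9)" by (auto simp: block_diagonal_def mone_entry)
    moreover have "block p (mone 9) = mone 3"
      by (rule mats_eqI[of _ 3]) (use p in \<open>auto simp: block_def mone_entry\<close>)
    ultimately show ?case by simp
  next
    case (Suc j)
    then show ?case using block_mmul[OF conjunct1[OF Suc] p, of v] block_diagonal_mmul[OF _ bd] bv by simp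
  qed
  then have "n [^]\<^bsub>mat_ring 3\<^esub> k = block p (\<lambda>ij\<in>idx 9. 0)" using k by metis
  also have "\<dots> = (\<lambda>ij\<in>idx 3. 0)" by (rule mats_eqI[of _ 3]) (use p in \<open>auto simp: block_def\<close>)
  finally show ?thesis by (intro nilpotent_invariants) (simp_all add: n_def)
qed

text \<open>
  All blocks $y_p z$ of a unipotent element have trace 3, so the $y_p$ coincide and can be moved into the
  first factor.
\<close>
lemma unipotent_std:
  assumes "u \<in> std" "unipotent 9 u"
  obtains x where "x \<in> mats 3" "u = tens x (mone 3)" "tr3 x = 3"
    "minors3 (\<lambda>ij\<in>idx 3. x ij - mone 3 ij) = 0" "det3 (\<lambda>ij\<in>idx 3. x ij - mone 3 ij) = 0"
proof -
  obtain z y where u: "u = tens z (diag3 y)" "z \<in> mats 3" "det3 z * (y 0 * y 1 * y 2) = 1" using assms(1) by (rule stdE)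
  note inv = unipotent_tens[OF assms(2)[unfolded u(1)]]
  have tr: "y p * tr3 z = 3" if "p < 3" for p
    using inv[OF that] by (simp add: tr3_def mone_entry algebra_simps)
  have "tr3 z \<noteq> 0" using tr[of 0] by auto
  then have y: "y p = y 0" if "p < 3" for p using tr[OF that] tr[of 0] by (metis mult_cancel_right zero_less_numeral)
  define x where "x = (\<lambda>ij\<in>idx 3. y 0 * z ij)"
  have n: "(\<lambda>ij\<in>idx 3. x ij - mone 3 ij) = (\<lambda>ij\<in>idx 3. y 0 * z ij - mone 3 ij)"
    by (rule mats_eqI[of _ 3]) (simp_all add: x_def)
  have "u = tens x (mone 3)"
    unfolding u(1) x_def mone_diag3 tens_scale by (intro arg_cong[of _ _ "tens z"] diag3_cong) (metis y mult_1_right)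
  moreover have "tr3 x = 3" using tr[of 0] by (simp add: tr3_def x_def algebra_simps)
  ultimately show thesis using that[of x] inv[of 0] n by (simp add: x_def)
qed

lemma diagonal_unipotent_trivial:
  fixes x :: "complex sqmat"
  assumes x: "x \<in> mats 3" "\<And>i j. i < 3 \<Longrightarrow> j < 3 \<Longrightarrow> i \<noteq> j \<Longrightarrow> x (i, j) = 0" "tr3 x = 3"
    "minors3 (\<lambda>ij\<in>idx 3. x ij - mone 3 ij) = 0" "det3 (\<lambda>ij\<in>idx 3. x ij - mone 3 ij) = 0"
  shows "tens x (mone 3) = mone 9"
proof -
  define a b c where "a = x (0, 0) - 1" and "b = x (1, 1) - 1" and "c = x (2, 2) - 1"
  have off: "x (0, 1) = 0" "x (0, 2) = 0" "x (1, 0) = 0" "x (1, 2) = 0" "x (2, 0) = 0" "x (2, 1) = 0"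
    by (rule x(2); simp)+
  have s: "a + b + c = 0" using x(3) by (simp add: tr3_def a_def b_def c_def algebra_simps)
  have m: "a * b + a * c + b * c = 0" using x(4) off by (simp add: minors3_def mone_entry a_def b_def c_def)
  have d: "a * (b * c) = 0" using x(5) off by (simp add: det3_def mone_entry a_def b_def c_def)
  have "a * a * a = a * (a * (a + b + c)) - a * (a * b + a * c + b * c) + a * (b * c)"
    "b * b * b = b * (b * (a + b + c)) - b * (a * b + a * c + b * c) + a * (b * c)"
    "c * c * c = c * (c * (a + b + c)) - c * (a * b + a * c + b * c) + a * (b * c)"
    by (simp_all add: algebra_simps)
  then have "a * a * a = 0" "b * b * b = 0" "c * c * c = 0" unfolding s m d by simp_all
  moreover have "r = 0" if "r * r * r = 0" for r :: complex using that by simp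
  ultimately have "a = 0" "b = 0" "c = 0" by blast+
  then have "x = mone 3"
    using off x(1) by (intro mats3_eqI) (simp_all add: mone_entry a_def b_def c_def)
  then show ?thesis using tens_mone by simp
qed

lemma unipotent_std_torus:
  assumes u: "u \<in> std_torus" "unipotent 9 u" shows "u = mone 9"
proof -
  obtain x where x: "x \<in> mats 3" "u = tens x (mone 3)" "tr3 x = 3"
    "minors3 (\<lambda>ij\<in>idx 3. x ij - mone 3 ij) = 0" "det3 (\<lambda>ij\<in>idx 3. x ij - mone 3 ij) = 0"
    using unipotent_std[of u] u std_torus_subset by blast
  obtain x' y' where u': "u = tens (diag3 x') (diag3 y')" using u(1) by (rule std_torusE)
  have "x (i, j) = 0" if "i < 3" "j < 3" "i \<noteq> j" for i j
  proof -
    have "x (i, j) = u (i, j)" unfolding x(2) using that by (simp add: tens_entry mone_entry)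
    also have "\<dots> = 0" unfolding u' using that by (simp add: tens_entry diag3_entry)
    finally show ?thesis .
  qed
  then show ?thesis unfolding x(2) by (intro diagonal_unipotent_trivial x) auto
qed

definition elementary :: "nat \<Rightarrow> nat \<Rightarrow> complex \<Rightarrow> complex sqmat"
  where "elementary i j r = (\<lambda>(k, l)\<in>idx 3. if k = l then 1 else if k = i \<and> l = j then r else 0)"

text \<open>
  The trace of $x \cdot e x e^{-1}$, for an elementary matrix $e$, differs from that of $x^2$ by the square of an
  off-diagonal entry of $x$.
\<close>
lemma elementary_facts:
  assumes "i < 3" "j < 3" "i \<noteq> j"
  shows "det3 (elementary i j r) = 1" "mmul 3 (elementary i j r) (elementary i j (- r)) = mone 3"
    "tr3 (mmul 3 x (mmul 3 (elementary i j 1) (mmul 3 x (elementary i j (- 1))))) = tr3 (mmul 3 x x) - x (j, i) * x (j, i)"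
proof -
  have c: "(i, j) \<in> {(0,1),(0,2),(1,0),(1,2),(2,0),(2,1)}"
  proof -
    have "i = 0 \<or> i = 1 \<or> i = 2" "j = 0 \<or> j = 1 \<or> j = 2" using assms(1,2) by linarith+
    then show ?thesis using assms(3) by blast
  qed
  have e: "elementary i j r (k, l) = (if k = l then 1 else if k = i \<and> l = j then r else 0)" if "k < 3" "l < 3" for i j r k l
    using that by (simp add: elementary_def)
  show "det3 (elementary i j r) = 1" using c by (auto simp: det3_def e)
  show "mmul 3 (elementary i j r) (elementary i j (- r)) = mone 3"
    by (rule mats3_eqI) (use c in \<open>auto simp: mmul3_entry e mone_entry\<close>)
  show "tr3 (mmul 3 x (mmul 3 (elementary i j 1) (mmul 3 x (elementary i j (- 1))))) = tr3 (mmul 3 x x) - x (j, i) * x (j, i)"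
    using c by (auto simp: tr3_def mmul3_entry e algebra_simps)
qed

text \<open>
  If $x$ belongs to a normal unipotent subgroup, then so do $x^2$ and $x \cdot e x e^{-1}$, whose traces are
  therefore equal. So $x$ is diagonal, and a diagonal unipotent matrix is 1.
\<close>
lemma unipotent_normal_std:
  assumes U: "U \<subseteq> std" "\<And>u v. u \<in> U \<Longrightarrow> v \<in> U \<Longrightarrow> mmul 9 u v \<in> U"
    and normal: "\<And>g u. g \<in> std \<Longrightarrow> u \<in> U \<Longrightarrow> mmul 9 (mmul 9 g u) (minv 9 g) \<in> U"
    and unip: "\<And>u. u \<in> U \<Longrightarrow> unipotent 9 u" and u: "u \<in> U"
  shows "u = mone 9"
proof -
  obtain x where x: "x \<in> mats 3" "u = tens x (mone 3)" "tr3 x = 3"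
    "minors3 (\<lambda>ij\<in>idx 3. x ij - mone 3 ij) = 0" "det3 (\<lambda>ij\<in>idx 3. x ij - mone 3 ij) = 0"
    by (rule unipotent_std[OF subsetD[OF U(1) u] unip[OF u]])
  have tr: "tr3 z = 3" if zU: "tens z (mone 3) \<in> U" for z
  proof -
    obtain z' where z': "tens z (mone 3) = tens z' (mone 3)" "tr3 z' = 3"
      by (rule unipotent_std[OF subsetD[OF U(1) zU] unip[OF zU]])
    have "z (k, k) = z' (k, k)" if "k < 3" for k
      using arg_cong[OF z'(1), of "\<lambda>g. g (k, k)"] that by (simp add: tens_entry mone_entry)
    then show ?thesis using z'(2) by (simp add: tr3_def)
  qed
  have sq: "tr3 (mmul 3 x x) = 3"
    using U(2)[OF u u] unfolding x(2) tens_mmul by (intro tr) (simp add: mmul_one)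
  have "x (j, i) = 0" if "j < 3" "i < 3" "j \<noteq> i" for i j
  proof -
    note e = elementary_facts[OF that(2,1) that(3)[symmetric]]
    let ?g = "tens (elementary i j 1) (mone 3)" and ?h = "tens (elementary i j (- 1)) (mone 3)"
    have "elementary i j 1 \<in> mats 3" by (simp add: elementary_def)
    then have g: "?g \<in> std" unfolding mone_diag3 by (rule stdI) (simp add: e(1))
    have "mmul 3 (elementary i j (- 1)) (elementary i j 1) = mone 3" using e(2)[of "- 1"] by simp
    then have "minv 9 ?g = ?h"
      by (intro GL_inv_unique(2)) (simp_all add: tens_mmul mmul_one e(2) tens_mone)
    then have "mmul 9 (mmul 9 ?g u) ?h \<in> U" using normal[OF g u] by simp
    then have "mmul 9 u (mmul 9 (mmul 9 ?g u) ?h) \<in> U" by (rule U(2)[OF u])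
    then have "tr3 (mmul 3 x (mmul 3 (mmul 3 (elementary i j 1) x) (elementary i j (- 1)))) = 3"
      unfolding x(2) tens_mmul by (intro tr) (simp add: mmul_one)
    then show ?thesis using e(3)[of x] sq by (simp add: mmul_assoc)
  qed
  then show ?thesis unfolding x(2) by (intro diagonal_unipotent_trivial x) auto
qed

end

section \<open>Monomial matrices\<close>

text \<open>
  The matrix sends the basis vector $e_j$ to $d_j e_{j+n}$, indices modulo 3.
\<close>
definition mono3 :: "nat \<Rightarrow> (nat \<Rightarrow> 'a::comm_ring_1) \<Rightarrow> 'a sqmat"
  where "mono3 n d = (\<lambda>(i, j)\<in>idx 3. if i = (j + n) mod 3 then d j else 0)"

lemma mono3_mats [simp]: "mono3 n d \<in> mats 3" by (simp add: mono3_def)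

lemma mono3_entry: "i < 3 \<Longrightarrow> j < 3 \<Longrightarrow> mono3 n d (i, j) = (if i = (j + n) mod 3 then d j else 0)"
  by (simp add: mono3_def)

lemma diag3_mono3: "diag3 d = mono3 0 d"
  by (rule mats_eqI[of _ 3]) (auto simp: diag3_entry mono3_entry)

lemma mono3_cong: "(\<And>j. j < 3 \<Longrightarrow> d j = e j) \<Longrightarrow> mono3 n d = mono3 n e"
  by (rule mats_eqI[of _ 3]) (auto simp: mono3_entry)

lemma mmul_mono3_right:
  assumes "i < 3" "j < 3" shows "mmul 3 M (mono3 n d) (i, j) = M (i, (j + n) mod 3) * d j"
proof -
  have "mmul 3 M (mono3 n d) (i, j) = (\<Sum>k<3. if k = (j + n) mod 3 then M (i, k) * d j else 0)"
    unfolding mmul_entry[OF assms] by (rule sum.cong) (use assms in \<open>auto simp: mono3_entry\<close>)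
  then show ?thesis by simp
qed

lemma shift3_inj:
  assumes "k < (3::nat)" "l < 3" shows "(k + n) mod 3 = (l + n) mod 3 \<longleftrightarrow> l = k"
proof -
  have "k = 0 \<or> k = 1 \<or> k = 2" "l = 0 \<or> l = 1 \<or> l = 2" "n mod 3 = 0 \<or> n mod 3 = 1 \<or> n mod 3 = 2"
    using assms mod_less_divisor[of 3 n] by linarith+
  then have "(k + n mod 3) mod 3 = (l + n mod 3) mod 3 \<longleftrightarrow> l = k" by auto
  then show ?thesis by (simp only: mod_add_right_eq)
qed

lemma mmul_mono3_left:
  assumes "k < 3" "j < 3" shows "mmul 3 (mono3 n d) M ((k + n) mod 3, j) = d k * M (k, j)"
proof -
  note inj = shift3_inj[OF assms(1)]
  have "mmul 3 (mono3 n d) M ((k + n) mod 3, j) = (\<Sum>l<3. if l = k then d k * M (k, j) else 0)"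
    unfolding mmul_entry[OF mod_less_divisor[OF three(1), of "k + n"] assms(2)]
    by (rule sum.cong) (use inj in \<open>auto simp: mono3_entry\<close>)
  then show ?thesis using assms by simp
qed

lemma mod3_combination: "(a mod 3 + 2 * (b mod 3)) mod 3 = (a + 2 * b) mod (3::nat)"
proof -
  have "(a + 2 * b) mod 3 = (a mod 3 + (2 * b) mod 3) mod 3" by (rule mod_add_eq[symmetric])
  also have "(2 * b) mod 3 = (2 * (b mod 3)) mod 3" by (rule mod_mult_right_eq[symmetric])
  also have "(a mod 3 + (2 * (b mod 3)) mod 3) mod 3 = (a mod 3 + 2 * (b mod 3)) mod 3" by (rule mod_add_right_eq)
  finally show ?thesis ..
qed

lemma shift3_back:
  assumes "j < (3::nat)" shows "((j + n) mod 3 + 2 * n) mod 3 = j"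
proof -
  have "((j + n) mod 3 + 2 * n) mod 3 = (j + n + 2 * n) mod 3" by (rule mod_add_left_eq)
  also have "j + n + 2 * n = j + 3 * n" by simp
  finally show ?thesis using assms by simp
qed

lemma mmul_mono3: "mmul 3 (mono3 n d) (mono3 m e) = mono3 (n + m) (\<lambda>j. d ((j + m) mod 3) * e j)"
proof (rule mats_eqI[of _ 3])
  fix i j :: nat assume ij: "i < 3" "j < 3"
  have "((j + m) mod 3 + n) mod 3 = (j + (n + m)) mod 3" by (simp add: mod_simps add_ac)
  then show "mmul 3 (mono3 n d) (mono3 m e) (i, j) = mono3 (n + m) (\<lambda>j. d ((j + m) mod 3) * e j) (i, j)"
    unfolding mmul_mono3_right[OF ij] using ij by (auto simp: mono3_entry)
qed simp_all

lemma det3_mono3: "n < 3 \<Longrightarrow> det3 (mono3 n d) = d 0 * d 1 * d 2"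
  by (erule less3E) (simp_all add: det3_def mono3_entry)

lemma tens_mono3_eqI:
  assumes "\<And>j l. j < 3 \<Longrightarrow> l < 3 \<Longrightarrow> d j * e l = d' j * e' l"
  shows "tens (mono3 n d) (mono3 m e) = tens (mono3 n d') (mono3 m e')"
  by (rule mats_eqI[of _ 9]) (use assms in \<open>auto simp: tens_entry mono3_entry div3_less\<close>)

lemma sum_shift3: "n < 3 \<Longrightarrow> (\<Sum>j<3. f ((j + n) mod 3)) = (\<Sum>j<3. f (j::nat))"
  by (erule less3E) (simp_all add: sum3 add_ac flip: numeral_2_eq_2)

lemma prod_shift3: "n < 3 \<Longrightarrow> f (n mod 3) * f ((1 + n) mod 3) * f ((2 + n) mod 3) = f (0::nat) * f 1 * (f 2 :: 'a::comm_ring_1)"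
  by (erule less3E) (simp_all add: mult_ac flip: numeral_2_eq_2)

definition diag9 :: "(nat \<Rightarrow> 'a::comm_ring_1) \<Rightarrow> 'a sqmat"
  where "diag9 d = (\<lambda>(i, j)\<in>idx 9. if i = j then d i else 0)"

lemma diag9_mats [simp]: "diag9 d \<in> mats 9" by (simp add: diag9_def)

lemma mmul_diag9:
  assumes "i < 9" "j < 9"
  shows "mmul 9 (diag9 d) M (i, j) = d i * M (i, j)" "mmul 9 M (diag9 d) (i, j) = M (i, j) * d j"
proof -
  have "mmul 9 (diag9 d) M (i, j) = (\<Sum>k<9. if k = i then d i * M (i, j) else 0)"
    unfolding mmul_entry[OF assms] by (rule sum.cong) (use assms in \<open>auto simp: diag9_def\<close>)
  then show "mmul 9 (diag9 d) M (i, j) = d i * M (i, j)" using assms by simp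
  have "mmul 9 M (diag9 d) (i, j) = (\<Sum>k<9. if k = j then M (i, j) * d j else 0)"
    unfolding mmul_entry[OF assms] by (rule sum.cong) (use assms in \<open>auto simp: diag9_def\<close>)
  then show "mmul 9 M (diag9 d) (i, j) = M (i, j) * d j" using assms by simp
qed

lemma diag9_entry: "i < 9 \<Longrightarrow> j < 9 \<Longrightarrow> diag9 d (i, j) = (if i = j then d i else 0)"
  by (simp add: diag9_def)

context base_field
begin

lemma gal_act_tens: "s \<in> Gal \<Longrightarrow> gal_act 9 s (tens x y) = tens (gal_act 3 s x) (gal_act 3 s y)"
  by (rule mats_eqI[of _ 9]) (simp_all add: gal_act_entry tens_entry div3_less GalD(2))

lemma gal_act_mono3: "s \<in> Gal \<Longrightarrow> gal_act 3 s (mono3 n d) = mono3 n (\<lambda>j. s (d j))"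
  by (rule mats_eqI[of _ 3]) (simp_all add: gal_act_entry mono3_entry GalD(3))

lemma gal_act_diag3: "s \<in> Gal \<Longrightarrow> gal_act 3 s (diag3 d) = diag3 (\<lambda>j. s (d j))"
  unfolding diag3_mono3 by (rule gal_act_mono3)

lemma det3_gal_act: "s \<in> Gal \<Longrightarrow> det3 (gal_act 3 s x) = s (det3 x)"
  by (simp add: det3_def gal_act_entry GalD)

text \<open>
  Monomial matrices normalise the diagonal matrices, and conjugation does not change determinants; hence
  twisting by monomial cocycles preserves \<open>std\<close>.
\<close>
lemma conj_tens_std:
  assumes n: "n < 3" and m1: "det3 m1 \<noteq> 0" and e: "e 0 * e 1 * e 2 \<noteq> 0" and g: "g \<in> std"
  shows "conj 9 (tens m1 (mono3 n e)) g \<in> std"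
proof -
  obtain x y where gx: "g = tens x (diag3 y)" "x \<in> mats 3" "det3 x * (y 0 * y 1 * y 2) = 1" using g by (rule stdE)
  have d2: "det3 (mono3 n e) \<noteq> 0" using e by (simp add: det3_mono3 n)
  define y' where "y' = (\<lambda>i. y ((i + 2 * n) mod 3))"
  have y': "y' ((j + n) mod 3) = y j" if "j < 3" for j
    by (simp add: y'_def shift3_back[OF that])
  have "mmul 3 (mono3 n e) (diag3 y) = mmul 3 (diag3 y') (mono3 n e)"
    unfolding diag3_mono3 mmul_mono3 by (simp, intro mono3_cong) (simp add: y' mult.commute)
  then have "mmul 3 (mmul 3 (mono3 n e) (diag3 y)) (inv3 (mono3 n e)) = diag3 y'"
    by (simp add: mmul_assoc mmul_inv3 d2 mmul_one)
  then have eq: "conj 9 (tens m1 (mono3 n e)) g = tens (mmul 3 (mmul 3 m1 x) (inv3 m1)) (diag3 y')"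
    unfolding conj_def tens_GL(2)[OF m1 d2] gx(1) tens_mmul by simp
  have "y' (n mod 3) * y' ((1 + n) mod 3) * y' ((2 + n) mod 3) = y' 0 * y' 1 * y' 2" by (rule prod_shift3[OF n])
  then have "y' 0 * y' 1 * y' 2 = y 0 * y 1 * y 2" using y'[of 0] y'[of 1] y'[of 2] by simp
  moreover have "det3 (mmul 3 (mmul 3 m1 x) (inv3 m1)) = det3 x" by (simp add: det3_mmul det3_inv3 m1)
  ultimately have "det3 (mmul 3 (mmul 3 m1 x) (inv3 m1)) * (y' 0 * y' 1 * y' 2) = 1" by (simp only: gx(3))
  then show ?thesis unfolding eq by (rule stdI[OF mmul_mats])
qed

lemma conj_tens_std_torus:
  assumes n: "n < 3" and d: "d 0 * d 1 * d 2 \<noteq> 0" and e: "e 0 * e 1 * e 2 \<noteq> 0" and g: "g \<in> std_torus"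
  shows "conj 9 (tens (mono3 n d) (mono3 n e)) g \<in> std_torus"
proof -
  obtain x y where gx: "g = tens (diag3 x) (diag3 y)" "x 0 * x 1 * x 2 * (y 0 * y 1 * y 2) = 1" using g by (rule std_torusE)
  have d2: "det3 (mono3 n e) \<noteq> 0" "det3 (mono3 n d) \<noteq> 0" using e d by (simp_all add: det3_mono3 n)
  define sh :: "(nat \<Rightarrow> complex) \<Rightarrow> nat \<Rightarrow> complex" where "sh = (\<lambda>y i. y ((i + 2 * n) mod 3))"
  have sh: "sh y ((j + n) mod 3) = y j" if "j < 3" for j y
    by (simp add: sh_def shift3_back[OF that])
  have mv: "mmul 3 (mmul 3 (mono3 n e) (diag3 y)) (inv3 (mono3 n e)) = diag3 (sh y)" if "det3 (mono3 n e) \<noteq> 0" for e y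
  proof -
    have "mmul 3 (mono3 n e) (diag3 y) = mmul 3 (diag3 (sh y)) (mono3 n e)"
      unfolding diag3_mono3 mmul_mono3 by (simp, intro mono3_cong) (simp add: sh mult.commute)
    then show ?thesis by (simp add: mmul_assoc mmul_inv3 that mmul_one)
  qed
  have eq: "conj 9 (tens (mono3 n d) (mono3 n e)) g = tens (diag3 (sh x)) (diag3 (sh y))"
    unfolding conj_def tens_GL(2)[OF d2(2,1)] gx(1) tens_mmul by (simp add: mv d2)
  have "sh y 0 * sh y 1 * sh y 2 = y 0 * y 1 * y 2" for y
    using prod_shift3[OF n, of "sh y"] sh[of 0 y] sh[of 1 y] sh[of 2 y] by simp
  then have "sh x 0 * sh x 1 * sh x 2 * (sh y 0 * sh y 1 * sh y 2) = 1" by (simp only: gx(2))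
  then show ?thesis unfolding eq by (rule std_torusI)
qed

end

section \<open>The twisted group and its torus\<close>

text \<open>
  The parameters of the symbol algebra are given by their cube roots, on which the Galois group acts
  through cube roots of unity.
\<close>
locale symbol_setup = base_field +
  fixes \<zeta> u v w :: complex
  assumes zeta_K: "\<zeta> \<in> K" and zeta: "1 + \<zeta> + \<zeta> * \<zeta> = 0"
    and nonzero: "u \<noteq> 0" "v \<noteq> 0" "w \<noteq> 0"
    and cubes_K: "u ^ 3 \<in> K" "v ^ 3 \<in> K" "w ^ 3 \<in> K"
    and not_norm: "no_norm (u ^ 3) (v ^ 3) (w ^ 3) \<zeta> K"
begin

lemma zeta_facts: "\<zeta> ^ 3 = 1" "\<zeta> \<noteq> 1" "\<zeta> * \<zeta> \<noteq> 1" "\<zeta> * \<zeta> \<noteq> \<zeta>" "\<zeta> \<noteq> 0"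
proof -
  have "\<zeta> ^ 3 - 1 = (\<zeta> - 1) * (1 + \<zeta> + \<zeta> * \<zeta>)" by (simp add: algebra_simps power3_eq_cube)
  then show c: "\<zeta> ^ 3 = 1" unfolding zeta by simp
  show n1: "\<zeta> \<noteq> 1" using zeta by auto
  show n0: "\<zeta> \<noteq> 0" using zeta by auto
  then show "\<zeta> * \<zeta> \<noteq> \<zeta>" using n1 by simp
  show "\<zeta> * \<zeta> \<noteq> 1"
  proof
    assume z: "\<zeta> * \<zeta> = 1"
    have "\<zeta> + 2 = 1 + \<zeta> + \<zeta> * \<zeta>" unfolding z by simp
    then have "\<zeta> = - 2" by (simp add: eq_neg_iff_add_eq_0 zeta)
    then show False using z by simp
  qed
qed

lemma cube_root_cases:
  assumes "z ^ 3 = 1" obtains "z = 1" | "z = \<zeta>" | "z = \<zeta> * \<zeta>"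
proof -
  have "(z - 1) * (z - \<zeta>) * (z - \<zeta> * \<zeta>) = z ^ 3 - z * z * (1 + \<zeta> + \<zeta> * \<zeta>) + z * (\<zeta> * (1 + \<zeta> + \<zeta> * \<zeta>)) + z * (\<zeta> ^ 3 - \<zeta> * \<zeta>) + z * \<zeta> * \<zeta> - z * \<zeta> ^ 3  - \<zeta> ^ 3"
    by (simp add: algebra_simps power3_eq_cube)
  then have "(z - 1) * (z - \<zeta>) * (z - \<zeta> * \<zeta>) = 0" unfolding zeta assms zeta_facts(1) by (simp add: algebra_simps)
  then show thesis using that by auto
qed

text \<open>
  The logarithm to the base \<open>\<zeta>\<close> on cube roots of unity.
\<close>
definition dlog :: "complex \<Rightarrow> nat"
  where "dlog z = (if z = 1 then 0 else if z = \<zeta> then 1 else 2)"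

lemma dlog_less: "dlog z < 3" by (simp add: dlog_def)

lemma zeta_pow_dlog: "z ^ 3 = 1 \<Longrightarrow> \<zeta> ^ dlog z = z"
  by (erule cube_root_cases) (use zeta_facts in \<open>simp_all add: dlog_def power2_eq_square\<close>)

lemma cube_root_pow_mod: "(z::complex) ^ 3 = 1 \<Longrightarrow> z ^ (n mod 3) = z ^ n"
  by (metis mult_1_left mult_div_mod_eq power_add power_mult power_one)

lemma cube_root_K: assumes "z ^ 3 = 1" shows "z \<in> K"
  using zeta_pow_dlog[OF assms] is_subfieldD(9)[OF subfield zeta_K] by metis

lemma cube_root_inverse: "(z::complex) ^ 3 = 1 \<Longrightarrow> inverse z ^ 3 = 1" by (simp add: power_inverse)

lemma cube_root_nz: "(z::complex) ^ 3 = 1 \<Longrightarrow> z \<noteq> 0" by auto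

text \<open>
  For $t^3 \in K$, the Kummer character of $t^3$.
\<close>
definition chi :: "complex \<Rightarrow> (complex \<Rightarrow> complex) \<Rightarrow> complex"
  where "chi t s = s t / t"

lemma chi:
  assumes "t ^ 3 \<in> K" "t \<noteq> 0" "s \<in> Gal"
  shows "chi t s ^ 3 = 1" "s t = chi t s * t"
proof -
  have "s t ^ 3 = t ^ 3" using GalD(9)[OF assms(3), of t 3] GalD(10)[OF assms(3,1)] by simp
  then show "chi t s ^ 3 = 1" using assms(2) by (simp add: chi_def power_divide)
  show "s t = chi t s * t" using assms(2) by (simp add: chi_def)
qed

lemma chi_mult:
  assumes "t ^ 3 \<in> K" "t \<noteq> 0" "s \<in> Gal" "s' \<in> Gal"
  shows "chi t (s \<circ> s') = chi t s * chi t s'"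
proof -
  have "s (chi t s') = chi t s'" by (intro GalD(10)[OF assms(3)] cube_root_K chi(1) assms)
  then have "(s \<circ> s') t = chi t s' * (chi t s * t)"
    using chi(2)[OF assms(1,2,3)] chi(2)[OF assms(1,2,4)] GalD(2)[OF assms(3)] by simp
  then show ?thesis using assms(2) by (simp add: chi_def[of t "s \<circ> s'"])
qed

lemmas chi_u = chi[OF cubes_K(1) nonzero(1)]
lemmas chi_v = chi[OF cubes_K(2) nonzero(2)]
lemmas chi_w = chi[OF cubes_K(3) nonzero(3)]

text \<open>
  The cocycle that defines the twisted form: on the first factor it is a cocycle of the symbol algebra (up to
  passing to the opposite algebra), on the second factor a cyclic permutation of the coordinates through the
  Galois group of $K(u)$, up to a diagonal matrix, which acts trivially on diagonal ones. It is
  the coboundary of \<open>frame\<close>; the scalars that prevent each factor from being a cocycle in \<open>GL\<^sub>3\<close> cancel in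
  the tensor product.
\<close>
definition twist :: "(complex \<Rightarrow> complex) \<Rightarrow> complex sqmat"
  where "twist s = tens (mono3 (dlog (chi u s)) (\<lambda>j. chi v s ^ j)) (mono3 (dlog (chi u s)) (\<lambda>j. inverse (chi v s) ^ j))"

text \<open>
  The columns of this Vandermonde matrix belong to the conjugates \<open>u \<zeta>\<^sup>j\<close>, which the Galois group
  permutes cyclically.
\<close>
definition vdm :: "complex sqmat" where "vdm = (\<lambda>(i, j)\<in>idx 3. (u * \<zeta> ^ j) ^ i)"

text \<open>
  The exponent is \<open>i mod 3 - i div 3\<close> modulo 3. It is unchanged when the same cyclic shift is applied to
  both tensor factors, so the diagonal matrix commutes with the permutation part of \<open>twist\<close>.
\<close>
definition vdiag :: "nat \<Rightarrow> complex" where "vdiag i = v ^ ((i mod 3 + 2 * (i div 3)) mod 3)"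

text \<open>
  A base change that trivialises the twisted form over the algebraic closure: the twisted groups are realised as
  conjugates of \<open>std\<close> and \<open>std_torus\<close> inside \<open>GL\<^sub>9\<close>, with the standard Galois action on entries.
\<close>
definition frame :: "complex sqmat" where "frame = mmul 9 (tens vdm vdm) (diag9 vdiag)"

lemma vdm_mats [simp]: "vdm \<in> mats 3" by (simp add: vdm_def)

lemma det3_vdm: "det3 vdm \<noteq> 0"
proof -
  have "det3 vdm = u ^ 3 * (\<zeta> * \<zeta> ^ 4 - \<zeta> ^ 2 * \<zeta> ^ 2 - (\<zeta> ^ 4 - \<zeta> ^ 2) + (\<zeta> ^ 2 - \<zeta>))"
    by (simp add: det3_def vdm_def algebra_simps eval_nat_numeral)
  also have "\<zeta> ^ 4 = \<zeta>" using zeta_facts(1) by (simp add: eval_nat_numeral)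
  also have "\<zeta> * \<zeta> - \<zeta> ^ 2 * \<zeta> ^ 2 - (\<zeta> - \<zeta> ^ 2) + (\<zeta> ^ 2 - \<zeta>) = 3 * (\<zeta> * \<zeta> - \<zeta>)"
    using \<open>\<zeta> ^ 4 = \<zeta>\<close> by (simp add: power2_eq_square eval_nat_numeral)
  finally show ?thesis using nonzero(1) zeta_facts(4) by simp
qed

lemma frame_GL: "frame \<in> GLc 9"
proof -
  have "vdiag i \<noteq> 0" for i using nonzero(2) by (simp add: vdiag_def)
  then have "mmul 9 (diag9 vdiag) (diag9 (\<lambda>i. inverse (vdiag i))) = mone 9" "mmul 9 (diag9 (\<lambda>i. inverse (vdiag i))) (diag9 vdiag) = mone 9"
    by (intro mats_eqI[of _ 9]; simp add: mmul_diag9 diag9_entry mone_entry)+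
  then have "diag9 vdiag \<in> GLc 9" by (intro GL_inv_unique(1)) simp_all
  then show ?thesis unfolding frame_def by (intro GL_closed tens_GL det3_vdm)
qed

lemma gal_act_frame:
  assumes s: "s \<in> Gal" shows "gal_act 9 s frame = mmul 9 frame (twist s)"
proof -
  let ?n = "dlog (chi u s)" and ?z = "chi v s"
  let ?S = "tens (mono3 ?n (\<lambda>_. 1)) (mono3 ?n (\<lambda>_. 1)) :: complex sqmat"
  let ?D = "tens (mono3 0 (\<lambda>j. ?z ^ j)) (mono3 0 (\<lambda>j. inverse ?z ^ j))"
  have z3: "?z ^ 3 = 1" by (rule chi_v(1)[OF s])
  have 1: "gal_act 3 s vdm = mmul 3 vdm (mono3 ?n (\<lambda>_. 1))"
  proof (rule mats_eqI[of _ 3])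
    fix i j :: nat assume ij: "i < 3" "j < 3"
    have "\<zeta> ^ ((j + ?n) mod 3) = \<zeta> ^ j * chi u s"
      unfolding cube_root_pow_mod[OF zeta_facts(1)] power_add zeta_pow_dlog[OF chi_u(1)[OF s]] ..
    moreover have "s (u * \<zeta> ^ j) = u * (\<zeta> ^ j * chi u s)"
      using chi_u(2)[OF s] GalD(10)[OF s zeta_K] by (simp add: GalD(2,9)[OF s])
    moreover have "mmul 3 vdm (mono3 ?n (\<lambda>_. 1)) (i, j) = (u * \<zeta> ^ ((j + ?n) mod 3)) ^ i"
      unfolding mmul_mono3_right[OF ij] using ij by (simp add: vdm_def)
    moreover have "gal_act 3 s vdm (i, j) = s (u * \<zeta> ^ j) ^ i"
      using ij by (simp add: gal_act_entry vdm_def GalD(9)[OF s])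
    ultimately show "gal_act 3 s vdm (i, j) = mmul 3 vdm (mono3 ?n (\<lambda>_. 1)) (i, j)" by simp
  qed simp_all
  have 2: "gal_act 9 s (diag9 vdiag) = mmul 9 (diag9 vdiag) ?D"
  proof (rule mats_eqI[of _ 9])
    fix i j :: nat assume ij: "i < 9" "j < 9"
    have iz: "inverse ?z = ?z ^ 2" using z3 by (intro inverse_unique) (simp add: eval_nat_numeral)
    have "s (vdiag i) = ?z ^ (i mod 3 + 2 * (i div 3)) * vdiag i"
      unfolding vdiag_def GalD(9)[OF s] chi_v(2)[OF s] power_mult_distrib cube_root_pow_mod[OF z3] ..
    also have "?z ^ (i mod 3 + 2 * (i div 3)) = ?z ^ (i mod 3) * inverse ?z ^ (i div 3)"
      unfolding iz power_add power_mult ..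
    finally have "s (vdiag i) = vdiag i * (?z ^ (i mod 3) * inverse ?z ^ (i div 3))" by simp
    then show "gal_act 9 s (diag9 vdiag) (i, j) = mmul 9 (diag9 vdiag) ?D (i, j)"
      using ij div3_less eq_iff_div_mod3[of i j]
      by (auto simp: gal_act_entry diag9_entry mmul_diag9 tens_entry mono3_entry GalD(3)[OF s])
  qed simp_all
  have 3: "mmul 9 ?S (diag9 vdiag) = mmul 9 (diag9 vdiag) ?S"
  proof (rule mats_eqI[of _ 9])
    fix i j :: nat assume ij: "i < 9" "j < 9"
    have "vdiag i = vdiag j" if "i mod 3 = (j mod 3 + ?n) mod 3" "i div 3 = (j div 3 + ?n) mod 3"
    proof -
      have "(i mod 3 + 2 * (i div 3)) mod 3 = (j mod 3 + ?n + 2 * (j div 3 + ?n)) mod 3"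
        unfolding that by (rule mod3_combination)
      also have "j mod 3 + ?n + 2 * (j div 3 + ?n) = j mod 3 + 2 * (j div 3) + 3 * ?n" by simp
      finally have "(i mod 3 + 2 * (i div 3)) mod 3 = (j mod 3 + 2 * (j div 3)) mod 3" by simp
      then show ?thesis by (simp add: vdiag_def)
    qed
    then show "mmul 9 ?S (diag9 vdiag) (i, j) = mmul 9 (diag9 vdiag) ?S (i, j)"
      using ij by (auto simp: mmul_diag9 tens_entry mono3_entry div3_less)
  qed simp_all
  have 4: "mmul 9 ?S ?D = twist s"
    unfolding tens_mmul mmul_mono3 twist_def by simp
  have "gal_act 9 s frame = mmul 9 (tens (mmul 3 vdm (mono3 ?n (\<lambda>_. 1))) (mmul 3 vdm (mono3 ?n (\<lambda>_. 1)))) (mmul 9 (diag9 vdiag) ?D)"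
    unfolding frame_def gal_act_mmul[OF s] gal_act_tens[OF s] 1 2 ..
  also have "\<dots> = mmul 9 (tens vdm vdm) (mmul 9 (mmul 9 ?S (diag9 vdiag)) ?D)"
    unfolding tens_mmul[symmetric] mmul_assoc ..
  also have "\<dots> = mmul 9 frame (twist s)"
    unfolding 3 frame_def 4[symmetric] mmul_assoc ..
  finally show ?thesis .
qed

lemma twist_nz:
  assumes "s \<in> Gal"
  shows "chi v s ^ 0 * chi v s ^ 1 * chi v s ^ 2 \<noteq> 0" "inverse (chi v s) ^ 0 * inverse (chi v s) ^ 1 * inverse (chi v s) ^ 2 \<noteq> 0"
  using cube_root_nz[OF chi_v(1)[OF assms]] by simp_all

lemma twist_GL: assumes "s \<in> Gal" shows "twist s \<in> GLc 9"
  unfolding twist_def by (intro tens_GL) (use twist_nz[OF assms] in \<open>simp_all only: det3_mono3[OF dlog_less] not_False_eq_True\<close>)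

lemma gal_act_conj_frame:
  assumes s: "s \<in> Gal" and g: "g \<in> GLc 9"
  shows "gal_act 9 s (conj 9 frame g) = conj 9 frame (conj 9 (twist s) (gal_act 9 s g))"
proof -
  have "gal_act 9 s (conj 9 frame g) = mmul 9 (mmul 9 (mmul 9 frame (twist s)) (gal_act 9 s g)) (mmul 9 (minv 9 (twist s)) (minv 9 frame))"
    unfolding conj_def gal_act_mmul[OF s] gal_act_frame[OF s] gal_act_GL(2)[OF s frame_GL, symmetric]
      GL_closed(7)[OF frame_GL twist_GL[OF s]] ..
  then show ?thesis unfolding conj_def by (simp add: mmul_assoc)
qed

lemma gal_act_std: "s \<in> Gal \<Longrightarrow> g \<in> std \<Longrightarrow> gal_act 9 s g \<in> std"
proof (elim stdE)
  fix x y assume s: "s \<in> Gal" and *: "g = tens x (diag3 y)" "det3 x * (y 0 * y 1 * y 2) = 1"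
  have "s (det3 x * (y 0 * y 1 * y 2)) = 1" unfolding *(2) by (rule GalD(4)[OF s])
  then show ?thesis unfolding *(1) gal_act_tens[OF s] gal_act_diag3[OF s]
    by (intro stdI) (simp_all add: det3_gal_act[OF s] GalD(2)[OF s])
qed

lemma gal_act_std_torus: "s \<in> Gal \<Longrightarrow> g \<in> std_torus \<Longrightarrow> gal_act 9 s g \<in> std_torus"
proof (elim std_torusE)
  fix x y assume s: "s \<in> Gal" and *: "g = tens (diag3 x) (diag3 y)" "x 0 * x 1 * x 2 * (y 0 * y 1 * y 2) = 1"
  have "s (x 0 * x 1 * x 2 * (y 0 * y 1 * y 2)) = 1" unfolding *(2) by (rule GalD(4)[OF s])
  then show ?thesis unfolding *(1) gal_act_tens[OF s] gal_act_diag3[OF s]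
    by (intro std_torusI) (simp add: GalD(2)[OF s])
qed

definition G :: "complex lin_group" where "G = \<lparr>deg = 9, points = conj 9 frame ` std\<rparr>"
definition T :: "complex lin_group" where "T = \<lparr>deg = 9, points = conj 9 frame ` std_torus\<rparr>"

lemma G_simps [simp]: "deg G = 9" "points G = conj 9 frame ` std" by (simp_all add: G_def)
lemma T_simps [simp]: "deg T = 9" "points T = conj 9 frame ` std_torus" by (simp_all add: T_def)

lemma std_torus_GL: "std_torus \<subseteq> GLc 9" using std_torus_subset std_GL by blast

lemma G_stable: "s \<in> Gal \<Longrightarrow> g \<in> points G \<Longrightarrow> gal_act 9 s g \<in> points G"
proof -
  assume s: "s \<in> Gal" and "g \<in> points G"
  then obtain h where h: "g = conj 9 frame h" "h \<in> std" by auto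
  have "conj 9 (twist s) (gal_act 9 s h) \<in> std"
    unfolding twist_def by (rule conj_tens_std[OF dlog_less])
      (use twist_nz[OF s] gal_act_std[OF s h(2)] in \<open>simp_all only: det3_mono3[OF dlog_less] not_False_eq_True\<close>)
  then show ?thesis unfolding h(1) gal_act_conj_frame[OF s subsetD[OF std_GL h(2)]] by simp
qed

lemma T_stable: "s \<in> Gal \<Longrightarrow> g \<in> points T \<Longrightarrow> gal_act 9 s g \<in> points T"
proof -
  assume s: "s \<in> Gal" and "g \<in> points T"
  then obtain h where h: "g = conj 9 frame h" "h \<in> std_torus" by auto
  have "conj 9 (twist s) (gal_act 9 s h) \<in> std_torus"
    unfolding twist_def by (rule conj_tens_std_torus[OF dlog_less])
      (use twist_nz[OF s] gal_act_std_torus[OF s h(2)] in \<open>simp_all only: not_False_eq_True\<close>)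
  then show ?thesis unfolding h(1) gal_act_conj_frame[OF s subsetD[OF std_torus_GL h(2)]] by simp
qed

lemma subgroup_conj_frame:
  assumes H: "H \<subseteq> GLc 9" "mone 9 \<in> H" "\<And>g h. g \<in> H \<Longrightarrow> h \<in> H \<Longrightarrow> mmul 9 g h \<in> H" "\<And>g. g \<in> H \<Longrightarrow> minv 9 g \<in> H"
  shows "subgroup (conj 9 frame ` H) (GL 9)"
proof -
  interpret GG: group "GL 9" by (rule GL_group)
  show ?thesis
  proof (rule GG.subgroupI)
    show "conj 9 frame ` H \<subseteq> GLc 9" using H(1) conj_GL[OF frame_GL] by blast
    show "conj 9 frame ` H \<noteq> {}" using H(2) by blast
    show "minv 9 g \<in> conj 9 frame ` H" if "g \<in> conj 9 frame ` H" for g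
    proof -
      obtain h where h: "g = conj 9 frame h" "h \<in> H" using \<open>g \<in> conj 9 frame ` H\<close> by blast
      then have "minv 9 g = conj 9 frame (minv 9 h)" using H(1) minv_conj[OF frame_GL] by blast
      then show ?thesis using H(4)[OF h(2)] by blast
    qed
    show "g \<otimes>\<^bsub>GL 9\<^esub> h \<in> conj 9 frame ` H" if gh: "g \<in> conj 9 frame ` H" "h \<in> conj 9 frame ` H" for g h
    proof -
      obtain g' h' where h: "g = conj 9 frame g'" "g' \<in> H" "h = conj 9 frame h'" "h' \<in> H" using gh by blast
      have "g \<otimes>\<^bsub>GL 9\<^esub> h = conj 9 frame (mmul 9 g' h')"
        unfolding h GL_simps by (rule conj_mult[OF frame_GL GL_mats[OF subsetD[OF H(1) h(4)]]])
      then show ?thesis using H(3)[OF h(2,4)] by blast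
    qed
  qed
qed

lemma subgroup_G: "subgroup (points G) (GL 9)"
  unfolding G_simps by (intro subgroup_conj_frame std_GL std_one std_mult std_inv)

lemma subgroup_T: "subgroup (points T) (GL 9)"
  unfolding T_simps by (intro subgroup_conj_frame std_torus_GL std_torus_one std_torus_mult std_torus_inv)

lemma G_GL: "points G \<subseteq> GLc 9" using subgroup.subset[OF subgroup_G] .
lemma T_GL: "points T \<subseteq> GLc 9" using subgroup.subset[OF subgroup_T] .

lemma K_group_G: "K_group G"
  unfolding K_group_def algebraic_group_def
  using subgroup_G zariski_closed_conj[OF frame_GL zariski_closed_std] defined_over_base_if_stable[OF G_GL G_stable] by simp

lemma K_group_T: "K_group T"
  unfolding K_group_def algebraic_group_def
  using subgroup_T zariski_closed_conj[OF frame_GL zariski_closed_std_torus] defined_over_base_if_stable[OF T_GL T_stable] by simp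

text \<open>
  Having no normal unipotent subgroup is transported along the conjugation by \<open>frame\<close>.
\<close>
lemma unipotent_normal_trivial:
  assumes H: "H \<subseteq> GLc 9" "subgroup (conj 9 frame ` H) (GL 9)"
    and triv: "\<And>U. U \<subseteq> H \<Longrightarrow> (\<And>u v. u \<in> U \<Longrightarrow> v \<in> U \<Longrightarrow> mmul 9 u v \<in> U) \<Longrightarrow>
      (\<And>g u. g \<in> H \<Longrightarrow> u \<in> U \<Longrightarrow> mmul 9 (mmul 9 g u) (minv 9 g) \<in> U) \<Longrightarrow> (\<And>u. u \<in> U \<Longrightarrow> unipotent 9 u) \<Longrightarrow> U \<subseteq> {mone 9}"
    and U: "U \<lhd> (GL 9)\<lparr>carrier := conj 9 frame ` H\<rparr>" and unip: "\<forall>g\<in>U. unipotent 9 g"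
  shows "U = {mone 9}"
proof -
  let ?GH = "(GL 9)\<lparr>carrier := conj 9 frame ` H\<rparr>"
  interpret GG: group "GL 9" by (rule GL_group)
  interpret N: normal U ?GH by (rule U)
  define V where "V = {h \<in> H. conj 9 frame h \<in> U}"
  have UH: "U \<subseteq> conj 9 frame ` H" using N.subset by simp
  have m: "h \<in> mats 9" if "h \<in> H" for h using H(1) that GL_mats by blast
  have H1: "mmul 9 g h \<in> H \<and> minv 9 g \<in> H" if gh: "g \<in> H" "h \<in> H" for g h
  proof -
    have "conj 9 frame g \<otimes>\<^bsub>GL 9\<^esub> conj 9 frame h \<in> conj 9 frame ` H"
      by (intro subgroup.m_closed[OF H(2)] imageI gh)
    then have "conj 9 frame (mmul 9 g h) \<in> conj 9 frame ` H"
      using conj_mult[OF frame_GL m[OF gh(2)]] by simp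
    then have "conj 9 (minv 9 frame) (conj 9 frame (mmul 9 g h)) \<in> H"
      using conj_inverse[OF frame_GL m] by auto
    moreover have "minv 9 (conj 9 frame g) \<in> conj 9 frame ` H"
      by (intro subgroup.m_inv_closed[OF H(2)] imageI gh)
    then have "conj 9 frame (minv 9 g) \<in> conj 9 frame ` H"
      using minv_conj[OF frame_GL subsetD[OF H(1) gh(1)]] by simp
    then have "conj 9 (minv 9 frame) (conj 9 frame (minv 9 g)) \<in> H"
      using conj_inverse[OF frame_GL m] by auto
    ultimately show ?thesis
      using conj_inverse[OF frame_GL] GL_mats[OF GL_closed(3)[OF subsetD[OF H(1) gh(1)]]] by simp
  qed
  have "V \<subseteq> {mone 9}"
  proof (rule triv)
    show "V \<subseteq> H" by (auto simp: V_def)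
    show "mmul 9 a b \<in> V" if "a \<in> V" "b \<in> V" for a b
    proof -
      have "conj 9 frame a \<otimes>\<^bsub>?GH\<^esub> conj 9 frame b \<in> U" by (rule subgroup.m_closed[OF normal_imp_subgroup[OF U]]) (use that in \<open>auto simp: V_def\<close>)
      then show ?thesis using that H1 m conj_mult[OF frame_GL, of b a] by (simp add: V_def)
    qed
    show "mmul 9 (mmul 9 g a) (minv 9 g) \<in> V" if g: "g \<in> H" and a: "a \<in> V" for g a
    proof -
      have aH: "a \<in> H" using a by (simp add: V_def)
      have "conj 9 frame g \<otimes>\<^bsub>?GH\<^esub> conj 9 frame a \<otimes>\<^bsub>?GH\<^esub> inv\<^bsub>?GH\<^esub> (conj 9 frame g) \<in> U"
        by (rule N.inv_op_closed2) (use g a in \<open>auto simp: V_def\<close>)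
      moreover have "inv\<^bsub>?GH\<^esub> (conj 9 frame g) = minv 9 (conj 9 frame g)"
        by (rule GG.m_inv_consistent[OF H(2)]) (use g in simp)
      ultimately have "mmul 9 (mmul 9 (conj 9 frame g) (conj 9 frame a)) (conj 9 frame (minv 9 g)) \<in> U"
        using minv_conj[OF frame_GL subsetD[OF H(1) g]] by simp
      then have "conj 9 frame (mmul 9 (mmul 9 g a) (minv 9 g)) \<in> U"
        using conj_mult[OF frame_GL m[OF aH], of g] conj_mult[OF frame_GL m[OF conjunct2[OF H1[OF g g]]], of "mmul 9 g a"] by simp
      then show ?thesis using H1 g aH by (simp add: V_def)
    qed
    show "unipotent 9 a" if "a \<in> V" for a
      by (rule unipotent_conj[OF frame_GL]) (use that m unip in \<open>auto simp: V_def\<close>)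
  qed
  then have "U \<subseteq> {mone 9}" using UH conj_one[OF frame_GL] by (auto simp: V_def)
  moreover have "mone 9 \<in> U" using subgroup.one_closed[OF normal_imp_subgroup[OF U]] by simp
  ultimately show ?thesis by blast
qed

lemma reductive_G: "reductive G"
  unfolding reductive_def
proof (intro conjI allI impI)
  show "K_group G" by (rule K_group_G)
  show "zariski_connected (deg G) (points G)"
    using zariski_connected_conj[OF frame_GL std_GL zariski_connected_std] by simp
  fix U assume U: "U \<lhd> grp G \<and> zariski_closed (deg G) U \<and> zariski_connected (deg G) U \<and> (\<forall>g\<in>U. unipotent (deg G) g)"
  have "U = {mone 9}"
  proof (rule unipotent_normal_trivial[OF std_GL])
    show "subgroup (conj 9 frame ` std) (GL 9)" using subgroup_G by simp
    show "V \<subseteq> {mone 9}" if "V \<subseteq> std" "\<And>u v. u \<in> V \<Longrightarrow> v \<in> V \<Longrightarrow> mmul 9 u v \<in> V"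
      "\<And>g u. g \<in> std \<Longrightarrow> u \<in> V \<Longrightarrow> mmul 9 (mmul 9 g u) (minv 9 g) \<in> V" "\<And>u. u \<in> V \<Longrightarrow> unipotent 9 u" for V
      using unipotent_normal_std[OF that] by blast
  qed (use U in simp_all)
  then show "U = {\<one>\<^bsub>GL (deg G)\<^esub>}" by simp
qed

lemma reductive_T: "reductive T"
  unfolding reductive_def
proof (intro conjI allI impI)
  show "K_group T" by (rule K_group_T)
  show "zariski_connected (deg T) (points T)"
    using zariski_connected_conj[OF frame_GL std_torus_GL zariski_connected_std_torus] by simp
  fix U assume U: "U \<lhd> grp T \<and> zariski_closed (deg T) U \<and> zariski_connected (deg T) U \<and> (\<forall>g\<in>U. unipotent (deg T) g)"
  have "U = {mone 9}"
  proof (rule unipotent_normal_trivial[OF std_torus_GL])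
    show "subgroup (conj 9 frame ` std_torus) (GL 9)" using subgroup_T by simp
    show "V \<subseteq> {mone 9}" if "V \<subseteq> std_torus" "\<And>u. u \<in> V \<Longrightarrow> unipotent 9 u" for V
      using unipotent_std_torus that by blast
  qed (use U in simp_all)
  then show "U = {\<one>\<^bsub>GL (deg T)\<^esub>}" by simp
qed

subsection \<open>Splitting the torus over the algebraic closure\<close>

definition diag4 :: "(nat \<Rightarrow> complex) \<Rightarrow> complex sqmat"
  where "diag4 d = (\<lambda>(i, j)\<in>idx 4. if i = j then d i else 0)"

lemma diag4_mats [simp]: "diag4 d \<in> mats 4" by (simp add: diag4_def)

lemma diag4_entry: "i < 4 \<Longrightarrow> j < 4 \<Longrightarrow> diag4 d (i, j) = (if i = j then d i else 0)"
  by (simp add: diag4_def)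

lemma diag4_cong: "(\<And>i. i < 4 \<Longrightarrow> d i = e i) \<Longrightarrow> diag4 d = diag4 e"
  by (rule mats_eqI[of _ 4]) (auto simp: diag4_entry)

lemma mmul_diag4: "mmul 4 (diag4 d) (diag4 e) = diag4 (\<lambda>i. d i * e i)"
proof (rule mats_eqI[of _ 4])
  fix i j :: nat assume ij: "i < 4" "j < 4"
  have "mmul 4 (diag4 d) (diag4 e) (i, j) = (\<Sum>k<4. if k = i then d i * diag4 e (i, j) else 0)"
    unfolding mmul_entry[OF ij] by (rule sum.cong) (use ij in \<open>auto simp: diag4_entry\<close>)
  then show "mmul 4 (diag4 d) (diag4 e) (i, j) = diag4 (\<lambda>i. d i * e i) (i, j)" using ij by (simp add: diag4_entry)
qed simp_all

lemma diag4_GL: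
  assumes "\<And>i. i < 4 \<Longrightarrow> d i \<noteq> 0"
  shows "diag4 d \<in> GLc 4" "minv 4 (diag4 d) = diag4 (\<lambda>i. inverse (d i))"
proof -
  have one: "mone 4 = diag4 (\<lambda>_. 1)" by (rule mats_eqI[of _ 4]) (simp_all add: diag4_entry mone_entry)
  have "mmul 4 (diag4 d) (diag4 (\<lambda>i. inverse (d i))) = mone 4" "mmul 4 (diag4 (\<lambda>i. inverse (d i))) (diag4 d) = mone 4"
    unfolding mmul_diag4 one by (rule diag4_cong; use assms in simp)+
  then show "diag4 d \<in> GLc 4" "minv 4 (diag4 d) = diag4 (\<lambda>i. inverse (d i))"
    using GL_inv_unique[OF diag4_mats diag4_mats] by blast+
qed

lemma points_diag_group: "points (diag_group 4) = {diag4 d | d. \<forall>i<4. d i \<noteq> 0}"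
proof (intro equalityI subsetI)
  fix g assume "g \<in> points (diag_group 4)"
  then have gm: "g \<in> GLc 4 \<and> (\<forall>(i, j)\<in>idx 4. i \<noteq> j \<longrightarrow> g (i, j) = 0)" by (simp add: diag_group_def)
  then have g: "g \<in> GLc 4" by blast
  have off: "g (i, j) = 0" if "i < 4" "j < 4" "i \<noteq> j" for i j
    using bspec[OF conjunct2[OF gm], of "(i, j)"] that by simp
  have eq: "g = diag4 (\<lambda>i. g (i, i))"
    by (rule mats_eqI[OF GL_mats[OF g]]) (use off in \<open>auto simp: diag4_entry\<close>)
  have "g (i, i) \<noteq> 0" if i: "i < 4" for i
  proof
    assume z: "g (i, i) = 0"
    have "mmul 4 g (minv 4 g) (i, i) = 0"
      unfolding mmul_entry[OF i i]
    proof (rule sum.neutral, rule ballI)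
      fix k :: nat assume "k \<in> {..<4}"
      then have "g (i, k) = 0" using off[OF i] z by (cases "i = k") auto
      then show "g (i, k) * minv 4 g (k, i) = 0" by simp
    qed
    then show False unfolding GL_closed(4)[OF g] using i by (simp add: mone_entry)
  qed
  then show "g \<in> {diag4 d | d. \<forall>i<4. d i \<noteq> 0}" using eq by blast
next
  fix g assume "g \<in> {diag4 d | d. \<forall>i<4. d i \<noteq> 0}"
  then show "g \<in> points (diag_group 4)"
    using diag4_GL(1) by (auto simp: diag_group_def diag4_entry)
qed

text \<open>
  Four characters of the torus that separate its elements, with inverse \<open>of_coords\<close>; up to the choice of
  coordinates they are those of \<open>std_chart\<close>.
\<close>
definition coords :: "complex sqmat \<Rightarrow> nat \<Rightarrow> complex"
  where "coords h i = (if i < 3 then h (i, i) else h (3, 3) * inverse (h (0, 0)))"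

definition of_coords :: "(nat \<Rightarrow> complex) \<Rightarrow> complex sqmat"
  where "of_coords d = tens (diag3 d) (diag3 (\<lambda>i. if i = 0 then 1 else if i = 1 then d 3 else inverse (d 3) * (inverse (d 0) * inverse (d 1) * inverse (d 2))))"

lemma coords_tens:
  assumes "x 0 * x 1 * x 2 * (y 0 * y 1 * y 2) = 1"
  shows "coords (tens (diag3 x) (diag3 y)) i = (if i < 3 then x i * y 0 else y 1 / y 0)"
  using assms by (auto simp: coords_def tens_entry diag3_entry field_simps)

lemma coords_nz: "h \<in> std_torus \<Longrightarrow> i < 4 \<Longrightarrow> coords h i \<noteq> 0"
proof (elim std_torusE)
  fix x y assume i: "i < 4" and *: "h = tens (diag3 x) (diag3 y)" "x 0 * x 1 * x 2 * (y 0 * y 1 * y 2) = 1"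
  have nz: "x 0 \<noteq> 0" "x 1 \<noteq> 0" "x 2 \<noteq> 0" "y 0 \<noteq> 0" "y 1 \<noteq> 0" using *(2) by auto
  have "x i \<noteq> 0" if "i < 3" using less3E[OF that, of "\<lambda>i. x i \<noteq> 0"] nz by blast
  then show ?thesis using nz unfolding *(1) coords_tens[OF *(2)] by simp
qed

lemma of_coords_std: "(\<And>i. i < 4 \<Longrightarrow> d i \<noteq> 0) \<Longrightarrow> of_coords d \<in> std_torus"
proof -
  assume nz: "\<And>i. i < 4 \<Longrightarrow> d i \<noteq> 0"
  have "d 0 \<noteq> 0" "d 1 \<noteq> 0" "d 2 \<noteq> 0" "d 3 \<noteq> 0" by (rule nz; simp)+
  then show ?thesis unfolding of_coords_def by (intro std_torusI) (simp add: field_simps)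
qed

lemma of_coords_coords: "h \<in> std_torus \<Longrightarrow> of_coords (coords h) = h"
proof (elim std_torusE)
  fix x y assume *: "h = tens (diag3 x) (diag3 y)" "x 0 * x 1 * x 2 * (y 0 * y 1 * y 2) = 1"
  have d: "det3 (diag3 x) * (y 0 * y 1 * y 2) = 1" using *(2) by (simp add: det3_diag3)
  have nz: "x 0 \<noteq> 0" "x 1 \<noteq> 0" "x 2 \<noteq> 0" "y 0 \<noteq> 0" "y 1 \<noteq> 0" using *(2) by auto
  have c: "(\<lambda>ij\<in>idx 3. y 0 * diag3 x ij) = diag3 (coords h)"
    by (rule mats_eqI[of _ 3]) (auto simp: diag3_entry *(1) coords_tens[OF *(2)])
  have "h = std_chart (diag3 (coords h)) (y 1 / y 0)"
    unfolding c[symmetric] unfolding *(1) by (rule tens_eq_std_chart(1)[OF d])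
  also have "\<dots> = of_coords (coords h)"
    unfolding std_chart_def of_coords_def det3_diag3
    by (intro arg_cong[of _ _ "tens _"] diag3_cong) (simp add: *(1) coords_tens[OF *(2)] nz field_simps)
  finally show ?thesis ..
qed

lemma coords_of_coords: "(\<And>i. i < 4 \<Longrightarrow> d i \<noteq> 0) \<Longrightarrow> i < 4 \<Longrightarrow> coords (of_coords d) i = d i"
proof -
  assume nz: "\<And>i. i < 4 \<Longrightarrow> d i \<noteq> 0" and i: "i < 4"
  have "d 0 \<noteq> 0" by (rule nz) simp
  moreover have "i = 3" if "\<not> i < 3" using that i by simp
  ultimately show ?thesis by (auto simp: coords_def of_coords_def tens_entry diag3_entry)
qed

lemma coords_mmul: "h \<in> std_torus \<Longrightarrow> h' \<in> std_torus \<Longrightarrow> coords (mmul 9 h h') i = coords h i * coords h' i"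
proof (elim std_torusE)
  fix x y x' y' assume *: "h = tens (diag3 x) (diag3 y)" "x 0 * x 1 * x 2 * (y 0 * y 1 * y 2) = 1"
     "h' = tens (diag3 x') (diag3 y')" "x' 0 * x' 1 * x' 2 * (y' 0 * y' 1 * y' 2) = 1"
  have "x 0 * x' 0 * (x 1 * x' 1) * (x 2 * x' 2) * (y 0 * y' 0 * (y 1 * y' 1) * (y 2 * y' 2))
     = (x 0 * x 1 * x 2 * (y 0 * y 1 * y 2)) * (x' 0 * x' 1 * x' 2 * (y' 0 * y' 1 * y' 2))"
    by (simp add: mult_ac)
  also have "\<dots> = 1" unfolding *(2,4) by simp
  finally have p: "x 0 * x' 0 * (x 1 * x' 1) * (x 2 * x' 2) * (y 0 * y' 0 * (y 1 * y' 1) * (y 2 * y' 2)) = 1" .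
  show ?thesis unfolding *(1,3) tens_mmul mmul_diag3 coords_tens[OF p] coords_tens[OF *(2)] coords_tens[OF *(4)] by simp
qed

lemma of_coords_mmul: "mmul 9 (of_coords d) (of_coords e) = of_coords (\<lambda>i. d i * e i)"
  unfolding of_coords_def tens_mmul mmul_diag3
  by (intro arg_cong[of _ _ "tens _"] diag3_cong) (simp add: mult_ac)

lemma alg_homI:
  assumes "\<phi> \<in> hom (grp H) (grp H')" "points H \<subseteq> GLc (deg H)"
    and "\<And>i j. i < deg H' \<Longrightarrow> j < deg H' \<Longrightarrow> \<exists>f. regular F (deg H) f \<and> (\<forall>g\<in>points H. \<phi> g (i, j) = f g)"
  shows "\<phi> \<in> alg_hom F H H'"
  unfolding alg_hom_def
proof (intro CollectI conjI ballI assms(1))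
  fix ij assume "ij \<in> idx (deg H')"
  then obtain i j where ij: "ij = (i, j)" "i < deg H'" "j < deg H'" by auto
  obtain f where f: "regular F (deg H) f" "\<forall>g\<in>points H. \<phi> g (i, j) = f g" using assms(3)[OF ij(2,3)] by blast
  have "\<forall>g\<in>points H. \<phi> g ij = restrict f (GLc (deg H)) g" using f(2) assms(2) ij(1) by auto
  then show "\<exists>f\<in>reg_fun F (deg H). \<forall>g\<in>points H. \<phi> g ij = f g" using f(1) unfolding regular_def by blast
qed

lemma regular_if: "(c \<Longrightarrow> regular F m f) \<Longrightarrow> (\<not> c \<Longrightarrow> regular F m h) \<Longrightarrow> regular F m (\<lambda>g. if c then f g else h g)"
  by (cases c) simp_all

lemma K_torus_T: "K_torus T"
  unfolding K_torus_def
proof (intro conjI exI)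
  show "K_group T" by (rule K_group_T)
  have Q: "minv 9 frame \<in> GLc 9" by (rule GL_closed(3)[OF frame_GL])
  have D: "deg (diag_group 4) = 4" by (simp add: diag_group_def)
  define \<phi> where "\<phi> = (\<lambda>g. diag4 (coords (conj 9 (minv 9 frame) g)))"
  define \<psi> where "\<psi> = (\<lambda>g. conj 9 frame (of_coords (\<lambda>i. g (i, i))))"
  have mT: "h \<in> mats 9" if "h \<in> std_torus" for h using that std_torus_GL GL_mats by blast
  have phi: "\<phi> (conj 9 frame h) = diag4 (coords h)" if "h \<in> std_torus" for h
    by (simp add: \<phi>_def conj_inverse[OF frame_GL mT[OF that]])
  have psi: "\<psi> (diag4 d) = conj 9 frame (of_coords d)" for d
  proof -
    have "of_coords (\<lambda>i. diag4 d (i, i)) = of_coords d"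
      unfolding of_coords_def by (intro arg_cong2[of _ _ _ _ tens] diag3_cong) (simp_all add: diag4_entry)
    then show ?thesis by (simp add: \<psi>_def)
  qed
  have p1: "\<phi> \<in> alg_hom (carrier LC) T (diag_group 4)"
  proof (rule alg_homI)
    show "points T \<subseteq> GLc (deg T)" using T_GL by simp
    show "\<phi> \<in> hom (grp T) (grp (diag_group 4))"
    proof (rule homI)
      fix g assume "g \<in> carrier (grp T)"
      then obtain h where "g = conj 9 frame h" "h \<in> std_torus" by auto
      then show "\<phi> g \<in> carrier (grp (diag_group 4))"
        using coords_nz by (auto simp: phi points_diag_group)
    next
      fix g g' assume "g \<in> carrier (grp T)" "g' \<in> carrier (grp T)"
      then obtain h h' where h: "g = conj 9 frame h" "h \<in> std_torus" "g' = conj 9 frame h'" "h' \<in> std_torus" by auto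
      have "mmul 9 g g' = conj 9 frame (mmul 9 h h')" unfolding h by (rule conj_mult[OF frame_GL mT[OF h(4)]])
      moreover have "coords (mmul 9 h h') = (\<lambda>i. coords h i * coords h' i)"
        by (rule ext) (rule coords_mmul[OF h(2,4)])
      ultimately show "\<phi> (g \<otimes>\<^bsub>grp T\<^esub> g') = \<phi> g \<otimes>\<^bsub>grp (diag_group 4)\<^esub> \<phi> g'"
        using h by (simp add: phi std_torus_mult D mmul_diag4)
    qed
    fix i j assume "i < deg (diag_group 4)" "j < deg (diag_group 4)"
    then have ij: "i < 4" "j < 4" using D by simp_all
    let ?c = "conj 9 (minv 9 frame)"
    let ?f = "\<lambda>g. if i = j then (if i < 3 then ?c g (i, i) else ?c g (3, 3) * minv 9 (?c g) (0, 0)) else 0"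
    have "regular UNIV 9 ?f"
      by (intro regular_if regular_mult regular_const regular_conj_entry[OF Q] regular_conj_inv_entry[OF Q]) (use ij in auto)
    moreover have "\<phi> g (i, j) = ?f g" if g: "g \<in> points T" for g
    proof -
      obtain h where h: "g = conj 9 frame h" "h \<in> std_torus" using g by auto
      obtain x y where xy: "h = tens (diag3 x) (diag3 y)" "x 0 * x 1 * x 2 * (y 0 * y 1 * y 2) = 1"
        using h(2) by (rule std_torusE)
      have "minv 9 h (0, 0) = inverse (h (0, 0))"
        unfolding xy(1) minv_tens_diag3[OF xy(2)] by (simp add: tens_entry diag3_entry)
      then show ?thesis using ij
        by (simp add: h(1) phi[OF h(2)] conj_inverse[OF frame_GL mT[OF h(2)]] diag4_entry coords_def)
    qed
    ultimately show "\<exists>f. regular (carrier LC) (deg T) f \<and> (\<forall>g\<in>points T. \<phi> g (i, j) = f g)"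
      by (intro exI[of _ ?f]) simp
  qed
  have p2: "\<psi> \<in> alg_hom (carrier LC) (diag_group 4) T"
  proof (rule alg_homI)
    show sub: "points (diag_group 4) \<subseteq> GLc (deg (diag_group 4))" by (auto simp: diag_group_def)
    show "\<psi> \<in> hom (grp (diag_group 4)) (grp T)"
    proof (rule homI)
      fix g assume "g \<in> carrier (grp (diag_group 4))"
      then obtain d where "g = diag4 d" "\<forall>i<4. d i \<noteq> 0" by (auto simp: points_diag_group)
      then show "\<psi> g \<in> carrier (grp T)" using of_coords_std by (auto simp: psi)
    next
      fix g g' assume "g \<in> carrier (grp (diag_group 4))" "g' \<in> carrier (grp (diag_group 4))"
      then obtain d d' where d: "g = diag4 d" "g' = diag4 d'" "\<forall>i<4. d' i \<noteq> 0" by (auto simp: points_diag_group)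
      have "of_coords d' \<in> mats 9" by (simp add: of_coords_def)
      then show "\<psi> (g \<otimes>\<^bsub>grp (diag_group 4)\<^esub> g') = \<psi> g \<otimes>\<^bsub>grp T\<^esub> \<psi> g'"
        by (simp add: d D mmul_diag4 psi conj_mult[OF frame_GL] of_coords_mmul)
    qed
    fix i j assume "i < deg T" "j < deg T"
    then have ij: "i < 9" "j < 9" by simp_all
    let ?m = "\<lambda>g l k. (if l mod 3 = k mod 3 then g (l mod 3, l mod 3) else 0) * (if l div 3 = k div 3 then
       (if l div 3 = 0 then 1 else if l div 3 = 1 then g (3, 3)
        else minv 4 g (3, 3) * (minv 4 g (0, 0) * minv 4 g (1, 1) * minv 4 g (2, 2))) else 0)"
    let ?f = "\<lambda>g. \<Sum>k<9. \<Sum>l<9. frame (i, l) * ?m g l k * minv 9 frame (k, j)"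
    have "l mod 3 < 4" for l :: nat by (rule less_trans[of _ 3]) simp_all
    then have "regular UNIV 4 ?f"
      by (intro regular_sum is_subfield_UNIV regular_if regular_mult regular_const regular_entry regular_inv_entry) simp_all
    moreover have "\<psi> g (i, j) = ?f g" if g: "g \<in> points (diag_group 4)" for g
    proof -
      obtain d where d: "g = diag4 d" "\<forall>i<4. d i \<noteq> 0" using g by (auto simp: points_diag_group)
      have mi: "minv 4 g = diag4 (\<lambda>i. inverse (d i))" unfolding d(1) by (rule diag4_GL(2)) (use d(2) in blast)
      have l4: "l mod 3 < 4" for l :: nat by (rule less_trans[of _ 3]) simp_all
      have "of_coords d (l, k) = ?m g l k" if "l < 9" "k < 9" for l k
        unfolding of_coords_def tens_entry[OF that] mi unfolding d(1)
        using that by (simp add: diag3_entry div3_less diag4_entry l4)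
      then show ?thesis unfolding d(1) psi conj_entry[OF frame_GL ij] by (intro sum.cong refl) (simp add: d(1))
    qed
    ultimately show "\<exists>f. regular (carrier LC) (deg (diag_group 4)) f \<and> (\<forall>g\<in>points (diag_group 4). \<psi> g (i, j) = f g)"
      by (intro exI[of _ ?f]) (simp add: D)
  qed
  have "\<forall>g\<in>points T. \<psi> (\<phi> g) = g"
    by (auto simp: phi psi of_coords_coords)
  moreover have "\<forall>g\<in>points (diag_group 4). \<phi> (\<psi> g) = g"
    by (auto simp: points_diag_group psi phi of_coords_std) (rule diag4_cong, rule coords_of_coords, auto)
  ultimately show "alg_isomorphic (carrier LC) T (diag_group 4)"
    unfolding alg_isomorphic_def using p1 p2 by blast
qed

end

section \<open>Galois cohomology of matrix groups\<close>

context base_field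
begin

lemma sep_points_eq: "sep_points H = points H"
  by (simp add: sep_points_def)

lemma topspace_krull: "topspace krull_topology = Gal"
  by (simp add: krull_topology_def)

text \<open>
  Continuity of the cocycles below comes from these sets, as their values only depend on the images of
  two elements.
\<close>
lemma krull_open_stabilizer: "openin krull_topology {s \<in> Gal. s x = y}"
proof -
  have "continuous_map krull_topology (discrete_topology UNIV) (\<lambda>s. s x)"
    unfolding krull_topology_def sep_closure_UNIV
    using continuous_map_from_subtopology[OF continuous_map_product_projection[OF UNIV_I, of "\<lambda>_. discrete_topology UNIV" x]] .
  then have "openin krull_topology {s \<in> topspace krull_topology. s x \<in> {y}}"
    by (rule openin_continuous_map_preimage) simp
  then show ?thesis by (simp add: topspace_krull)
qed

definition locally_constant :: "((complex \<Rightarrow> complex) \<Rightarrow> complex sqmat) \<Rightarrow> bool"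
  where "locally_constant c \<longleftrightarrow> (\<forall>s\<in>Gal. \<exists>N. openin krull_topology N \<and> s \<in> N \<and> (\<forall>t\<in>N. c t = c s))"

lemma cocycles_iff:
  "c \<in> cocycles H \<longleftrightarrow> c \<in> Gal \<rightarrow>\<^sub>E points H \<and> locally_constant c \<and>
     (\<forall>s\<in>Gal. \<forall>t\<in>Gal. c (s \<circ> t) = mmul (deg H) (c s) (gal_act (deg H) s (c t)))"
proof -
  have comp: "compose UNIV s t = s \<circ> t" for s t :: "complex \<Rightarrow> complex" by (simp add: compose_def fun_eq_iff)
  have "continuous_map krull_topology (discrete_topology (points H)) c \<longleftrightarrow> locally_constant c"
    if c: "c \<in> Gal \<rightarrow>\<^sub>E points H"
  proof
    assume cont: "continuous_map krull_topology (discrete_topology (points H)) c"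
    show "locally_constant c" unfolding locally_constant_def
    proof
      fix s assume s: "s \<in> Gal"
      have "openin krull_topology {t \<in> topspace krull_topology. c t \<in> {c s}}"
        by (rule openin_continuous_map_preimage[OF cont]) (use c s in auto)
      then show "\<exists>N. openin krull_topology N \<and> s \<in> N \<and> (\<forall>t\<in>N. c t = c s)"
        using s by (intro exI[of _ "{t \<in> Gal. c t = c s}"]) (simp add: topspace_krull)
    qed
  next
    assume lc: "locally_constant c"
    show "continuous_map krull_topology (discrete_topology (points H)) c"
      unfolding continuous_map_def
    proof (intro conjI allI impI)
      show "c \<in> topspace krull_topology \<rightarrow> topspace (discrete_topology (points H))" using c by (auto simp: topspace_krull)
      fix B assume "openin (discrete_topology (points H)) B"
      show "openin krull_topology {x \<in> topspace krull_topology. c x \<in> B}"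
      proof (subst openin_subopen, intro ballI)
        fix s assume s: "s \<in> {x \<in> topspace krull_topology. c x \<in> B}"
        then obtain N where N: "openin krull_topology N" "s \<in> N" "\<forall>t\<in>N. c t = c s"
          using lc[unfolded locally_constant_def] by (metis (no_types, lifting) mem_Collect_eq topspace_krull)
        have "N \<subseteq> {x \<in> topspace krull_topology. c x \<in> B}"
        proof
          fix t assume t: "t \<in> N"
          then show "t \<in> {x \<in> topspace krull_topology. c x \<in> B}"
            using openin_subset[OF N(1)] s bspec[OF N(3) t] by auto
        qed
        then show "\<exists>N. openin krull_topology N \<and> s \<in> N \<and> N \<subseteq> {x \<in> topspace krull_topology. c x \<in> B}" using N(1,2) by blast
      qed
    qed
  qed
  then show ?thesis unfolding cocycles_def by (auto simp: sep_points_eq comp)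
qed

definition galois_stable_subgroup :: "complex lin_group \<Rightarrow> bool"
  where "galois_stable_subgroup H \<longleftrightarrow> subgroup (points H) (GL (deg H)) \<and> (\<forall>s\<in>Gal. \<forall>g\<in>points H. gal_act (deg H) s g \<in> points H)"

lemma cohomologous_iff: "(c, d) \<in> cohomologous H \<longleftrightarrow> c \<in> cocycles H \<and> d \<in> cocycles H \<and>
    (\<exists>g\<in>points H. \<forall>s\<in>Gal. d s = mmul (deg H) (mmul (deg H) (minv (deg H) g) (c s)) (gal_act (deg H) s g))"
  by (simp add: cohomologous_def sep_points_eq)

lemma cohomologousE:
  assumes "(c, d) \<in> cohomologous H" and "m = deg H"
  obtains g where "c \<in> cocycles H" "d \<in> cocycles H" "g \<in> points H"
    "\<forall>s\<in>Gal. d s = mmul m (mmul m (minv m g) (c s)) (gal_act m s g)"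
proof -
  have *: "c \<in> cocycles H" "d \<in> cocycles H"
    "\<exists>g\<in>points H. \<forall>s\<in>Gal. d s = mmul m (mmul m (minv m g) (c s)) (gal_act m s g)"
    using assms(1) unfolding cohomologous_iff assms(2) by blast+
  from *(3) obtain g where g: "g \<in> points H" "\<forall>s\<in>Gal. d s = mmul m (mmul m (minv m g) (c s)) (gal_act m s g)" ..
  show ?thesis by (rule that[OF *(1,2) g(1)]) (rule g(2))
qed

context
  fixes H m assumes H: "galois_stable_subgroup H" and m: "m = deg H"
begin

lemma gH: "subgroup (points H) (GL m)" using H by (simp add: galois_stable_subgroup_def m)

lemma points_GL: "g \<in> points H \<Longrightarrow> g \<in> GLc m" using subgroup.subset[OF gH] by blast

lemma points_closed:
  "mone m \<in> points H" "g \<in> points H \<Longrightarrow> h \<in> points H \<Longrightarrow> mmul m g h \<in> points H"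
  "g \<in> points H \<Longrightarrow> minv m g \<in> points H"
  using subgroup.one_closed[OF gH] subgroup.m_closed[OF gH, of g h] subgroup.m_inv_closed[OF gH, of g] by simp_all

lemma cocycle_value: "c \<in> cocycles H \<Longrightarrow> s \<in> Gal \<Longrightarrow> c s \<in> points H"
  unfolding cocycles_iff by blast

lemma cocycle_mats: "c \<in> cocycles H \<Longrightarrow> s \<in> Gal \<Longrightarrow> c s \<in> mats m"
  using cocycle_value points_GL GL_mats by blast

lemma cohomologous_refl: "c \<in> cocycles H \<Longrightarrow> (c, c) \<in> cohomologous H"
  unfolding cohomologous_iff m[symmetric]
proof (intro conjI bexI[of _ "mone m"] ballI points_closed(1))
  fix s assume "c \<in> cocycles H" and s: "s \<in> Gal"
  then have c: "c s \<in> mats m" by (rule cocycle_mats)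
  have "minv m (mone m) = mone m" by (rule GL_inv_unique(2)) (simp_all add: mmul_one)
  then show "c s = mmul m (mmul m (minv m (mone m)) (c s)) (gal_act m s (mone m))"
    by (simp add: gal_act_mone[OF s] mmul_one c)
qed

lemma cohomologous_sym: assumes "(c, d) \<in> cohomologous H" shows "(d, c) \<in> cohomologous H"
proof -
  obtain g where cd: "c \<in> cocycles H" "d \<in> cocycles H" and g: "g \<in> points H"
    "\<forall>s\<in>Gal. d s = mmul m (mmul m (minv m g) (c s)) (gal_act m s g)"
    by (rule cohomologousE[OF assms m]) (rule that; assumption)
  note gg = points_GL[OF g(1)]
  have "c s = mmul m (mmul m (minv m (minv m g)) (d s)) (gal_act m s (minv m g))" if s: "s \<in> Gal" for s
    unfolding bspec[OF g(2) s] GL_closed(6)[OF gg] gal_act_GL(2)[OF s gg, symmetric] mmul_assoc[symmetric]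
    by (simp add: mmul_assoc mmul_cancel(2)[OF gg mmul_mats] GL_closed(4)[OF gal_act_GL(1)[OF s gg]] mmul_one cocycle_mats[OF cd(1) s]
        GL_closed(4)[OF gg] flip: mmul_assoc[of m g "minv m g"])
  then show ?thesis unfolding cohomologous_iff m[symmetric] using cd points_closed(3)[OF g(1)] by blast
qed

lemma cohomologous_trans:
  assumes "(c, d) \<in> cohomologous H" "(d, e) \<in> cohomologous H" shows "(c, e) \<in> cohomologous H"
proof -
  obtain g where cd: "c \<in> cocycles H" and g: "g \<in> points H"
    "\<forall>s\<in>Gal. d s = mmul m (mmul m (minv m g) (c s)) (gal_act m s g)"
    by (rule cohomologousE[OF assms(1) m]) (rule that; assumption)
  obtain h where e: "e \<in> cocycles H" and h: "h \<in> points H"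
    "\<forall>s\<in>Gal. e s = mmul m (mmul m (minv m h) (d s)) (gal_act m s h)"
    by (rule cohomologousE[OF assms(2) m]) (rule that; assumption)
  have "e s = mmul m (mmul m (minv m (mmul m g h)) (c s)) (gal_act m s (mmul m g h))" if s: "s \<in> Gal" for s
    unfolding bspec[OF h(2) s] bspec[OF g(2) s] GL_closed(7)[OF points_GL[OF g(1)] points_GL[OF h(1)]] gal_act_mmul[OF s]
    by (simp add: mmul_assoc)
  then show ?thesis unfolding cohomologous_iff m[symmetric] using cd e points_closed(2)[OF g(1) h(1)] by blast
qed

lemma class_eq_iff:
  assumes "c \<in> cocycles H" "d \<in> cocycles H"
  shows "cohomologous H `` {c} = cohomologous H `` {d} \<longleftrightarrow> (c, d) \<in> cohomologous H"
proof
  assume eq: "cohomologous H `` {c} = cohomologous H `` {d}"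
  have "d \<in> cohomologous H `` {c}" unfolding eq using cohomologous_refl[OF assms(2)] by simp
  then show "(c, d) \<in> cohomologous H" by simp
next
  assume "(c, d) \<in> cohomologous H"
  then show "cohomologous H `` {c} = cohomologous H `` {d}"
    using cohomologous_trans cohomologous_sym by blast
qed

lemma class_in_H1: "c \<in> cocycles H \<Longrightarrow> cohomologous H `` {c} \<in> H1 H"
  unfolding H1_def by (rule quotientI)

text \<open>
  For commutative groups the product of cocycles is a cocycle and its class does not depend on the representatives, so that
  the product of classes, a union over all representatives, is a single class.
\<close>
lemma H1_mult_class:
  assumes comm: "\<And>g h. g \<in> points H \<Longrightarrow> h \<in> points H \<Longrightarrow> mmul m g h = mmul m h g"
    and c: "c \<in> cocycles H" and d: "d \<in> cocycles H"
  defines "e \<equiv> (\<lambda>s\<in>Gal. mmul m (c s) (d s))"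
  shows "cohomologous H `` {c} \<otimes>\<^bsub>H1_group H\<^esub> cohomologous H `` {d} = cohomologous H `` {e}" "e \<in> cocycles H"
proof -
  have prod: "(\<lambda>s\<in>Gal. mmul m (c s) (d s)) \<in> cocycles H" if c: "c \<in> cocycles H" and d: "d \<in> cocycles H" for c d
    unfolding cocycles_iff m[symmetric]
  proof (intro conjI ballI)
    show "(\<lambda>s\<in>Gal. mmul m (c s) (d s)) \<in> Gal \<rightarrow>\<^sub>E points H"
      using cocycle_value[OF c] cocycle_value[OF d] points_closed(2) by auto
    show "locally_constant (\<lambda>s\<in>Gal. mmul m (c s) (d s))" unfolding locally_constant_def
    proof
      fix s assume s: "s \<in> Gal"
      obtain N where N: "openin krull_topology N" "s \<in> N" "\<forall>t\<in>N. c t = c s"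
        using c[unfolded cocycles_iff locally_constant_def] s by metis
      obtain N' where N': "openin krull_topology N'" "s \<in> N'" "\<forall>t\<in>N'. d t = d s"
        using d[unfolded cocycles_iff locally_constant_def] s by metis
      have "N \<subseteq> Gal" using openin_subset[OF N(1)] by (simp add: topspace_krull)
      then have "(\<lambda>s\<in>Gal. mmul m (c s) (d s)) t = (\<lambda>s\<in>Gal. mmul m (c s) (d s)) s" if t: "t \<in> N \<inter> N'" for t
        using bspec[OF N(3) IntD1[OF t]] bspec[OF N'(3) IntD2[OF t]] s t by auto
      then show "\<exists>N. openin krull_topology N \<and> s \<in> N \<and> (\<forall>t\<in>N. (\<lambda>s\<in>Gal. mmul m (c s) (d s)) t = (\<lambda>s\<in>Gal. mmul m (c s) (d s)) s)"
        using openin_Int[OF N(1) N'(1)] N(2) N'(2) by blast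
    qed
    fix s t assume s: "s \<in> Gal" and t: "t \<in> Gal"
    have ct: "gal_act m s (c t) \<in> points H" using H s cocycle_value[OF c t] unfolding galois_stable_subgroup_def m by blast
    have "mmul m (mmul m (c s) (gal_act m s (c t))) (mmul m (d s) (gal_act m s (d t)))
        = mmul m (c s) (mmul m (mmul m (gal_act m s (c t)) (d s)) (gal_act m s (d t)))" by (simp add: mmul_assoc)
    also have "\<dots> = mmul m (mmul m (c s) (d s)) (mmul m (gal_act m s (c t)) (gal_act m s (d t)))"
      unfolding comm[OF ct cocycle_value[OF d s]] by (simp add: mmul_assoc)
    finally show "(\<lambda>s\<in>Gal. mmul m (c s) (d s)) (s \<circ> t)
        = mmul m ((\<lambda>s\<in>Gal. mmul m (c s) (d s)) s) (gal_act m s ((\<lambda>s\<in>Gal. mmul m (c s) (d s)) t))"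
      using c d s t by (simp add: Gal_comp gal_act_mmul cocycles_iff m)
  qed
  show e: "e \<in> cocycles H" unfolding e_def by (rule prod[OF c d])
  have coh: "(e, \<lambda>s\<in>Gal. mmul m (c' s) (d' s)) \<in> cohomologous H"
    if c': "(c, c') \<in> cohomologous H" and d': "(d, d') \<in> cohomologous H" for c' d'
  proof -
    obtain g where cc: "c' \<in> cocycles H" and g: "g \<in> points H"
      "\<forall>s\<in>Gal. c' s = mmul m (mmul m (minv m g) (c s)) (gal_act m s g)"
      by (rule cohomologousE[OF c' m]) (rule that; assumption)
    obtain h where dd: "d' \<in> cocycles H" and h: "h \<in> points H"
      "\<forall>s\<in>Gal. d' s = mmul m (mmul m (minv m h) (d s)) (gal_act m s h)"
      by (rule cohomologousE[OF d' m]) (rule that; assumption)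
    have "mmul m (c' s) (d' s) = mmul m (mmul m (minv m (mmul m g h)) (mmul m (c s) (d s))) (gal_act m s (mmul m g h))"
      if s: "s \<in> Gal" for s
    proof -
      have gg: "gal_act m s g \<in> points H" "gal_act m s h \<in> points H" using H s g(1) h(1) unfolding galois_stable_subgroup_def m by blast+
      note cs = cocycle_value[OF c s] and ds = cocycle_value[OF d s]
      note gi = points_closed(3)[OF g(1)] and hi = points_closed(3)[OF h(1)]
      let ?gi = "minv m g" and ?hi = "minv m h" and ?g = "gal_act m s g" and ?h = "gal_act m s h"
      have "mmul m (c' s) (d' s) = mmul m (mmul m (mmul m ?gi (c s)) ?g) (mmul m (mmul m ?hi (d s)) ?h)"
        unfolding bspec[OF g(2) s] bspec[OF h(2) s] ..
      also have "\<dots> = mmul m (mmul m ?gi (c s)) (mmul m (mmul m ?g (mmul m ?hi (d s))) ?h)" by (simp add: mmul_assoc)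
      also have "mmul m ?g (mmul m ?hi (d s)) = mmul m (mmul m ?hi (d s)) ?g"
        by (rule comm[OF gg(1) points_closed(2)[OF hi ds]])
      also have "mmul m (mmul m ?gi (c s)) (mmul m (mmul m (mmul m ?hi (d s)) ?g) ?h)
        = mmul m (mmul m (mmul m (mmul m ?gi (c s)) ?hi) (d s)) (mmul m ?g ?h)" by (simp add: mmul_assoc)
      also have "mmul m (mmul m ?gi (c s)) ?hi = mmul m ?hi (mmul m ?gi (c s))"
        by (rule comm[OF points_closed(2)[OF gi cs] hi])
      finally show ?thesis
        unfolding GL_closed(7)[OF points_GL[OF g(1)] points_GL[OF h(1)]] gal_act_mmul[OF s] by (simp add: mmul_assoc)
    qed
    then show ?thesis unfolding cohomologous_iff m[symmetric]
      using e prod[OF cc dd] points_closed(2)[OF g(1) h(1)] by (auto simp: e_def)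
  qed
  have "cohomologous H `` {\<lambda>s\<in>Gal. mmul m (c' s) (d' s) | c' d'. c' \<in> cohomologous H `` {c} \<and> d' \<in> cohomologous H `` {d}}
      = cohomologous H `` {e}"
  proof (intro equalityI subsetI)
    fix z assume "z \<in> cohomologous H `` {\<lambda>s\<in>Gal. mmul m (c' s) (d' s) | c' d'. c' \<in> cohomologous H `` {c} \<and> d' \<in> cohomologous H `` {d}}"
    then obtain c' d' where "(c, c') \<in> cohomologous H" "(d, d') \<in> cohomologous H" "(\<lambda>s\<in>Gal. mmul m (c' s) (d' s), z) \<in> cohomologous H"
      by blast
    then show "z \<in> cohomologous H `` {e}" using cohomologous_trans[OF coh] by blast
  next
    fix z assume z: "z \<in> cohomologous H `` {e}"
    have "e \<in> {\<lambda>s\<in>Gal. mmul m (c' s) (d' s) | c' d'. c' \<in> cohomologous H `` {c} \<and> d' \<in> cohomologous H `` {d}}"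
      unfolding e_def using cohomologous_refl[OF c] cohomologous_refl[OF d] by blast
    then show "z \<in> cohomologous H `` {\<lambda>s\<in>Gal. mmul m (c' s) (d' s) | c' d'. c' \<in> cohomologous H `` {c} \<and> d' \<in> cohomologous H `` {d}}"
      using z by blast
  qed
  then show "cohomologous H `` {c} \<otimes>\<^bsub>H1_group H\<^esub> cohomologous H `` {d} = cohomologous H `` {e}"
    by (simp add: H1_group_def m)
qed

lemma trivial_cocycle: "(\<lambda>s\<in>Gal. mone m) \<in> cocycles H"
  unfolding cocycles_iff m[symmetric]
proof (intro conjI ballI)
  show "(\<lambda>s\<in>Gal. mone m) \<in> Gal \<rightarrow>\<^sub>E points H" using points_closed(1) by auto
  show "locally_constant (\<lambda>s\<in>Gal. mone m)" unfolding locally_constant_def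
    by (intro ballI exI[of _ Gal]) (use openin_topspace[of krull_topology] in \<open>simp add: topspace_krull\<close>)
qed (simp add: Gal_comp gal_act_mone mmul_one)

lemma H1_square_class:
  assumes comm: "\<And>g h. g \<in> points H \<Longrightarrow> h \<in> points H \<Longrightarrow> mmul m g h = mmul m h g"
    and c: "c \<in> cocycles H"
  shows "(cohomologous H `` {c}) [^]\<^bsub>H1_group H\<^esub> (2::int) = cohomologous H `` {\<lambda>s\<in>Gal. mmul m (c s) (c s)}"
proof -
  have one: "\<one>\<^bsub>H1_group H\<^esub> = cohomologous H `` {\<lambda>s\<in>Gal. mone m}" by (simp add: H1_group_def m)
  have ext: "(\<lambda>s\<in>Gal. mmul m ((\<lambda>s\<in>Gal. mone m) s) (c s)) = c"
  proof (rule extensionalityI[of _ Gal])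
    show "c \<in> extensional Gal" using c unfolding cocycles_iff PiE_def by blast
  qed (use cocycle_mats[OF c] in \<open>simp_all add: mmul_one\<close>)
  have "(cohomologous H `` {c}) [^]\<^bsub>H1_group H\<^esub> (2::int) = (cohomologous H `` {c}) [^]\<^bsub>H1_group H\<^esub> (2::nat)"
    using int_pow_int[of "H1_group H" "cohomologous H `` {c}" 2] by simp
  also have "\<dots> = (\<one>\<^bsub>H1_group H\<^esub> \<otimes>\<^bsub>H1_group H\<^esub> (cohomologous H `` {c})) \<otimes>\<^bsub>H1_group H\<^esub> (cohomologous H `` {c})"
    by (simp add: nat_pow_def numeral_2_eq_2)
  also have "\<one>\<^bsub>H1_group H\<^esub> \<otimes>\<^bsub>H1_group H\<^esub> (cohomologous H `` {c}) = cohomologous H `` {c}"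
  proof -
    have "\<one>\<^bsub>H1_group H\<^esub> \<otimes>\<^bsub>H1_group H\<^esub> (cohomologous H `` {c})
        = cohomologous H `` {\<lambda>s\<in>Gal. mmul m ((\<lambda>s\<in>Gal. mone m) s) (c s)}"
      unfolding one by (rule H1_mult_class(1)[OF comm trivial_cocycle c])
    then show ?thesis unfolding ext .
  qed
  also have "cohomologous H `` {c} \<otimes>\<^bsub>H1_group H\<^esub> cohomologous H `` {c} = cohomologous H `` {\<lambda>s\<in>Gal. mmul m (c s) (c s)}"
    by (rule H1_mult_class(1)[OF comm c c])
  finally show ?thesis .
qed

end

lemma cocycles_mono:
  assumes "deg H' = deg H" "points H' \<subseteq> points H" shows "cocycles H' \<subseteq> cocycles H"
  using assms by (fastforce simp: cocycles_iff)

lemma H1_map_inclusion: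
  assumes H: "galois_stable_subgroup H" and sub: "deg H' = deg H" "points H' \<subseteq> points H" and H': "galois_stable_subgroup H'" and c: "c \<in> cocycles H'"
  shows "H1_map H id (cohomologous H' `` {c}) = cohomologous H `` {c}"
proof -
  have mono: "(x, y) \<in> cohomologous H" if "(x, y) \<in> cohomologous H'" for x y
    using that cocycles_mono[OF sub] sub unfolding cohomologous_iff by auto
  have r: "(\<lambda>s\<in>Gal. id (d s)) = d" if "d \<in> cocycles H'" for d
    using that unfolding cocycles_iff PiE_def by (auto simp: extensional_restrict)
  have img: "(\<lambda>d. \<lambda>s\<in>Gal. id (d s)) ` (cohomologous H' `` {c}) = cohomologous H' `` {c}"
  proof -
    have "(\<lambda>s\<in>Gal. id (d s)) = d" if "d \<in> cohomologous H' `` {c}" for d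
      using that by (intro r) (simp add: cohomologous_iff)
    from trans[OF image_cong[OF refl this] image_ident] show ?thesis .
  qed
  show ?thesis
    unfolding H1_map_def img
  proof (intro equalityI subsetI)
    fix z assume "z \<in> cohomologous H `` (cohomologous H' `` {c})"
    then show "z \<in> cohomologous H `` {c}" using mono cohomologous_trans[OF H refl] by blast
  next
    fix z assume "z \<in> cohomologous H `` {c}"
    then show "z \<in> cohomologous H `` (cohomologous H' `` {c})" using cohomologous_refl[OF H' refl c] by blast
  qed
qed

end

section \<open>Cocycles with values in the twisted torus\<close>

text \<open>
  The norm form is the product of the conjugates \<open>x + u \<zeta>\<^sup>j y + u\<^sup>2 \<zeta>\<^sup>2\<^sup>j z\<close>.
\<close>
lemma norm3_factors:
  fixes \<zeta> u :: "'a::field"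
  assumes "1 + \<zeta> + \<zeta> * \<zeta> = 0"
  shows "(x + u * y + u * u * z) * (x + u * \<zeta> * y + u * u * (\<zeta> * \<zeta>) * z) * (x + u * (\<zeta> * \<zeta>) * y + u * u * \<zeta> * z)
     = norm3 (u * u * u) x y z"
  unfolding norm3_def using assms by Groebner_Basis.algebra

text \<open>
  The form \<open>mixed\<close> is a trace, the sum of the three cyclic conjugates of a product with one factor from each row.
\<close>
lemma mixed_sum:
  fixes \<zeta> u :: "'a::field"
  assumes "1 + \<zeta> + \<zeta> * \<zeta> = 0"
  shows "(y 0 0 + u * y 0 1 + u * u * y 0 2) * (y 1 0 + u * \<zeta> * y 1 1 + u * u * (\<zeta> * \<zeta>) * y 1 2) * (y 2 0 + u * (\<zeta> * \<zeta>) * y 2 1 + u * u * \<zeta> * y 2 2)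
    + (y 0 0 + u * \<zeta> * y 0 1 + u * u * (\<zeta> * \<zeta>) * y 0 2) * (y 1 0 + u * (\<zeta> * \<zeta>) * y 1 1 + u * u * \<zeta> * y 1 2) * (y 2 0 + u * y 2 1 + u * u * y 2 2)
    + (y 0 0 + u * (\<zeta> * \<zeta>) * y 0 1 + u * u * \<zeta> * y 0 2) * (y 1 0 + u * y 1 1 + u * u * y 1 2) * (y 2 0 + u * \<zeta> * y 2 1 + u * u * (\<zeta> * \<zeta>) * y 2 2)
    = mixed (u * u * u) \<zeta> y"
proof -
  have "(x0 + u * x1 + u * u * x2) * (y0 + u * \<zeta> * y1 + u * u * (\<zeta> * \<zeta>) * y2) * (z0 + u * (\<zeta> * \<zeta>) * z1 + u * u * \<zeta> * z2)
    + (x0 + u * \<zeta> * x1 + u * u * (\<zeta> * \<zeta>) * x2) * (y0 + u * (\<zeta> * \<zeta>) * y1 + u * u * \<zeta> * y2) * (z0 + u * z1 + u * u * z2)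
    + (x0 + u * (\<zeta> * \<zeta>) * x1 + u * u * \<zeta> * x2) * (y0 + u * y1 + u * u * y2) * (z0 + u * \<zeta> * z1 + u * u * (\<zeta> * \<zeta>) * z2)
    = 3 * (x0 * y0 * z0 + (u * u * u) * (x1 * y1 * z1) + (u * u * u) * (u * u * u) * (x2 * y2 * z2)
     + (u * u * u) * \<zeta> * \<zeta> * (x0 * y1 * z2 + x2 * y0 * z1 + x1 * y2 * z0)
     + (u * u * u) * \<zeta> * (x0 * y2 * z1 + x1 * y0 * z2 + x2 * y1 * z0))" for x0 x1 x2 y0 y1 y2 z0 z1 z2 :: 'a
    using assms by Groebner_Basis.algebra
  then show ?thesis unfolding mixed_def .
qed

context symbol_setup
begin

lemma galois_stable_G: "galois_stable_subgroup G" unfolding galois_stable_subgroup_def using subgroup_G G_stable by simp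
lemma galois_stable_T: "galois_stable_subgroup T" unfolding galois_stable_subgroup_def using subgroup_T T_stable by simp

lemma points_T_G: "points T \<subseteq> points G" using std_torus_subset by auto

lemma points_T_commute: "g \<in> points T \<Longrightarrow> h \<in> points T \<Longrightarrow> mmul 9 g h = mmul 9 h g"
proof -
  assume "g \<in> points T" "h \<in> points T"
  then obtain g' h' where *: "g = conj 9 frame g'" "g' \<in> std_torus" "h = conj 9 frame h'" "h' \<in> std_torus" by auto
  have "g' \<in> mats 9" "h' \<in> mats 9" using * std_torus_GL GL_mats by blast+
  then show ?thesis unfolding *(1,3) by (simp add: conj_mult[OF frame_GL] std_torus_commute[OF *(2,4)])
qed

text \<open>
  For cube roots of unity this element commutes with all values of \<open>twist\<close>, so that the Galois action on its
  conjugate by \<open>frame\<close> is trivial and characters of the Galois group give cocycles.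
\<close>
definition tor :: "complex \<Rightarrow> complex \<Rightarrow> complex sqmat"
  where "tor \<gamma> \<beta> = tens (diag3 (\<lambda>i. \<gamma> * inverse \<beta> ^ i)) (diag3 (\<lambda>i. \<beta> ^ i))"

lemma tor_mats [simp]: "tor \<gamma> \<beta> \<in> mats 9" by (simp add: tor_def)

lemma tor_std_torus: "\<gamma> ^ 3 = 1 \<Longrightarrow> \<beta> ^ 3 = 1 \<Longrightarrow> tor \<gamma> \<beta> \<in> std_torus"
  unfolding tor_def by (intro std_torusI) (simp add: power3_eq_cube power2_eq_square field_simps)

lemma tor_mmul: "mmul 9 (tor \<gamma> \<beta>) (tor \<gamma>' \<beta>') = tor (\<gamma> * \<gamma>') (\<beta> * \<beta>')"
  unfolding tor_def tens_mmul mmul_diag3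
  by (intro arg_cong2[of _ _ _ _ tens] arg_cong[of _ _ diag3] ext) (simp_all add: power_mult_distrib mult_ac)

lemma gal_act_tor: "s \<in> Gal \<Longrightarrow> \<gamma> ^ 3 = 1 \<Longrightarrow> \<beta> ^ 3 = 1 \<Longrightarrow> gal_act 9 s (tor \<gamma> \<beta>) = tor \<gamma> \<beta>"
  unfolding tor_def
  by (simp add: gal_act_tens gal_act_diag3 GalD(2,7,9) GalD(10)[OF _ cube_root_K])

text \<open>
  Multiplying \<open>twist\<close> by \<open>tor \<gamma> \<beta>\<close> changes the character \<open>\<chi>\<^sub>v\<close> in the first factor into
  \<open>\<chi>\<^sub>v / \<beta>\<close>. For \<open>\<beta> = \<chi>\<^sub>v\<close> the symbol algebra becomes split, for \<open>\<beta> = \<chi>\<^sub>v\<^sup>2\<close> its class is inverted.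
\<close>
lemma tor_twist:
  assumes s: "s \<in> Gal" and b: "\<beta> ^ 3 = 1"
  defines "n \<equiv> dlog (chi u s)" and "z \<equiv> chi v s"
  shows "mmul 9 (tor \<gamma> \<beta>) (twist s) = tens (mono3 n (\<lambda>j. \<gamma> * (inverse \<beta> * z) ^ j)) (mono3 n (\<lambda>j. (\<beta> * inverse z) ^ j))"
    "mmul 9 (twist s) (tor \<gamma> \<beta>) = mmul 9 (tor \<gamma> \<beta>) (twist s)"
proof -
  have b0: "\<beta> \<noteq> 0" by (rule cube_root_nz[OF b])
  have p: "\<beta> ^ ((j + n) mod 3) = \<beta> ^ j * \<beta> ^ n" "inverse \<beta> ^ ((j + n) mod 3) = inverse \<beta> ^ j * inverse (\<beta> ^ n)" for j
    unfolding cube_root_pow_mod[OF b] cube_root_pow_mod[OF cube_root_inverse[OF b]] power_add power_inverse by simp_all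
  have "mmul 9 (tor \<gamma> \<beta>) (twist s) = tens (mono3 n (\<lambda>j. \<gamma> * inverse \<beta> ^ ((j + n) mod 3) * z ^ j)) (mono3 n (\<lambda>j. \<beta> ^ ((j + n) mod 3) * inverse z ^ j))"
    unfolding tor_def twist_def tens_mmul diag3_mono3 mmul_mono3 n_def z_def by simp
  also have "\<dots> = tens (mono3 n (\<lambda>j. \<gamma> * (inverse \<beta> * z) ^ j)) (mono3 n (\<lambda>j. (\<beta> * inverse z) ^ j))"
    by (rule tens_mono3_eqI) (use b0 in \<open>simp add: p power_mult_distrib\<close>)
  finally show 1: "mmul 9 (tor \<gamma> \<beta>) (twist s) = tens (mono3 n (\<lambda>j. \<gamma> * (inverse \<beta> * z) ^ j)) (mono3 n (\<lambda>j. (\<beta> * inverse z) ^ j))" .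
  have "mmul 9 (twist s) (tor \<gamma> \<beta>) = tens (mono3 n (\<lambda>j. z ^ j * (\<gamma> * inverse \<beta> ^ j))) (mono3 n (\<lambda>j. inverse z ^ j * \<beta> ^ j))"
    unfolding tor_def twist_def tens_mmul diag3_mono3 mmul_mono3 n_def z_def
    by (intro arg_cong2[of _ _ _ _ tens]) (simp_all, (rule mono3_cong, simp)+)
  then show "mmul 9 (twist s) (tor \<gamma> \<beta>) = mmul 9 (tor \<gamma> \<beta>) (twist s)"
    unfolding 1 by (elim ssubst, intro arg_cong2[of _ _ _ _ tens] arg_cong2[of _ _ _ _ mono3] refl ext)
      (simp_all add: power_mult_distrib mult_ac)
qed

lemma gal_act_conj_tor:
  assumes s: "s \<in> Gal" and "\<gamma> ^ 3 = 1" "\<beta> ^ 3 = 1"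
  shows "gal_act 9 s (conj 9 frame (tor \<gamma> \<beta>)) = conj 9 frame (tor \<gamma> \<beta>)"
proof -
  have "conj 9 (twist s) (tor \<gamma> \<beta>) = tor \<gamma> \<beta>"
    unfolding conj_def tor_twist(2)[OF s assms(3)] by (rule mmul_cancel(3)[OF twist_GL[OF s] tor_mats])
  then show ?thesis
    using gal_act_conj_frame[OF s subsetD[OF std_torus_GL tor_std_torus[OF assms(2,3)]]] gal_act_tor[OF assms] by simp
qed

text \<open>
  The cocycle of the class \<open>\<eta>\<^sup>k\<xi>\<^sup>l\<close>, where \<open>\<eta>\<close> is central and belongs to \<open>w\<close>, and \<open>\<xi>\<close>
  belongs to \<open>v\<close>.
\<close>
definition cocyc :: "nat \<Rightarrow> nat \<Rightarrow> (complex \<Rightarrow> complex) \<Rightarrow> complex sqmat"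
  where "cocyc k l = (\<lambda>s\<in>Gal. conj 9 frame (tor (chi w s ^ k) (chi v s ^ l)))"

lemma chi_pow: "s \<in> Gal \<Longrightarrow> (chi w s ^ k) ^ 3 = 1" "s \<in> Gal \<Longrightarrow> (chi v s ^ k) ^ 3 = 1"
  using chi_w(1) chi_v(1) by (simp_all flip: power_mult add: mult.commute[of k]) (simp_all add: power_mult)

lemma cocyc_cocycle: "cocyc k l \<in> cocycles T"
  unfolding cocycles_iff T_simps(1)
proof (intro conjI ballI)
  show "cocyc k l \<in> Gal \<rightarrow>\<^sub>E points T"
    using tor_std_torus[OF chi_pow] by (auto simp: cocyc_def)
  show "locally_constant (cocyc k l)" unfolding locally_constant_def
  proof
    fix s assume s: "s \<in> Gal"
    have o: "openin krull_topology ({t \<in> Gal. t w = s w} \<inter> {t \<in> Gal. t v = s v})"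
      by (intro openin_Int krull_open_stabilizer)
    have c: "cocyc k l t = cocyc k l s" if "t \<in> {t \<in> Gal. t w = s w} \<inter> {t \<in> Gal. t v = s v}" for t
      using that s by (simp add: cocyc_def chi_def)
    show "\<exists>N. openin krull_topology N \<and> s \<in> N \<and> (\<forall>t\<in>N. cocyc k l t = cocyc k l s)"
      using s by (intro exI[of _ "{t \<in> Gal. t w = s w} \<inter> {t \<in> Gal. t v = s v}"] conjI ballI o c) simp_all
  qed
  fix s t assume s: "s \<in> Gal" and t: "t \<in> Gal"
  have "cocyc k l (s \<circ> t) = conj 9 frame (mmul 9 (tor (chi w s ^ k) (chi v s ^ l)) (tor (chi w t ^ k) (chi v t ^ l)))"
    using s t by (simp add: cocyc_def Gal_comp tor_mmul chi_mult[OF cubes_K(2) nonzero(2) s t] chi_mult[OF cubes_K(3) nonzero(3) s t] power_mult_distrib)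
  also have "\<dots> = mmul 9 (conj 9 frame (tor (chi w s ^ k) (chi v s ^ l))) (conj 9 frame (tor (chi w t ^ k) (chi v t ^ l)))"
    by (rule conj_mult[OF frame_GL tor_mats, symmetric])
  finally show "cocyc k l (s \<circ> t) = mmul 9 (cocyc k l s) (gal_act 9 s (cocyc k l t))"
    using s t by (simp add: cocyc_def gal_act_conj_tor[OF s chi_pow[OF t]])
qed

lemma cocyc_cocycle_G: "cocyc k l \<in> cocycles G"
  by (rule subsetD[OF cocycles_mono[OF _ points_T_G] cocyc_cocycle]) simp

lemma cocyc_square: "(\<lambda>s\<in>Gal. mmul 9 (cocyc k l s) (cocyc k l s)) = cocyc (2 * k) (2 * l)"
  unfolding cocyc_def
  by (rule restrict_ext) (simp add: conj_mult[OF frame_GL] tor_mmul power_add mult_2)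

lemma conj_twist_move:
  assumes s: "s \<in> Gal" and h: "h \<in> mats 9" and g: "g \<in> mats 9"
  shows "mmul 9 (mmul 9 h (conj 9 (twist s) g)) (twist s) = mmul 9 (mmul 9 h (twist s)) g"
  unfolding conj_def mmul_assoc by (simp add: GL_closed(5)[OF twist_GL[OF s]] mmul_one g)

text \<open>
  Moving \<open>frame\<close> out of the cohomology relation leaves an equation between explicit matrices in which the
  cocycles are multiplied by \<open>twist\<close>.
\<close>
lemma cohomologous_G_iff:
  assumes g: "g \<in> std" and s: "s \<in> Gal"
  shows "cocyc k' l' s = mmul 9 (mmul 9 (minv 9 (conj 9 frame g)) (cocyc k l s)) (gal_act 9 s (conj 9 frame g))
    \<longleftrightarrow> mmul 9 g (mmul 9 (tor (chi w s ^ k') (chi v s ^ l')) (twist s))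
      = mmul 9 (mmul 9 (tor (chi w s ^ k) (chi v s ^ l)) (twist s)) (gal_act 9 s g)"
    (is "?L \<longleftrightarrow> ?R")
proof -
  let ?h' = "tor (chi w s ^ k') (chi v s ^ l')" and ?h = "tor (chi w s ^ k) (chi v s ^ l)"
  let ?y = "conj 9 (twist s) (gal_act 9 s g)"
  have gG: "g \<in> GLc 9" using g std_GL by blast
  have gm: "g \<in> mats 9" by (rule GL_mats[OF gG])
  have rhs: "mmul 9 (mmul 9 (minv 9 (conj 9 frame g)) (cocyc k l s)) (gal_act 9 s (conj 9 frame g))
     = conj 9 frame (mmul 9 (minv 9 g) (mmul 9 ?h ?y))"
    unfolding minv_conj[OF frame_GL gG] gal_act_conj_frame[OF s gG]
    using s by (simp add: cocyc_def conj_mult[OF frame_GL] mmul_assoc)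
  have inj: "conj 9 frame a = conj 9 frame b \<longleftrightarrow> a = b" if "a \<in> mats 9" "b \<in> mats 9" for a b
    using conj_inverse[OF frame_GL that(1)] conj_inverse[OF frame_GL that(2)] by metis
  have "?L \<longleftrightarrow> ?h' = mmul 9 (minv 9 g) (mmul 9 ?h ?y)"
    unfolding rhs using s by (simp add: cocyc_def inj)
  also have "\<dots> \<longleftrightarrow> mmul 9 g ?h' = mmul 9 ?h ?y"
    using mmul_cancel(1,2)[OF gG] by (metis tor_mats mmul_mats)
  also have "\<dots> \<longleftrightarrow> mmul 9 (mmul 9 g ?h') (twist s) = mmul 9 (mmul 9 ?h ?y) (twist s)"
    using mmul_cancel(3)[OF twist_GL[OF s]] by (metis mmul_mats)
  also have "mmul 9 (mmul 9 ?h ?y) (twist s) = mmul 9 (mmul 9 ?h (twist s)) (gal_act 9 s g)"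
    by (rule conj_twist_move[OF s]) simp_all
  finally show ?thesis by (simp only: mmul_assoc[of 9 g])
qed

text \<open>
  After twisting by \<open>\<xi>\<close> the first factor is the matrix algebra of size 3 with a permutation action.
  It suffices to find a matrix $x$ of determinant 1 that the Galois group multiplies by \<open>\<chi>\<^sub>w\<close> while it shifts the
  indices cyclically. Among the matrices \<open>w (1 + r J)\<close>, where all entries of $J$ are 1, the determinant is
  $w^3 (1 + 3 r)$.
\<close>
lemma cohomologous_01_11: "(cocyc 0 1, cocyc 1 1) \<in> cohomologous G"
proof -
  define x where "x = (\<lambda>(i, j)\<in>idx 3. w * ((if i = j then 1 else 0) + (1 / w ^ 3 - 1) / 3))"
  have det: "det3 x = 1"
  proof -
    have f: "det3 (\<lambda>(i, j)\<in>idx 3. w * ((if i = j then 1 else 0) + r)) = w ^ 3 * (1 + 3 * r)" for r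
      by (simp add: det3_def algebra_simps power3_eq_cube)
    have e: "w ^ 3 * (1 + 3 * ((1 / w ^ 3 - 1) / 3)) = 1" using nonzero(3) by (simp add: field_simps)
    show ?thesis unfolding x_def by (rule trans[OF f e])
  qed
  define g where "g = tens x (mone 3)"
  have g: "g \<in> std" unfolding g_def mone_diag3 by (rule stdI) (simp_all add: det, simp add: x_def)
  have "cocyc 1 1 s = mmul 9 (mmul 9 (minv 9 (conj 9 frame g)) (cocyc 0 1 s)) (gal_act 9 s (conj 9 frame g))" if s: "s \<in> Gal" for s
  proof -
    let ?n = "dlog (chi u s)" and ?z = "chi v s" and ?c = "chi w s"
    have z0: "?z \<noteq> 0" by (rule cube_root_nz[OF chi_v(1)[OF s]])
    have a: "mmul 9 (tor (?c ^ 1) (?z ^ 1)) (twist s) = tens (mono3 ?n (\<lambda>j. ?c)) (mono3 ?n (\<lambda>j. 1))"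
      "mmul 9 (tor (?c ^ 0) (?z ^ 1)) (twist s) = tens (mono3 ?n (\<lambda>j. 1)) (mono3 ?n (\<lambda>j. 1))"
      using tor_twist(1)[OF s chi_pow(2)[OF s, of 1]] z0 by simp_all
    have gx: "gal_act 9 s g = tens (gal_act 3 s x) (mone 3)"
      unfolding g_def gal_act_tens[OF s] gal_act_mone[OF s] ..
    have "mmul 3 x (mono3 ?n (\<lambda>j. ?c)) = mmul 3 (mono3 ?n (\<lambda>j. 1)) (gal_act 3 s x)"
    proof (rule mats_eqI[of _ 3])
      fix i j :: nat assume ij: "i < 3" "j < 3"
      \<comment> \<open>The preimage of \<open>i\<close> under the shift by \<open>dlog (chi u s)\<close>.\<close>
      define k where "k = (i + 2 * ?n) mod 3"
      have k: "k < 3" "i = (k + ?n) mod 3"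
      proof -
        show "k < 3" by (simp add: k_def)
        have "(k + ?n) mod 3 = (i + 3 * ?n) mod 3" unfolding k_def mod_add_left_eq by (simp add: add.assoc)
        then show "i = (k + ?n) mod 3" using ij by simp
      qed
      have K3: "1 / w ^ 3 \<in> K" using cubes_K(3) is_subfieldD(2,8)[OF subfield] by blast
      have "s ((1 / w ^ 3 - 1) / 3) = (1 / w ^ 3 - 1) / 3"
        by (rule GalD(10)[OF s]) (intro is_subfieldD(2,7,8,11)[OF subfield] K3)
      then have sx: "s (x (k, j)) = ?c * x (k, j)"
        using k(1) ij by (simp add: x_def GalD[OF s] chi_w(2)[OF s])
      have "x ((k + ?n) mod 3, (j + ?n) mod 3) = x (k, j)"
        using k(1) ij shift3_inj[of k j ?n] by (auto simp: x_def)
      then show "mmul 3 x (mono3 ?n (\<lambda>j. ?c)) (i, j) = mmul 3 (mono3 ?n (\<lambda>j. 1)) (gal_act 3 s x) (i, j)"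
        unfolding k(2) mmul_mono3_right[OF ij[unfolded k(2)]] mmul_mono3_left[OF k(1) ij(2)] gal_act_entry[OF k(1) ij(2)] sx
        by (simp add: mult.commute)
    qed simp_all
    then show ?thesis
      unfolding cohomologous_G_iff[OF g s] a gx unfolding g_def tens_mmul by (simp add: mmul_one)
  qed
  note eq = this
  have gG: "conj 9 frame g \<in> points G" using g by simp
  show ?thesis
    unfolding cohomologous_iff G_simps(1)
    by (intro conjI cocyc_cocycle_G bexI[OF _ gG] ballI) (rule eq)
qed

text \<open>
  The matrix is $w^2 \sum_{p,q} y_{pq} V^p U^q$ with $U$ diagonal with entries \<open>u \<zeta>\<^sup>j\<close> and $V$ the cyclic
  permutation multiplied by $v$. This is the splitting of the symbol algebra over the algebraic closure, and
  the determinant of the sum is the reduced norm.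
\<close>
lemma det3_symbol:
  assumes E: "\<And>p j. E p j = y p 0 + u * \<zeta> ^ j * y p 1 + u * u * \<zeta> ^ (2 * j) * y p 2"
    and M: "\<And>p j. p < 3 \<Longrightarrow> j < 3 \<Longrightarrow> M ((j + p) mod 3, j) = w ^ 2 * v ^ p * E p j"
  shows "det3 M = w ^ 3 * w ^ 3 * reduced_norm (u ^ 3) (v ^ 3) \<zeta> y"
proof -
  have z4: "\<zeta> ^ 4 = \<zeta>" using zeta_facts(1) by (simp add: eval_nat_numeral)
  have E0: "E p 0 = y p 0 + u * y p 1 + u * u * y p 2" for p by (simp add: E)
  have E1: "E p 1 = y p 0 + u * \<zeta> * y p 1 + u * u * (\<zeta> * \<zeta>) * y p 2" for p by (simp add: E power2_eq_square)
  have E2: "E p 2 = y p 0 + u * (\<zeta> * \<zeta>) * y p 1 + u * u * \<zeta> * y p 2" for p by (simp add: E z4 power2_eq_square)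
  have m: "M (0, 0) = w ^ 2 * E 0 0" "M (1, 1) = w ^ 2 * E 0 1" "M (2, 2) = w ^ 2 * E 0 2"
    "M (1, 0) = w ^ 2 * v * E 1 0" "M (2, 1) = w ^ 2 * v * E 1 1" "M (0, 2) = w ^ 2 * v * E 1 2"
    "M (2, 0) = w ^ 2 * v ^ 2 * E 2 0" "M (0, 1) = w ^ 2 * v ^ 2 * E 2 1" "M (1, 2) = w ^ 2 * v ^ 2 * E 2 2"
    using M[of 0 0] M[of 0 1] M[of 0 2] M[of 1 0] M[of 1 1] M[of 1 2] M[of 2 0] M[of 2 1] M[of 2 2]
    by (simp_all flip: numeral_2_eq_2)
  have n: "E p 0 * E p 1 * E p 2 = norm3 (u * u * u) (y p 0) (y p 1) (y p 2)" for p
    unfolding E0 E1 E2 by (rule norm3_factors[OF zeta])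
  have x: "E 0 0 * E 1 1 * E 2 2 + E 0 1 * E 1 2 * E 2 0 + E 0 2 * E 1 0 * E 2 1 = mixed (u * u * u) \<zeta> y"
    unfolding E0 E1 E2 by (rule mixed_sum[OF zeta])
  have "det3 M = w ^ 3 * w ^ 3 * (E 0 0 * E 0 1 * E 0 2 + v ^ 3 * (E 1 0 * E 1 1 * E 1 2) + v ^ 3 * v ^ 3 * (E 2 0 * E 2 1 * E 2 2)
      - v ^ 3 * (E 0 0 * E 1 1 * E 2 2 + E 0 1 * E 1 2 * E 2 0 + E 0 2 * E 1 0 * E 2 1))"
    unfolding det3_def m by (simp add: algebra_simps power2_eq_square power3_eq_cube)
  then show ?thesis unfolding n x reduced_norm_def by (simp add: power3_eq_cube)
qed

text \<open>
  Absorbing the diagonal factor of \<open>g\<close> into its first factor gives a matrix $M$ of determinant 1 on which the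
  Galois group acts by characters and a simultaneous cyclic shift of the indices. Along each cyclic
  diagonal of $M$ a finite Fourier transform diagonalises the shift. The transformed entries are eigenvectors, so
  they are products of powers of $w$, $v$, $u$ with elements $Y_{pq}$ of $K$. Then \<open>det3_symbol\<close> turns
  $\det M = 1$ into $c^2 \cdot \mathrm{Nrd}(Y) = 1$.
\<close>
lemma not_cohomologous_02_22: "(cocyc 0 2, cocyc 2 2) \<notin> cohomologous G"
proof
  assume "(cocyc 0 2, cocyc 2 2) \<in> cohomologous G"
  then obtain g0 where g0: "g0 \<in> points G" and eq0: "\<forall>s\<in>Gal. cocyc 2 2 s = mmul 9 (mmul 9 (minv 9 g0) (cocyc 0 2 s)) (gal_act 9 s g0)"
    unfolding cohomologous_iff by auto
  obtain g where g: "g0 = conj 9 frame g" "g \<in> std" using g0 by auto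
  obtain x y where xy: "g = tens x (diag3 y)" "x \<in> mats 3" "det3 x * (y 0 * y 1 * y 2) = 1" using g(2) by (rule stdE)
  define M where "M = (\<lambda>(k, l). x (k, l) * y l)"
  have detM: "det3 M = 1"
  proof -
    have "det3 M = det3 x * (y 0 * y 1 * y 2)" unfolding det3_def M_def by (simp add: algebra_simps)
    then show ?thesis using xy(3) by simp
  qed
  have sM: "s (M (k, l)) = chi w s ^ 2 * chi v s ^ k * inverse (chi v s) ^ l * M ((k + dlog (chi u s)) mod 3, (l + dlog (chi u s)) mod 3)"
    if s: "s \<in> Gal" and kl: "k < 3" "l < 3" for s k l
  proof -
    let ?n = "dlog (chi u s)" and ?z = "chi v s" and ?c = "chi w s"
    have z0: "?z \<noteq> 0" by (rule cube_root_nz[OF chi_v(1)[OF s]])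
    have zz: "inverse (?z ^ 2) * ?z = inverse ?z" "?z ^ 2 * inverse ?z = ?z" using z0 by (simp_all add: power2_eq_square)
    have a: "mmul 9 (tor (?c ^ 2) (?z ^ 2)) (twist s) = tens (mono3 ?n (\<lambda>j. ?c ^ 2 * inverse ?z ^ j)) (mono3 ?n (\<lambda>j. ?z ^ j))"
      "mmul 9 (tor (?c ^ 0) (?z ^ 2)) (twist s) = tens (mono3 ?n (\<lambda>j. inverse ?z ^ j)) (mono3 ?n (\<lambda>j. ?z ^ j))"
      unfolding tor_twist(1)[OF s chi_pow(2)[OF s, of 2]] zz by simp_all
    have "mmul 9 g (mmul 9 (tor (?c ^ 2) (?z ^ 2)) (twist s)) = mmul 9 (mmul 9 (tor (?c ^ 0) (?z ^ 2)) (twist s)) (gal_act 9 s g)"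
      using cohomologous_G_iff[OF g(2) s, of 2 2 0 2] eq0 s unfolding g(1) by blast
    then have "tens (mmul 3 x (mono3 ?n (\<lambda>j. ?c ^ 2 * inverse ?z ^ j))) (mmul 3 (diag3 y) (mono3 ?n (\<lambda>j. ?z ^ j)))
       = tens (mmul 3 (mono3 ?n (\<lambda>j. inverse ?z ^ j)) (gal_act 3 s x)) (mmul 3 (mono3 ?n (\<lambda>j. ?z ^ j)) (diag3 (\<lambda>i. s (y i))))"
      (is "?A = ?B") unfolding a xy(1) gal_act_tens[OF s] gal_act_diag3[OF s] tens_mmul .
    \<comment> \<open>In the diagonal block with column index \<open>l\<close>, only the shifted row index contributes. So one entry of the
      matrix equation determines \<open>s (M (k, l))\<close>.\<close>
    then have AB: "?A (3 * ((l + ?n) mod 3) + (k + ?n) mod 3, 3 * l + l) = ?B (3 * ((l + ?n) mod 3) + (k + ?n) mod 3, 3 * l + l)" by simp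
    have i9: "3 * ((l + ?n) mod 3) + (k + ?n) mod 3 < 9" "3 * l + l < 9"
    proof -
      have "(l + ?n) mod 3 < 3" "(k + ?n) mod 3 < 3" by simp_all
      then show "3 * ((l + ?n) mod 3) + (k + ?n) mod 3 < 9" by linarith
      show "3 * l + l < 9" using kl(2) by linarith
    qed
    have dm: "(3 * ((l + ?n) mod 3) + (k + ?n) mod 3) mod 3 = (k + ?n) mod 3"
      "(3 * ((l + ?n) mod 3) + (k + ?n) mod 3) div 3 = (l + ?n) mod 3" "(3 * l + l) mod 3 = l" "(3 * l + l) div 3 = l"
      by (simp, simp) (rule less3E[OF kl(2)]; simp)+
    have m3: "(k + ?n) mod 3 < 3" "(l + ?n) mod 3 < 3" by simp_all
    have "x ((k + ?n) mod 3, (l + ?n) mod 3) * (?c ^ 2 * inverse ?z ^ l) * (diag3 y ((l + ?n) mod 3, (l + ?n) mod 3) * ?z ^ l)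
       = inverse ?z ^ k * gal_act 3 s x (k, l) * (?z ^ l * diag3 (\<lambda>i. s (y i)) (l, l))"
      using AB unfolding tens_entry[OF i9] dm mmul_mono3_right[OF m3(1) kl(2)] mmul_mono3_right[OF m3(2) kl(2)]
        mmul_mono3_left[OF kl(1,2)] mmul_mono3_left[OF kl(2,2)] .
    then have "?c ^ 2 * M ((k + ?n) mod 3, (l + ?n) mod 3) * (inverse ?z ^ l * ?z ^ l) = inverse ?z ^ k * ?z ^ l * s (M (k, l))"
      using kl by (simp add: diag3_entry gal_act_entry M_def GalD(2)[OF s] mult_ac)
    moreover have "inverse ?z ^ l * ?z ^ l = 1" using z0 by (simp flip: power_mult_distrib)
    ultimately have e: "?c ^ 2 * M ((k + ?n) mod 3, (l + ?n) mod 3) = inverse ?z ^ k * ?z ^ l * s (M (k, l))" by simp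
    have "?z ^ k * inverse ?z ^ l * (inverse ?z ^ k * ?z ^ l) = (?z * inverse ?z) ^ k * (?z * inverse ?z) ^ l"
      by (simp add: power_mult_distrib mult_ac)
    also have "\<dots> = 1" using z0 by simp
    finally have "s (M (k, l)) = ?z ^ k * inverse ?z ^ l * (inverse ?z ^ k * ?z ^ l * s (M (k, l)))" by (simp only: mult.assoc[symmetric] mult_1_left)
    then show ?thesis unfolding e[symmetric] by (simp add: mult_ac)
  qed
  \<comment> \<open>The exponent \<open>2 * q * j\<close> stands for \<open>- q * j\<close>, as \<open>\<zeta>\<close> has order 3.\<close>
  define f where "f = (\<lambda>p q. (\<Sum>j<3. M ((j + p) mod 3, j) * \<zeta> ^ (2 * q * j)) / 3)"
  have sf: "s (f p q) = chi w s ^ 2 * chi v s ^ p * chi u s ^ q * f p q" if s: "s \<in> Gal" for s p q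
  proof -
    let ?n = "dlog (chi u s)" and ?z = "chi v s" and ?c = "chi w s"
    have z0: "?z \<noteq> 0" by (rule cube_root_nz[OF chi_v(1)[OF s]])
    have sz: "s (\<zeta> ^ i) = \<zeta> ^ i" for i using GalD(10)[OF s zeta_K] by (simp add: GalD(9)[OF s])
    define F where "F = (\<lambda>i. M ((i + p) mod 3, i) * \<zeta> ^ (2 * q * i))"
    have t: "s (M ((j + p) mod 3, j) * \<zeta> ^ (2 * q * j)) = ?c ^ 2 * ?z ^ p * chi u s ^ q * F ((j + ?n) mod 3)" if j: "j < 3" for j
    proof -
      have "?z ^ ((j + p) mod 3) * inverse ?z ^ j = ?z ^ p * (?z * inverse ?z) ^ j"
        unfolding cube_root_pow_mod[OF chi_v(1)[OF s]] by (simp add: power_add power_mult_distrib mult_ac)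
      also have "\<dots> = ?z ^ p" using z0 by simp
      finally have zp: "?z ^ ((j + p) mod 3) * inverse ?z ^ j = ?z ^ p" .
      have idx: "((j + p) mod 3 + ?n) mod 3 = ((j + ?n) mod 3 + p) mod 3" by (simp add: mod_simps add_ac)
      have "\<zeta> ^ (2 * q * ((j + ?n) mod 3)) = (\<zeta> ^ ((j + ?n) mod 3)) ^ (2 * q)" by (simp flip: power_mult add: mult.commute)
      also have "\<dots> = (\<zeta> ^ j * chi u s) ^ (2 * q)"
        unfolding cube_root_pow_mod[OF zeta_facts(1)] power_add zeta_pow_dlog[OF chi_u(1)[OF s]] ..
      also have "\<dots> = \<zeta> ^ (2 * q * j) * chi u s ^ (2 * q)" by (simp add: power_mult_distrib mult.commute flip: power_mult)
      finally have "chi u s ^ q * \<zeta> ^ (2 * q * ((j + ?n) mod 3)) = \<zeta> ^ (2 * q * j) * (chi u s ^ 3) ^ q"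
        by (simp add: power3_eq_cube power_mult_distrib power_mult power2_eq_square mult_ac)
      then have zq: "chi u s ^ q * \<zeta> ^ (2 * q * ((j + ?n) mod 3)) = \<zeta> ^ (2 * q * j)" by (simp add: chi_u(1)[OF s])
      have "s (M ((j + p) mod 3, j) * \<zeta> ^ (2 * q * j)) = ?c ^ 2 * (?z ^ ((j + p) mod 3) * inverse ?z ^ j) * M (((j + ?n) mod 3 + p) mod 3, (j + ?n) mod 3) * \<zeta> ^ (2 * q * j)"
        using j by (simp add: GalD(2)[OF s] sz sM[OF s] idx)
      then show ?thesis unfolding zp F_def zq[symmetric] by (simp add: mult_ac)
    qed
    have "s (f p q) = (\<Sum>j<3. s (M ((j + p) mod 3, j) * \<zeta> ^ (2 * q * j))) / 3"
    proof -
      have "s 3 = 3" by (rule GalD(10)[OF s is_subfieldD(11)[OF subfield]])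
      then show ?thesis unfolding f_def GalD(8)[OF s] Gal_sum[OF s] by simp
    qed
    also have "\<dots> = ?c ^ 2 * ?z ^ p * chi u s ^ q * (\<Sum>j<3. F ((j + ?n) mod 3)) / 3"
      by (simp add: t sum_distrib_left)
    also have "(\<Sum>j<3. F ((j + ?n) mod 3)) = (\<Sum>j<3. F j)" by (rule sum_shift3[OF dlog_less])
    finally show ?thesis by (simp add: f_def F_def)
  qed
  define Y where "Y = (\<lambda>p q. f p q / (w ^ 2 * v ^ p * u ^ q))"
  have YK: "Y p q \<in> K" for p q
  proof (rule Gal_fixed)
    fix s assume s: "s \<in> Gal"
    note nz = cube_root_nz[OF chi_u(1)[OF s]] cube_root_nz[OF chi_v(1)[OF s]] cube_root_nz[OF chi_w(1)[OF s]]
    show "s (Y p q) = Y p q"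
      unfolding Y_def GalD(8)[OF s] sf[OF s]
      using nz nonzero by (simp add: GalD(2,9)[OF s] chi_u(2)[OF s] chi_v(2)[OF s] chi_w(2)[OF s] power_mult_distrib field_simps)
  qed
  have "det3 M = w ^ 3 * w ^ 3 * reduced_norm (u ^ 3) (v ^ 3) \<zeta> Y"
  proof (rule det3_symbol[OF refl])
    fix p j :: nat assume p: "p < 3" and j: "j < 3"
    have f: "f p q = w ^ 2 * v ^ p * u ^ q * Y p q" for q using nonzero by (simp add: Y_def)
    \<comment> \<open>Fourier inversion.\<close>
    have inv: "f p 0 + \<zeta> ^ j * f p 1 + \<zeta> ^ (2 * j) * f p 2 = M ((j + p) mod 3, j)"
    proof -
      have z4: "\<zeta> ^ 4 = \<zeta>" using zeta_facts(1) by (simp add: eval_nat_numeral)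
      have z8: "\<zeta> ^ 8 = \<zeta> * \<zeta>" using zeta_facts(1) by (simp add: eval_nat_numeral)
      have z2: "\<zeta> * \<zeta> = - 1 - \<zeta>" using group_add_class.minus_unique[OF zeta, symmetric] by simp
      have z2': "\<zeta> * (\<zeta> * x) = - x - \<zeta> * x" for x unfolding mult.assoc[symmetric] z2 by (simp add: algebra_simps)
      show ?thesis
        by (rule less3E[OF j]) (simp_all add: f_def sum3 z4 z8 power2_eq_square z2 z2' field_simps flip: numeral_2_eq_2)
    qed
    have "w ^ 2 * v ^ p * (Y p 0 + u * \<zeta> ^ j * Y p 1 + u * u * \<zeta> ^ (2 * j) * Y p 2) = f p 0 + \<zeta> ^ j * f p 1 + \<zeta> ^ (2 * j) * f p 2"
      unfolding f by (simp add: algebra_simps power2_eq_square)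
    then show "M ((j + p) mod 3, j) = w ^ 2 * v ^ p * (Y p 0 + u * \<zeta> ^ j * Y p 1 + u * u * \<zeta> ^ (2 * j) * Y p 2)"
      unfolding inv by simp
  qed
  then have "w ^ 3 * w ^ 3 * reduced_norm (u ^ 3) (v ^ 3) \<zeta> Y = 1" using detM by simp
  moreover have "w ^ 3 * w ^ 3 * reduced_norm (u ^ 3) (v ^ 3) \<zeta> Y \<noteq> 1"
    using not_norm[unfolded no_norm_def] YK by simp
  ultimately show False by simp
qed

lemma inclusion_alg_hom: "id \<in> alg_hom K T G"
proof (rule alg_homI)
  show "id \<in> hom (grp T) (grp G)" by (rule homI) (use points_T_G in auto)
  show "points T \<subseteq> GLc (deg T)" using T_GL by simp
  fix i j assume "i < deg G" "j < deg G"
  then show "\<exists>f. regular K (deg T) f \<and> (\<forall>g\<in>points T. id g (i, j) = f g)"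
    by (intro exI[of _ "\<lambda>g. g (i, j)"]) (simp add: regular_entry)
qed

text \<open>
  Squares of the classes of \<open>cocyc 0 1\<close> and \<open>cocyc 1 1\<close> are computed in the torus and compared in \<open>G\<close>.
\<close>
theorem no_power_operation: "\<not> power_operation 2 p"
proof
  assume p: "power_operation 2 p"
  have p_tor: "\<And>T \<xi>. K_torus T \<and> \<xi> \<in> H1 T \<Longrightarrow> p T \<xi> = \<xi> [^]\<^bsub>H1_group T\<^esub> (2::int)"
    and p_nat: "\<And>G G' \<phi> \<xi>. reductive G \<and> reductive G' \<and> \<phi> \<in> alg_hom K G G' \<and> \<xi> \<in> H1 G \<Longrightarrow>
       H1_map G' \<phi> (p G \<xi>) = p G' (H1_map G' \<phi> \<xi>)"
    using p unfolding power_operation_def by simp_all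
  let ?cT = "\<lambda>k l. cohomologous T `` {cocyc k l}" and ?cG = "\<lambda>k l. cohomologous G `` {cocyc k l}"
  have map: "H1_map G id (?cT k l) = ?cG k l" for k l
    by (rule H1_map_inclusion[OF galois_stable_G _ points_T_G galois_stable_T cocyc_cocycle]) simp
  have inT: "?cT k l \<in> H1 T" for k l by (rule class_in_H1[OF galois_stable_T refl cocyc_cocycle])
  have pT: "p T (?cT k l) = ?cT (2 * k) (2 * l)" for k l
  proof -
    have "p T (?cT k l) = ?cT k l [^]\<^bsub>H1_group T\<^esub> (2::int)"
      by (intro p_tor conjI K_torus_T inT)
    also have "\<dots> = cohomologous T `` {\<lambda>s\<in>Gal. mmul 9 (cocyc k l s) (cocyc k l s)}"
      using H1_square_class[OF galois_stable_T T_simps(1)[symmetric] points_T_commute cocyc_cocycle] .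
    finally show ?thesis unfolding cocyc_square .
  qed
  have pG: "p G (?cG k l) = ?cG (2 * k) (2 * l)" for k l
  proof -
    have "H1_map G id (p T (?cT k l)) = p G (H1_map G id (?cT k l))"
      by (intro p_nat conjI reductive_T reductive_G inclusion_alg_hom inT)
    then show ?thesis unfolding pT map ..
  qed
  have "?cG 0 1 = ?cG 1 1"
    by (rule iffD2[OF class_eq_iff[OF galois_stable_G refl cocyc_cocycle_G cocyc_cocycle_G] cohomologous_01_11])
  then have "?cG 0 2 = ?cG 2 2" using pG[of 0 1] pG[of 1 1] by simp
  from iffD1[OF class_eq_iff[OF galois_stable_G refl cocyc_cocycle_G cocyc_cocycle_G] this] not_cohomologous_02_22 show False by (rule notE[rotated])
qed

end

theorem theorem1p3:
  shows "\<exists>(L :: complex ring) (K :: complex set) (n :: int).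
    algebraic_closure L K \<and> \<not> (\<exists>p. algebraic_closure.power_operation L K n p)"
proof -
  obtain K :: "complex set" and a b c \<zeta> where K: "is_subfield K" "a \<in> K" "b \<in> K" "c \<in> K" "\<zeta> \<in> K"
    "a \<noteq> 0" "b \<noteq> 0" "c \<noteq> 0" "1 + \<zeta> + \<zeta> * \<zeta> = 0" "no_norm a b c \<zeta> K" "\<And>t. \<not> transc K t"
    by (rule exists_base_field[OF that])
  have "\<exists>z. z ^ 3 = x" for x :: complex
  proof -
    obtain z where "poly [:- x, 0, 0, 1:] z = 0"
      using alg_closed_imp_poly_has_root[of "[:- x, 0, 0, 1:]"] by auto
    then have "z ^ 3 = x" by (simp add: power3_eq_cube algebra_simps)
    then show ?thesis ..
  qed
  then obtain u v w where uvw: "u ^ 3 = a" "v ^ 3 = b" "w ^ 3 = c" by metis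
  interpret symbol_setup K \<zeta> u v w
    by unfold_locales (use K uvw in auto)
  show ?thesis
    by (intro exI[of _ LC] exI[of _ K] exI[of _ "2 :: int"] conjI notI, rule algebraic_closure_axioms)
      (elim exE notE[OF no_power_operation])
qed

end
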